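(* Let $k$ be a field, let $G$ be a weakly chordal (finite simple) graph with vertex set $[n]=\{1,\ldots,n\}$ and with at least one edge, let $R=k[x_1,\ldots,x_n]$, and let $I(G)\subset R$ be the edge ideal of $G$. Let $\sigma\subseteq[n]$ with $\sigma\neq\emptyset$ and let $r$ be an integer. If $\beta_{|\sigma|-r,\sigma}(R/I(G))\neq 0$, then there exists a strongly disjoint family $\{B_1,\ldots,B_r\}$ of complete bipartite subgraphs of $G$ such that $\sigma=V(B_1)\cup\cdots\cup V(B_r)$.
   Context: All graphs are finite and simple. $V(H)$ and $E(H)$ denote the vertex set and the edge set of a graph $H$. The complement $\overline{G}$ of $G$ is the graph on the same vertex set in which two distinct vertices are adjacent if and only if they are not adjacent in $G$. A graph $G$ is weakly chordal if neither $G$ nor $\overline{G}$ contains an induced cycle with five or more vertices. The edge ideal $I(G)\subset R=k[x_1,\ldots,x_n]$ is the ideal generated by the monomials $x_ix_j$ such that $\{i,j\}$ is an edge of $G$. The ring $R$ carries its canonical $\mathbb{Z}^n$-grading. For a finitely generated $\mathbb{Z}^n$-graded $R$-module $M$, the multigraded Betti numbers are $\beta_{i,\sigma}(M)=\dim_k \operatorname{Tor}_i^R(M,k)_\sigma$ for $\sigma\in\mathbb{Z}^n$. A subset $\sigma\subseteq[n]$ is identified with its characteristic vector in $\{0,1\}^n\subset\mathbb{Z}^n$, and $|\sigma|$ denotes its number of elements. Two edges $e$ and $f$ of $G$ are called $3$-disjoint if they have no vertex in common and no endpoint of $e$ is adjacent in $G$ to an endpoint of $f$. A family $\{B_1,\ldots,B_r\}$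 of complete bipartite subgraphs of $G$ (not necessarily induced subgraphs) is called strongly disjoint if $V(B_i)\cap V(B_j)=\emptyset$ for all $i\neq j$ and there are edges $e_1,\ldots,e_r$, with $e_i\in E(B_i)$ for each $i$, which are pairwise $3$-disjoint in $G$. *)

theory Defs
  imports
    "HOL-Algebra.Module"
    "HOL-Algebra.QuotRing"
    "HOL-Library.Poly_Mapping"
    "HOL-Library.Indicator_Function"
begin

section \<open>Graphs\<close>

record 'v graph =
  verts :: "'v set"
  edges :: "'v set set"

definition simple_graph :: "'v graph \<Rightarrow> bool" where
  "simple_graph G \<longleftrightarrow> finite (verts G) \<and> (\<forall>e\<in>edges G. e \<subseteq> verts G \<and> card e = 2)"

definition complement :: "'v graph \<Rightarrow> 'v graph" where
  "complement G = \<lparr>verts = verts G,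
     edges = {{u, v} | u v. u \<in> verts G \<and> v \<in> verts G \<and> u \<noteq> v \<and> {u, v} \<notin> edges G}\<rparr>"

text \<open>The vertices \<open>c ! 0, c ! 1, \<dots>\<close>, listed in cyclic order, induce a cycle of length
  \<open>length c\<close>; meaningful for \<open>length c \<ge> 3\<close>.\<close>

definition induced_cycle :: "'v graph \<Rightarrow> 'v list \<Rightarrow> bool" where
  "induced_cycle G c \<longleftrightarrow> set c \<subseteq> verts G \<and> distinct c \<and>
     (\<forall>i<length c. \<forall>j<length c. {c ! i, c ! j} \<in> edges G \<longleftrightarrow>
        j = Suc i mod length c \<or> i = Suc j mod length c)"

definition weakly_chordal :: "'v graph \<Rightarrow> bool" where
  "weakly_chordal G \<longleftrightarrow>
     (\<nexists>c. length c \<ge> 5 \<and> (induced_cycle G c \<or> induced_cycle (complement G) c))"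

definition subgraph :: "'v graph \<Rightarrow> 'v graph \<Rightarrow> bool" where
  "subgraph B G \<longleftrightarrow> verts B \<subseteq> verts G \<and> edges B \<subseteq> edges G"

definition complete_bipartite :: "'v graph \<Rightarrow> bool" where
  "complete_bipartite B \<longleftrightarrow> (\<exists>X Y. X \<noteq> {} \<and> Y \<noteq> {} \<and> X \<inter> Y = {} \<and> finite X \<and> finite Y \<and>
     verts B = X \<union> Y \<and> edges B = {{x, y} | x y. x \<in> X \<and> y \<in> Y})"

definition three_disjoint :: "'v graph \<Rightarrow> 'v set \<Rightarrow> 'v set \<Rightarrow> bool" where
  "three_disjoint G e f \<longleftrightarrow> e \<inter> f = {} \<and> (\<forall>u\<in>e. \<forall>v\<in>f. {u, v} \<notin> edges G)"

text \<open>The family \<open>{B\<^sub>1, \<dots>, B\<^sub>r}\<close> is given as the list \<open>[B\<^sub>1, \<dots>, B\<^sub>r]\<close>.\<close>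

definition strongly_disjoint :: "'v graph \<Rightarrow> 'v graph list \<Rightarrow> bool" where
  "strongly_disjoint G Bs \<longleftrightarrow>
     (\<forall>B\<in>set Bs. complete_bipartite B \<and> subgraph B G) \<and>
     (\<forall>i<length Bs. \<forall>j<length Bs. i \<noteq> j \<longrightarrow> verts (Bs ! i) \<inter> verts (Bs ! j) = {}) \<and>
     (\<exists>e. (\<forall>i<length Bs. e i \<in> edges (Bs ! i)) \<and>
          (\<forall>i<length Bs. \<forall>j<length Bs. i \<noteq> j \<longrightarrow> three_disjoint G (e i) (e j)))"


section \<open>The polynomial ring and edge ideals\<close>

text \<open>The finite type \<open>'n\<close> plays the role of \<open>[n]\<close>: a polynomial over \<open>'k\<close> in the variables
  \<open>x\<^sub>v\<close>, \<open>v :: 'n\<close>, maps exponent vectors to coefficients.\<close>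

type_synonym ('n, 'k) mpoly = "('n \<Rightarrow>\<^sub>0 nat) \<Rightarrow>\<^sub>0 'k"

definition poly_ring :: "('n, 'k::field) mpoly ring" where
  "poly_ring = \<lparr>carrier = UNIV, mult = (*), one = 1, zero = 0, add = (+)\<rparr>"

definition Var :: "'n \<Rightarrow> ('n, 'k::field) mpoly" where
  "Var v = Poly_Mapping.single (Poly_Mapping.single v 1) 1"

definition edge_ideal :: "'n graph \<Rightarrow> ('n, 'k::field) mpoly set" where
  "edge_ideal G = Idl\<^bsub>poly_ring\<^esub> {Var u * Var v | u v. {u, v} \<in> edges G}"


section \<open>Multigraded modules\<close>

text \<open>Elements of \<open>\<int>\<^sup>n\<close> are functions \<open>'n \<Rightarrow> int\<close>. The \<open>mult\<close> and \<open>one\<close> fields that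
  \<^typ>\<open>('a, 'b) module\<close> inherits from rings are irrelevant for modules.\<close>

record (overloaded) ('n, 'k, 'm) graded_module = "(('n, 'k) mpoly, 'm) module" +
  component :: "('n \<Rightarrow> int) \<Rightarrow> 'm set"

definition homogeneous :: "('n \<Rightarrow> int) \<Rightarrow> ('n, 'k::field) mpoly \<Rightarrow> bool" where
  "homogeneous a p \<longleftrightarrow> (\<forall>m\<in>Poly_Mapping.keys p. \<forall>v. int (Poly_Mapping.lookup m v) = a v)"

definition quotient_module ::
    "('n, 'k::field) mpoly set \<Rightarrow> ('n, 'k, ('n, 'k) mpoly set) graded_module" where
  "quotient_module I =
     \<lparr>carrier = carrier (poly_ring Quot I), mult = mult (poly_ring Quot I),
      one = one (poly_ring Quot I), zero = zero (poly_ring Quot I),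
      add = add (poly_ring Quot I),
      smult = (\<lambda>p X. (I +>\<^bsub>poly_ring\<^esub> p) \<otimes>\<^bsub>poly_ring Quot I\<^esub> X),
      component = (\<lambda>a. {I +>\<^bsub>poly_ring\<^esub> p | p. homogeneous a p})\<rparr>"

text \<open>The graded free module \<open>R(-s 0) \<oplus> \<dots> \<oplus> R(-s (b - 1))\<close>, whose \<open>j\<close>-th basis element has
  degree \<open>s j\<close>.\<close>

definition free_module ::
    "nat \<Rightarrow> (nat \<Rightarrow> 'n \<Rightarrow> int) \<Rightarrow> ('n, 'k::field, nat \<Rightarrow>\<^sub>0 ('n, 'k) mpoly) graded_module" where
  "free_module b s =
     \<lparr>carrier = {f. Poly_Mapping.keys f \<subseteq> {..<b}},
      mult = undefined, one = undefined, zero = 0, add = (+),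
      smult = (\<lambda>p. Poly_Mapping.map ((*) p)),
      component = (\<lambda>a. {f. Poly_Mapping.keys f \<subseteq> {..<b} \<and>
        (\<forall>j<b. homogeneous (\<lambda>v. a v - s j v) (Poly_Mapping.lookup f j))})\<rparr>"

definition graded_hom ::
    "('n, 'k, 'm) graded_module \<Rightarrow> ('n, 'k::field, 'l) graded_module \<Rightarrow> ('m \<Rightarrow> 'l) \<Rightarrow> bool" where
  "graded_hom M N h \<longleftrightarrow> h \<in> carrier M \<rightarrow> carrier N \<and>
     (\<forall>x\<in>carrier M. \<forall>y\<in>carrier M. h (x \<oplus>\<^bsub>M\<^esub> y) = h x \<oplus>\<^bsub>N\<^esub> h y) \<and>
     (\<forall>p. \<forall>x\<in>carrier M. h (p \<odot>\<^bsub>M\<^esub> x) = p \<odot>\<^bsub>N\<^esub> h x) \<and>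
     (\<forall>a. h ` component M a \<subseteq> component N a)"


section \<open>Graded free resolutions, Tor and Betti numbers\<close>

text \<open>Data for a complex \<open>\<dots> \<rightarrow> F\<^sub>2 \<rightarrow> F\<^sub>1 \<rightarrow> F\<^sub>0 \<rightarrow> M\<close> of graded modules with \<open>F\<^sub>i\<close> free of rank
  \<open>rank i\<close> with basis degrees \<open>shift i\<close>; \<open>diff i\<close> is the map \<open>F\<^sub>i\<^sub>+\<^sub>1 \<rightarrow> F\<^sub>i\<close>.\<close>

record (overloaded) ('n, 'k, 'm) free_complex =
  rank :: "nat \<Rightarrow> nat"
  shift :: "nat \<Rightarrow> nat \<Rightarrow> 'n \<Rightarrow> int"
  diff :: "nat \<Rightarrow> (nat \<Rightarrow>\<^sub>0 ('n, 'k) mpoly) \<Rightarrow> (nat \<Rightarrow>\<^sub>0 ('n, 'k) mpoly)"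
  aug :: "(nat \<Rightarrow>\<^sub>0 ('n, 'k) mpoly) \<Rightarrow> 'm"

definition term_at ::
    "('n, 'k::field, 'm) free_complex \<Rightarrow> nat \<Rightarrow> ('n, 'k, nat \<Rightarrow>\<^sub>0 ('n, 'k) mpoly) graded_module" where
  "term_at F i = free_module (rank F i) (shift F i)"

definition graded_free_resolution ::
    "('n, 'k::field, 'm) graded_module \<Rightarrow> ('n, 'k, 'm) free_complex \<Rightarrow> bool" where
  "graded_free_resolution M F \<longleftrightarrow>
     graded_hom (term_at F 0) M (aug F) \<and>
     (\<forall>i. graded_hom (term_at F (Suc i)) (term_at F i) (diff F i)) \<and>
     aug F ` carrier (term_at F 0) = carrier M \<and>
     diff F 0 ` carrier (term_at F 1) = {f \<in> carrier (term_at F 0). aug F f = \<zero>\<^bsub>M\<^esub>} \<and>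
     (\<forall>i. diff F (Suc i) ` carrier (term_at F (Suc (Suc i))) =
          {f \<in> carrier (term_at F (Suc i)). diff F i f = 0})"

abbreviation vec_scale :: "'k::field \<Rightarrow> (nat \<Rightarrow>\<^sub>0 'k) \<Rightarrow> (nat \<Rightarrow>\<^sub>0 'k)" where
  "vec_scale c \<equiv> Poly_Mapping.map ((*) c)"

lemma lookup_vec_scale: "Poly_Mapping.lookup (vec_scale c v) j = c * Poly_Mapping.lookup v j"
  by (simp add: map.rep_eq when_def)

global_interpretation vec: vector_space "vec_scale :: 'k::field \<Rightarrow> _"
  by unfold_locales
    (auto intro!: poly_mapping_eqI simp: lookup_vec_scale lookup_add algebra_simps)

text \<open>Since \<open>F\<^sub>i\<close> is free, \<open>F\<^sub>i \<otimes>\<^sub>R k\<close> with \<open>k = R/(x\<^sub>1, \<dots>, x\<^sub>n)\<close> is the \<open>k\<close>-vector space on the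
  basis of \<open>F\<^sub>i\<close>, realised inside \<^typ>\<open>nat \<Rightarrow>\<^sub>0 'k\<close>. Its component of degree \<open>a\<close> is spanned by the
  basis elements of degree \<open>a\<close>, and \<open>f \<mapsto> f \<otimes> 1\<close> takes constant coefficients.\<close>

definition tensor_component ::
    "('n, 'k::field, 'm) free_complex \<Rightarrow> nat \<Rightarrow> ('n \<Rightarrow> int) \<Rightarrow> (nat \<Rightarrow>\<^sub>0 'k) set" where
  "tensor_component F i a = {v. Poly_Mapping.keys v \<subseteq> {j. j < rank F i \<and> shift F i j = a}}"

definition tensor_one :: "(nat \<Rightarrow>\<^sub>0 ('n, 'k::field) mpoly) \<Rightarrow> (nat \<Rightarrow>\<^sub>0 'k)" where
  "tensor_one = Poly_Mapping.map (\<lambda>p. Poly_Mapping.lookup p 0)"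

definition const_lift :: "(nat \<Rightarrow>\<^sub>0 'k::field) \<Rightarrow> (nat \<Rightarrow>\<^sub>0 ('n, 'k) mpoly)" where
  "const_lift = Poly_Mapping.map (Poly_Mapping.single 0)"

text \<open>The map \<open>F\<^sub>i\<^sub>+\<^sub>1 \<otimes> k \<rightarrow> F\<^sub>i \<otimes> k\<close> induced by the differential.\<close>

definition tensor_diff ::
    "('n, 'k::field, 'm) free_complex \<Rightarrow> nat \<Rightarrow> (nat \<Rightarrow>\<^sub>0 'k) \<Rightarrow> (nat \<Rightarrow>\<^sub>0 'k)" where
  "tensor_diff F i v = tensor_one (diff F i (const_lift v))"

definition tor_cycles ::
    "('n, 'k::field, 'm) free_complex \<Rightarrow> nat \<Rightarrow> ('n \<Rightarrow> int) \<Rightarrow> (nat \<Rightarrow>\<^sub>0 'k) set" where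
  "tor_cycles F i a =
     {v \<in> tensor_component F i a. case i of 0 \<Rightarrow> True | Suc l \<Rightarrow> tensor_diff F l v = 0}"

definition tor_boundaries ::
    "('n, 'k::field, 'm) free_complex \<Rightarrow> nat \<Rightarrow> ('n \<Rightarrow> int) \<Rightarrow> (nat \<Rightarrow>\<^sub>0 'k) set" where
  "tor_boundaries F i a = tensor_diff F i ` tensor_component F (Suc i) a"

text \<open>The dimension of the degree \<open>a\<close> part of \<open>H\<^sub>i(F \<otimes> k)\<close>. All spaces involved are
  finite-dimensional, and for a complex the boundaries lie in the cycles, so the difference
  is the dimension of the quotient.\<close>

definition tor_dim ::
    "('n, 'k::field, 'm) free_complex \<Rightarrow> nat \<Rightarrow> ('n \<Rightarrow> int) \<Rightarrow> nat" where
  "tor_dim F i a = vec.dim (tor_cycles F i a) - vec.dim (tor_boundaries F i a)"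

text \<open>Tor is computed from an arbitrarily chosen graded free resolution; the result does
  not depend on the choice. A resolution by free modules of finite rank exists for every finitely
  generated graded module. The homological degree is an integer, and Tor vanishes in negative
  degrees.\<close>

definition multigraded_betti ::
    "('n, 'k::field, 'm) graded_module \<Rightarrow> int \<Rightarrow> ('n \<Rightarrow> int) \<Rightarrow> nat" where
  "multigraded_betti M i a =
     (if i < 0 then 0 else tor_dim (SOME F. graded_free_resolution M F) (nat i) a)"

end

theory Submission
  imports Defs
begin

text \<open>
  A multigraded Betti number \<open>\<beta>\<^bsub>i,a\<^esub>\<close> vanishes as soon as some graded free resolution, minimal or
  not, has no basis element of degree \<open>a\<close> in position \<open>i\<close> (lemma \<open>tor_vanishes\<close>). It therefore
  suffices to construct, for every weakly chordal graph, one resolution of \<open>R/I(G)\<close> all of whose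
  basis degrees are explained by strongly disjoint families.

  The construction removes one edge \<open>e = xy\<close> at a time. Multiplication by the product of the two
  variables of \<open>e\<close> gives an exact sequence
  \<open>0 \<rightarrow> (R/(I(G - e) : e))(-e) \<rightarrow> R/I(G - e) \<rightarrow> R/I(G) \<rightarrow> 0\<close>, and the colon ideal is generated by the
  variables in \<open>N = (N(x) \<union> N(y)) - e\<close> together with the edge ideal of \<open>G - N[e]\<close>. So a mapping cone
  turns resolutions for \<open>G - e\<close> and for \<open>G - N[e]\<close> into one for \<open>G\<close>. Its basis degrees are those of
  \<open>G - e\<close> and the sets \<open>e \<union> T \<union> \<tau>\<close> with \<open>T \<subseteq> N\<close> and \<open>\<tau>\<close> coming from \<open>G - N[e]\<close>; in the second case a
  complete bipartite graph on \<open>e \<union> T\<close> that contains \<open>e\<close> is added to the family of \<open>\<tau>\<close>.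

  This needs an edge for which \<open>G - e\<close> is again weakly chordal, strongly disjoint families of
  \<open>G - e\<close> remain so in \<open>G\<close>, and \<open>e \<union> T\<close> is spanned by a complete bipartite graph. All three hold if
  no induced path of the complement with four or more vertices joins \<open>x\<close> and \<open>y\<close>. Such a pair is a
  two-pair of the complement and is called a co-pair here; \<open>holefree_has_copair\<close> finds one, via a
  minimal handle, in every weakly chordal graph that has an edge.

  The homological algebra is done after setting all variables to \<open>1\<close>. A multigraded map between
  free modules is a matrix of scalars, the monomials being determined by the degrees, so a
  resolution becomes a complex of vector spaces with bases labelled by degrees (a frame). It is
  exact in the multigraded sense iff, for every \<open>a\<close>, the basis elements of degree at most \<open>a\<close>
  span a subcomplex that resolves the degree \<open>a\<close> part of the module. Lifts, homotopies and cones
  are then linear algebra (\<open>chain_lift_exists\<close>, \<open>homotopy_exists\<close>, \<open>resolves_cone\<close>), and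
  \<open>resolution_of_frame\<close> and \<open>frame_of_resolution\<close> translate between frames and resolutions.
\<close>

section \<open>Induced paths and cycles of a relation\<close>

definition ipath :: "('a \<Rightarrow> 'a \<Rightarrow> bool) \<Rightarrow> 'a list \<Rightarrow> bool" where
  "ipath R p \<longleftrightarrow> distinct p \<and>
     (\<forall>i<length p. \<forall>j<length p. R (p ! i) (p ! j) \<longleftrightarrow> j = Suc i \<or> i = Suc j)"

lemma ipath_append:
  assumes sym: "\<And>u v. R u v \<longleftrightarrow> R v u"
  shows "ipath R (p @ q) \<longleftrightarrow> ipath R p \<and> ipath R q \<and> set p \<inter> set q = {} \<and>
     (\<forall>i<length p. \<forall>j<length q. R (p ! i) (q ! j) \<longleftrightarrow> Suc i = length p \<and> j = 0)"
    (is "?L \<longleftrightarrow> ?R")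
proof
  assume L: ?L
  have a: "R ((p @ q) ! i) ((p @ q) ! j) \<longleftrightarrow> j = Suc i \<or> i = Suc j"
    if "i < length p + length q" "j < length p + length q" for i j
    using L that unfolding ipath_def by auto
  have "ipath R p"
    unfolding ipath_def
  proof (intro conjI allI impI)
    show "distinct p" using L by (simp add: ipath_def)
    fix i j assume "i < length p" "j < length p"
    then show "R (p ! i) (p ! j) \<longleftrightarrow> j = Suc i \<or> i = Suc j"
      using a[of i j] by (simp add: nth_append)
  qed
  moreover have "ipath R q"
    unfolding ipath_def
  proof (intro conjI allI impI)
    show "distinct q" using L by (simp add: ipath_def)
    fix i j assume "i < length q" "j < length q"
    then show "R (q ! i) (q ! j) \<longleftrightarrow> j = Suc i \<or> i = Suc j"
      using a[of "length p + i" "length p + j"] by (simp add: nth_append)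
  qed
  moreover have "set p \<inter> set q = {}" using L by (simp add: ipath_def)
  moreover have "R (p ! i) (q ! j) \<longleftrightarrow> Suc i = length p \<and> j = 0"
    if "i < length p" "j < length q" for i j
    using a[of i "length p + j"] that by (auto simp add: nth_append)
  ultimately show ?R by blast
next
  assume R: ?R
  show ?L
    unfolding ipath_def
  proof (intro conjI allI impI)
    show "distinct (p @ q)" using R by (simp add: ipath_def)
    fix i j assume ij: "i < length (p @ q)" "j < length (p @ q)"
    have p: "R (p ! i) (p ! j) \<longleftrightarrow> j = Suc i \<or> i = Suc j" if "i < length p" "j < length p" for i j
      using R that by (simp add: ipath_def)
    have q: "R (q ! i) (q ! j) \<longleftrightarrow> j = Suc i \<or> i = Suc j" if "i < length q" "j < length q" for i j
      using R that by (simp add: ipath_def)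
    have pq: "R (p ! i) (q ! j) \<longleftrightarrow> Suc i = length p \<and> j = 0" if "i < length p" "j < length q" for i j
      using R that by blast
    show "R ((p @ q) ! i) ((p @ q) ! j) \<longleftrightarrow> j = Suc i \<or> i = Suc j"
    proof (cases "i < length p"; cases "j < length p")
      assume "i < length p" "j < length p"
      then show ?thesis using p by (simp add: nth_append)
    next
      assume "i < length p" "\<not> j < length p"
      then show ?thesis using pq[of i "j - length p"] ij by (auto simp add: nth_append)
    next
      assume "\<not> i < length p" "j < length p"
      then show ?thesis using pq[of j "i - length p"] ij sym[of "p ! j" "q ! (i - length p)"]
        by (auto simp add: nth_append)
    next
      assume "\<not> i < length p" "\<not> j < length p"
      then show ?thesis using q[of "i - length p" "j - length p"] ij by (auto simp add: nth_append)
    qed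
  qed
qed

lemma ipath_Nil [simp]: "ipath R []" by (simp add: ipath_def)

lemma ipath_single: "ipath R [x] \<longleftrightarrow> \<not> R x x" by (simp add: ipath_def)

lemma ipath_Cons:
  assumes sym: "\<And>u v. R u v \<longleftrightarrow> R v u"
  shows "ipath R (x # y # p) \<longleftrightarrow> ipath R (y # p) \<and> \<not> R x x \<and> R x y \<and> x \<noteq> y \<and> x \<notin> set p \<and> (\<forall>z\<in>set p. \<not> R x z)"
proof -
  have "(\<forall>i<length [x]. \<forall>j<length (y # p). R ([x] ! i) ((y # p) ! j) \<longleftrightarrow> Suc i = length [x] \<and> j = 0)
      \<longleftrightarrow> R x y \<and> (\<forall>z\<in>set p. \<not> R x z)"
    by (simp add: All_less_Suc2 all_set_conv_all_nth)
  note e = ipath_append[of R, OF sym, where p = "[x]" and q = "y # p", unfolded this ipath_single]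
  show ?thesis using e by simp blast
qed

lemma ipath_rev:
  assumes "\<And>u v. R u v \<longleftrightarrow> R v u" "ipath R p"
  shows "ipath R (rev p)"
  unfolding ipath_def
proof (intro conjI allI impI)
  show "distinct (rev p)" using assms by (simp add: ipath_def)
  fix i j assume "i < length (rev p)" "j < length (rev p)"
  then show "R (rev p ! i) (rev p ! j) \<longleftrightarrow> j = Suc i \<or> i = Suc j"
    using assms(2) unfolding ipath_def by (auto simp: rev_nth)
qed

lemma ipath_snoc:
  assumes sym: "\<And>u v. R u v \<longleftrightarrow> R v u"
    and "ipath R p" "p \<noteq> []" "x \<notin> set p" "\<not> R x x" "R (last p) x" "\<forall>z\<in>set (butlast p). \<not> R z x"
  shows "ipath R (p @ [x])"
proof -
  have "R (p ! i) x \<longleftrightarrow> Suc i = length p" if "i < length p" for i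
  proof (cases "Suc i = length p")
    case True
    then show ?thesis using assms(6) by (metis assms(3) diff_Suc_1 last_conv_nth)
  next
    case False
    then have "p ! i \<in> set (butlast p)"
      using that by (auto simp: in_set_conv_nth nth_butlast intro!: exI[of _ i])
    then show ?thesis using assms(7) False by blast
  qed
  then show ?thesis
    unfolding ipath_append[OF sym] using assms(2,4,5) by (simp add: ipath_single)
qed

text \<open>The adjacency condition of \<open>induced_cycle\<close> for an arbitrary relation, so that it applies alike to
  the edges and to the non-edges of a graph.\<close>

definition cycle_adj :: "('a \<Rightarrow> 'a \<Rightarrow> bool) \<Rightarrow> 'a list \<Rightarrow> bool" where
  "cycle_adj R c \<longleftrightarrow> distinct c \<and> (\<forall>i<length c. \<forall>j<length c. R (c ! i) (c ! j) \<longleftrightarrow>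
        j = Suc i mod length c \<or> i = Suc j mod length c)"

lemma cycle_adj_snoc:
  "cycle_adj R (p @ [x]) \<longleftrightarrow> distinct p \<and> x \<notin> set p \<and>
     (\<forall>i\<le>length p. \<forall>j\<le>length p. R ((p@[x]) ! i) ((p@[x]) ! j) \<longleftrightarrow>
        j = (if i = length p then 0 else Suc i) \<or> i = (if j = length p then 0 else Suc j))"
proof -
  have m: "Suc i mod Suc (length p) = (if i = length p then 0 else Suc i)"
    if "i \<le> length p" for i using that by auto
  show ?thesis
    unfolding cycle_adj_def by (simp add: less_Suc_eq_le m cong: conj_cong)
qed

lemma cycle_snocD:
  assumes c: "cycle_adj R (p @ [x])" and len: "length p \<ge> 2"
  shows "ipath R p" "x \<notin> set p" "\<not> R x x"
    "\<And>i. i < length p \<Longrightarrow> R x (p ! i) \<longleftrightarrow> i = 0 \<or> Suc i = length p"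
proof -
  have a: "R ((p@[x]) ! i) ((p@[x]) ! j) \<longleftrightarrow>
      j = (if i = length p then 0 else Suc i) \<or> i = (if j = length p then 0 else Suc j)"
    if "i \<le> length p" "j \<le> length p" for i j
    using c that unfolding cycle_adj_snoc by blast
  show "x \<notin> set p" using c by (simp add: cycle_adj_snoc)
  show "\<not> R x x" using a[of "length p" "length p"] len by (auto simp: nth_append)
  show "R x (p ! i) \<longleftrightarrow> i = 0 \<or> Suc i = length p" if "i < length p" for i
    using a[of "length p" i] that by (auto simp: nth_append)
  have "R (p ! i) (p ! j) \<longleftrightarrow> j = Suc i \<or> i = Suc j" if "i < length p" "j < length p" for i j
    using a[of i j] that by (simp add: nth_append)
  then show "ipath R p"
    using c by (simp add: cycle_adj_snoc ipath_def)
qed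

lemma cycle_snocI:
  assumes sym: "\<And>u v. R u v \<longleftrightarrow> R v u" and len: "length p \<ge> 2"
    and p: "ipath R p" "x \<notin> set p" "\<not> R x x"
    and x: "\<And>i. i < length p \<Longrightarrow> R x (p ! i) \<longleftrightarrow> i = 0 \<or> Suc i = length p"
  shows "cycle_adj R (p @ [x])"
  unfolding cycle_adj_snoc
proof (intro conjI allI impI)
  show "distinct p" using p by (simp add: ipath_def)
  show "x \<notin> set p" by fact
  let ?n = "length p"
  fix i j assume "i \<le> ?n" "j \<le> ?n"
  then consider "i < ?n" "j < ?n" | "i < ?n" "j = ?n" | "i = ?n" "j < ?n" | "i = ?n" "j = ?n"
    by linarith
  then show "R ((p@[x]) ! i) ((p@[x]) ! j) \<longleftrightarrow>
        j = (if i = ?n then 0 else Suc i) \<or> i = (if j = ?n then 0 else Suc j)"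
  proof cases
    case 1
    then have "R (p ! i) (p ! j) \<longleftrightarrow> j = Suc i \<or> i = Suc j" using p by (simp add: ipath_def)
    then show ?thesis using 1 by (simp add: nth_append)
  next
    case 2
    then show ?thesis using x[of i] sym[of x "p ! i"] by (auto simp: nth_append)
  next
    case 3
    then show ?thesis using x[of j] by (auto simp: nth_append)
  next
    case 4
    then show ?thesis using p len by (auto simp: nth_append)
  qed
qed

lemma cycle_rotate1:
  assumes "cycle_adj R c"
  shows "cycle_adj R (rotate1 c)"
proof (cases "c = []")
  case False
  let ?n = "length c"
  define f where "f i = Suc i mod ?n" for i
  have n: "?n > 0" using False by simp
  have lt: "f i < ?n" for i using n by (simp add: f_def)
  have inj: "f i = f j \<longleftrightarrow> i = j" if "i < ?n" "j < ?n" for i j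
    using that by (auto simp: f_def mod_Suc split: if_splits)
  have nth: "rotate1 c ! i = c ! f i" if "i < ?n" for i
    using nth_rotate1[OF that] by (simp add: f_def)
  have "R (c ! f i) (c ! f j) \<longleftrightarrow> j = f i \<or> i = f j" if "i < ?n" "j < ?n" for i j
  proof -
    have "R (c ! f i) (c ! f j) \<longleftrightarrow> f j = f (f i) \<or> f i = f (f j)"
      using assms lt[of i] lt[of j] unfolding cycle_adj_def f_def by blast
    then show ?thesis using inj[OF that(2) lt] inj[OF that(1) lt] by simp
  qed
  then show ?thesis
    using assms unfolding cycle_adj_def by (simp add: nth f_def)
qed (use assms in simp)

lemma cycle_rotate: "cycle_adj R c \<Longrightarrow> cycle_adj R (rotate k c)"
  by (induction k) (simp_all add: cycle_rotate1)

lemma cycle_open_at: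
  assumes c: "cycle_adj R c" "length c \<ge> 3" "x \<in> set c"
  shows "\<exists>p. ipath R p \<and> Suc (length p) = length c \<and> set c = insert x (set p) \<and> x \<notin> set p \<and>
    (\<forall>i<length p. R x (p ! i) \<longleftrightarrow> i = 0 \<or> Suc i = length p)"
proof -
  obtain a b where ab: "c = a @ x # b" using c(3) by (meson split_list)
  have "rotate (length (a @ [x])) ((a @ [x]) @ b) = b @ a @ [x]"
    by (rule rotate_append)
  then have r: "cycle_adj R ((b @ a) @ [x])"
    using cycle_rotate[OF c(1), of "length (a @ [x])"] by (simp add: ab)
  have len: "length (b @ a) \<ge> 2" using c(2) ab by simp
  show ?thesis
    by (rule exI[of _ "b @ a"]) (use cycle_snocD[OF r len] ab in \<open>simp add: Un_commute\<close>)
qed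

text \<open>Holes are handled as a vertex \<open>x\<close> together with an induced path of whose vertices \<open>x\<close> sees exactly
  the two ends. By rotation any vertex of the cycle can play the role of \<open>x\<close>.\<close>

lemma cycle_open:
  assumes c: "cycle_adj R c" "length c \<ge> 5" "x \<in> set c"
  obtains u m w where "ipath R (u # m @ [w])" "length m + 3 = length c"
    "set c = insert x (set (u # m @ [w]))" "x \<notin> set (u # m @ [w])"
    "R x u" "R x w" "\<forall>z\<in>set m. \<not> R x z"
proof -
  have "length c \<ge> 3" using c(2) by simp
  then obtain p where p: "ipath R p" "Suc (length p) = length c" "set c = insert x (set p)" "x \<notin> set p"
    and Rx: "\<And>i. i < length p \<Longrightarrow> R x (p ! i) \<longleftrightarrow> i = 0 \<or> Suc i = length p"
    using cycle_open_at[OF c(1) _ c(3)] by blast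
  obtain u q where q: "p = u # q" using p(2) c(2) by (cases p) auto
  obtain m w where m: "q = m @ [w]" using p(2) c(2) q by (cases q rule: rev_cases) auto
  have "R x u" using Rx[of 0] by (simp add: q)
  moreover have "R x w" using Rx[of "Suc (length m)"] by (simp add: q m nth_append)
  moreover have "\<not> R x z" if z: "z \<in> set m" for z
  proof -
    obtain i where "i < length m" "z = m ! i" using z by (metis in_set_conv_nth)
    then show ?thesis using Rx[of "Suc i"] by (simp add: q m nth_append)
  qed
  ultimately show ?thesis using that[of u m w] p by (simp add: q m)
qed

lemma cycle_close:
  assumes sym: "\<And>u v. R u v \<longleftrightarrow> R v u" and p: "ipath R (u # m @ [w])"
    and x: "x \<notin> set (u # m @ [w])" "\<not> R x x" "R x u" "R x w" "\<forall>z\<in>set m. \<not> R x z"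
  shows "cycle_adj R ((u # m @ [w]) @ [x])"
proof (rule cycle_snocI[OF sym _ p x(1,2)])
  fix i assume i: "i < length (u # m @ [w])"
  show "R x ((u # m @ [w]) ! i) \<longleftrightarrow> i = 0 \<or> Suc i = length (u # m @ [w])"
  proof (cases i)
    case 0 then show ?thesis using x(3) by simp
  next
    case (Suc j)
    show ?thesis
    proof (cases "j < length m")
      case True then show ?thesis using x(5) Suc by (simp add: nth_append)
    next
      case False then show ?thesis using x(4) Suc i by (simp add: nth_append)
    qed
  qed
qed simp

lemma ipath_cong:
  assumes "\<And>u v. u \<in> set p \<Longrightarrow> v \<in> set p \<Longrightarrow> R u v \<longleftrightarrow> R' u v"
  shows "ipath R p \<longleftrightarrow> ipath R' p"
  using assms unfolding ipath_def by auto

lemma cycle_adj_cong: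
  assumes "\<And>u v. u \<in> set p \<Longrightarrow> v \<in> set p \<Longrightarrow> R u v \<longleftrightarrow> R' u v"
  shows "cycle_adj R p \<longleftrightarrow> cycle_adj R' p"
  using assms unfolding cycle_adj_def by auto

definition reach :: "('a \<Rightarrow> 'a \<Rightarrow> bool) \<Rightarrow> 'a set \<Rightarrow> 'a \<Rightarrow> 'a \<Rightarrow> bool" where
  "reach R S u v \<longleftrightarrow> (u, v) \<in> {(a, b). a \<in> S \<and> b \<in> S \<and> R a b}\<^sup>*"

lemma reach_refl [simp]: "reach R S u u" by (simp add: reach_def)

lemma reach_trans: "reach R S u v \<Longrightarrow> reach R S v w \<Longrightarrow> reach R S u w"
  unfolding reach_def by (rule rtrancl_trans)

lemma reach_edge: "u \<in> S \<Longrightarrow> v \<in> S \<Longrightarrow> R u v \<Longrightarrow> reach R S u v"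
  unfolding reach_def by blast

lemma reach_mono: "reach R S u v \<Longrightarrow> S \<subseteq> T \<Longrightarrow> reach R T u v"
  unfolding reach_def by (rule subsetD[OF rtrancl_mono]) auto

lemma reach_sym:
  assumes "\<And>u v. R u v \<longleftrightarrow> R v u" "reach R S u v" shows "reach R S v u"
proof -
  have "sym {(a, b). a \<in> S \<and> b \<in> S \<and> R a b}" using assms(1) by (auto simp: sym_def)
  then show ?thesis using assms(2) unfolding reach_def by (meson sym_rtrancl symD)
qed

lemma reach_in: "reach R S u v \<Longrightarrow> u \<in> S \<Longrightarrow> v \<in> S"
  unfolding reach_def by (induction rule: rtrancl_induct) auto

text \<open>A walk is shortened from its end: a new first vertex is joined to its last neighbour on the
  induced path found so far, and everything before that neighbour is dropped.\<close>

lemma reach_ipath: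
  assumes sym: "\<And>u v. R u v \<longleftrightarrow> R v u" and irr: "\<And>u. \<not> R u u"
    and "reach R S u v" "u \<in> S"
  shows "\<exists>p. ipath R (u # p) \<and> set p \<subseteq> S \<and> last (u # p) = v"
  using assms(3) unfolding reach_def
proof (induction rule: converse_rtrancl_induct)
  case base
  show ?case by (rule exI[of _ "[]"]) (simp add: ipath_single irr)
next
  case (step a b)
  then obtain p where p: "ipath R (b # p)" "set p \<subseteq> S" "last (b # p) = v" by blast
  have ab: "a \<in> S" "b \<in> S" "R a b" using step by auto
  show ?case
  proof (cases "a \<in> set (b # p)")
    case True
    then obtain q r where qr: "b # p = q @ a # r" by (meson split_list)
    then have "ipath R (a # r)" using p(1) unfolding qr ipath_append[of R, OF sym] by blast
    moreover have "set r \<subseteq> set (b # p)" unfolding qr by auto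
    moreover have "last (a # r) = v" using p(3) unfolding qr by simp
    ultimately show ?thesis using p ab by (intro exI[of _ r]) auto
  next
    case False
    have "\<exists>z\<in>set (b # p). R a z" using ab(3) by simp
    then obtain q z r where qr: "b # p = q @ z # r" "R a z" "\<forall>y\<in>set r. \<not> R a y"
      using split_list_last_prop[of "b # p" "R a"] by blast
    have "ipath R (z # r)" using p(1) unfolding qr(1) ipath_append[of R, OF sym] by blast
    then have "ipath R (a # z # r)"
      using False qr(2,3) unfolding qr(1) ipath_Cons[of R, OF sym] by (simp add: irr)
    moreover have "set (z # r) \<subseteq> set (b # p)" unfolding qr(1) by auto
    moreover have "last (a # z # r) = v" using p(3) unfolding qr(1) by simp
    ultimately show ?thesis using p ab by (intro exI[of _ "z # r"]) auto
  qed
qed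

text \<open>Adjacency in the complement graph.\<close>

definition co :: "('a \<Rightarrow> 'a \<Rightarrow> bool) \<Rightarrow> 'a \<Rightarrow> 'a \<Rightarrow> bool" where
  "co E u v \<longleftrightarrow> u \<noteq> v \<and> \<not> E u v"

definition holefree :: "('a \<Rightarrow> 'a \<Rightarrow> bool) \<Rightarrow> 'a set \<Rightarrow> bool" where
  "holefree R V \<longleftrightarrow> \<not> (\<exists>c. set c \<subseteq> V \<and> length c \<ge> 5 \<and> cycle_adj R c)"

lemma holefree_close:
  assumes "holefree R V" and sym: "\<And>u v. R u v \<longleftrightarrow> R v u" and p: "ipath R (u # m @ [w])" "length m \<ge> 2"
    and x: "x \<notin> set (u # m @ [w])" "\<not> R x x" "R x u" "R x w" "\<forall>z\<in>set m. \<not> R x z"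
    and V: "x \<in> V" "set (u # m @ [w]) \<subseteq> V"
  shows False
  using assms(1) cycle_close[OF sym p(1) x] p(2) V unfolding holefree_def
  by (elim notE, intro exI[of _ "(u # m @ [w]) @ [x]"]) auto

lemma holefree_mono: "holefree R V \<Longrightarrow> W \<subseteq> V \<Longrightarrow> holefree R W"
  unfolding holefree_def by blast

section \<open>Co-pairs in graphs without holes and antiholes\<close>

locale sym_graph =
  fixes E :: "'a \<Rightarrow> 'a \<Rightarrow> bool"
  assumes E_sym: "E u v \<longleftrightarrow> E v u" and E_irrefl [simp]: "\<not> E u u"
begin

lemma co_sym: "co E u v \<longleftrightarrow> co E v u"
  by (auto simp: co_def E_sym)

lemma co_irrefl [simp]: "\<not> co E u u"
  by (simp add: co_def)

definition connected :: "'a set \<Rightarrow> bool" where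
  "connected S \<longleftrightarrow> (\<forall>u\<in>S. \<forall>v\<in>S. reach E S u v)"

text \<open>An induced path through \<open>J\<close>; it has an inner vertex because \<open>u\<close> and \<open>w\<close> are not adjacent,
  and a second one because they have no common neighbour.\<close>

lemma ipath_through_connected:
  assumes J: "connected J" and uw: "u \<noteq> w" "\<not> E u w"
    and u: "j \<in> J" "E u j" and w: "j' \<in> J" "E w j'"
    and common: "\<And>j. j \<in> J \<Longrightarrow> \<not> (E u j \<and> E w j)"
  obtains m where "ipath E (u # m @ [w])" "length m \<ge> 2" "set m \<subseteq> J"
proof -
  let ?S = "J \<union> {u, w}"
  have "reach E ?S u j" "reach E ?S j' w"
    using u w by (auto intro!: reach_edge simp: E_sym)
  moreover have "reach E ?S j j'"
    using J u w unfolding connected_def by (meson Un_upper1 reach_mono)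
  ultimately have "reach E ?S u w" by (meson reach_trans)
  then obtain p where p: "ipath E (u # p)" "set p \<subseteq> ?S" "last (u # p) = w"
    using reach_ipath[of E ?S u w] E_sym by auto
  have "p \<noteq> []" using p(3) uw by auto
  then obtain m where m: "p = m @ [w]" using p(3) by (metis append_butlast_last_id last_ConsR)
  have "set m \<subseteq> J" using p unfolding m ipath_def by auto
  moreover have "length m \<ge> 2"
  proof (rule ccontr)
    assume "\<not> ?thesis"
    then consider "m = []" | z where "m = [z]"
      by (cases m; cases "tl m") auto
    then show False
    proof cases
      case 1
      then show ?thesis using p(1) m uw by (simp add: ipath_Cons[of E, OF E_sym])
    next
      case (2 z)
      then have "E u z" "E w z" "z \<in> J"
        using p(1) m \<open>set m \<subseteq> J\<close> by (simp_all add: ipath_Cons[of E, OF E_sym] E_sym)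
      then show ?thesis using common by blast
    qed
  qed
  ultimately show ?thesis using that p(1) m by blast
qed

text \<open>An induced path \<open>h, n\<^sub>1, n\<^sub>2, \<dots>, h'\<close> of the complement cannot have all its inner vertices attached
  to a connected set \<open>J\<close> that its ends do not see. A common neighbour of \<open>n\<^sub>1\<close> and \<open>n\<^sub>2\<close> in \<open>J\<close>
  would close a hole of the complement. Without one, an induced path through \<open>J\<close> of length at
  least three joins \<open>n\<^sub>1\<close> to \<open>n\<^sub>2\<close>, and \<open>h'\<close>, or \<open>h\<close> and \<open>h'\<close> if \<open>n\<^sub>1\<close> and \<open>n\<^sub>2\<close> are the only inner vertices,
  closes it to a hole of the graph.\<close>

lemma co_ipath_not_attached:
  assumes hf: "holefree E V" "holefree (co E) V" and J: "J \<subseteq> V" "connected J"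
    and p: "ipath (co E) (h # S @ [h'])" "set (h # S @ [h']) \<subseteq> V" "length S \<ge> 2"
    and disj: "set (h # S @ [h']) \<inter> J = {}"
    and att: "\<And>n. n \<in> set S \<Longrightarrow> \<exists>j\<in>J. E n j"
    and h: "\<And>j. j \<in> J \<Longrightarrow> \<not> E h j" "\<And>j. j \<in> J \<Longrightarrow> \<not> E h' j"
  shows False
proof -
  note coC = ipath_Cons[of "co E", OF co_sym] and EC = ipath_Cons[of E, OF E_sym]
  obtain n1 n2 S' where S: "S = n1 # n2 # S'"
    using p(3) by (cases S; cases "tl S") auto
  have rel: "co E h n1" "co E n1 n2" "\<not> co E h n2" "\<not> co E h h'" "\<not> co E n1 h'" "h \<noteq> h'" "h \<noteq> n2" "n1 \<noteq> h'"
    "n1 \<noteq> n2" "h \<noteq> n1" "n2 \<noteq> h'"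
    using p(1) unfolding S by (auto simp: coC)
  have common: "\<not> (E n1 j \<and> E n2 j)" if j: "j \<in> J" for j
  proof
    assume n: "E n1 j \<and> E n2 j"
    \<comment> \<open>the first non-neighbour \<open>b\<close> of \<open>j\<close> after \<open>n2\<close>; there is one, namely \<open>h'\<close> at the latest\<close>
    have "co E j h'" using h(2)[OF j] disj j by (auto simp: co_def E_sym)
    then have "\<exists>b\<in>set (S' @ [h']). co E j b" by simp
    then obtain a b c where abc: "S' @ [h'] = a @ b # c" "co E j b" "\<forall>y\<in>set a. \<not> co E j y"
      using split_list_first_prop[of "S' @ [h']" "co E j"] by blast
    have eq: "h # S @ [h'] = (h # (n1 # n2 # a) @ [b]) @ c" using abc(1) by (simp add: S)
    show False
    proof (rule holefree_close[OF hf(2) co_sym])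
      show "ipath (co E) (h # (n1 # n2 # a) @ [b])"
        using p(1) unfolding eq ipath_append[of "co E", OF co_sym] by blast
      show "set (h # (n1 # n2 # a) @ [b]) \<subseteq> V" using p(2) unfolding eq by auto
      show "j \<notin> set (h # (n1 # n2 # a) @ [b])" using disj j unfolding eq by auto
      show "co E j h" using h(1)[OF j] disj j by (auto simp: co_def E_sym)
      show "\<forall>z\<in>set (n1 # n2 # a). \<not> co E j z" using n abc(3) by (auto simp: co_def E_sym)
      show "j \<in> V" using j J by blast
    qed (use abc(2) in auto)
  qed
  obtain j j' where "j \<in> J" "E n1 j" "j' \<in> J" "E n2 j'"
    using att[of n1] att[of n2] by (auto simp: S)
  moreover have "\<not> E n1 n2" using rel by (simp add: co_def)
  ultimately obtain m where m: "ipath E (n1 # m @ [n2])" "length m \<ge> 2" "set m \<subseteq> J"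
    using ipath_through_connected[OF J(2), of n1 n2] common rel by metis
  show False
  proof (cases S')
    case Nil
    have r: "co E n2 h'" using p(1) unfolding S Nil by (simp add: coC)
    show False
    proof (rule holefree_close[OF hf(1) E_sym])
      have "\<forall>z\<in>set m. \<not> E z h" using m(3) h(1) by (auto simp: E_sym)
      moreover have "h \<notin> set m" using m(3) disj by auto
      ultimately have "ipath E ((n1 # m @ [n2]) @ [h])"
        using m(1) rel by (intro ipath_snoc[OF E_sym]) (auto simp: co_def E_sym butlast_append)
      then show "ipath E (n1 # (m @ [n2]) @ [h])" by simp
      show "h' \<notin> set (n1 # (m @ [n2]) @ [h])" using rel m(3) disj by auto
      show "E h' n1" "E h' h" using rel by (auto simp: co_def E_sym)
      show "\<forall>z\<in>set (m @ [n2]). \<not> E h' z" using r m(3) h(2) by (auto simp: co_def E_sym)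
      show "h' \<in> V" "set (n1 # (m @ [n2]) @ [h]) \<subseteq> V" using p(2) m(3) J(1) by (auto simp: S)
    qed (use m(2) in auto)
  next
    case (Cons s S'')
    have r: "\<not> co E n2 h'" using p(1) unfolding S Cons by (simp add: coC)
    show False
    proof (rule holefree_close[OF hf(1) E_sym m(1,2)])
      show "h' \<notin> set (n1 # m @ [n2])" using rel m(3) disj by auto
      show "E h' n1" "E h' n2" using rel r by (auto simp: co_def E_sym)
      show "\<forall>z\<in>set m. \<not> E h' z" using m(3) h(2) by auto
      show "h' \<in> V" "set (n1 # m @ [n2]) \<subseteq> V" using p(2) m(3) J(1) by (auto simp: S)
    qed auto
  qed
qed

text \<open>A handle \<open>H\<close> with co-handle \<open>J\<close> in the sense of Hayward, Spinrad and Sritharan: two connected sets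
  without edges between them such that every outside neighbour of \<open>H\<close> is also a neighbour of \<open>J\<close>.\<close>

definition handle :: "'a set \<Rightarrow> 'a set \<Rightarrow> 'a set \<Rightarrow> bool" where
  "handle V H J \<longleftrightarrow> H \<subseteq> V \<and> J \<subseteq> V \<and> connected H \<and> (\<exists>x\<in>H. \<exists>y\<in>H. E x y) \<and>
     J \<noteq> {} \<and> connected J \<and> H \<inter> J = {} \<and> (\<forall>h\<in>H. \<forall>j\<in>J. \<not> E h j) \<and>
     (\<forall>v\<in>V - H. (\<exists>h\<in>H. E v h) \<longrightarrow> (\<exists>j\<in>J. E v j))"

definition component_of :: "'a set \<Rightarrow> 'a \<Rightarrow> 'a set" where
  "component_of S x = {w. reach E S x w}"

lemma connectedI:
  assumes "\<And>u. u \<in> S \<Longrightarrow> reach E S x u"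
  shows "connected S"
  unfolding connected_def
proof (intro ballI)
  fix u v assume "u \<in> S" "v \<in> S"
  then show "reach E S u v"
    using reach_sym[of E, OF E_sym assms] assms by (blast intro: reach_trans)
qed

lemma component_of:
  assumes "x \<in> S"
  shows "component_of S x \<subseteq> S" "x \<in> component_of S x" "connected (component_of S x)"
    "\<And>u v. u \<in> component_of S x \<Longrightarrow> v \<in> S \<Longrightarrow> E u v \<Longrightarrow> v \<in> component_of S x"
proof -
  let ?K = "component_of S x"
  show sub: "?K \<subseteq> S" using reach_in[OF _ assms] by (auto simp: component_of_def)
  show "x \<in> ?K" by (simp add: component_of_def)
  show "v \<in> ?K" if "u \<in> ?K" "v \<in> S" "E u v" for u v
  proof -
    have "reach E S u v" using that sub by (intro reach_edge) auto
    moreover have "reach E S x u" using that(1) by (simp add: component_of_def)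
    ultimately show ?thesis by (simp add: component_of_def reach_trans[of E S x u v])
  qed
  have "reach E ?K x w" if "reach E S x w" for w
    using that unfolding reach_def
  proof (induction rule: rtrancl_induct)
    case (step a b)
    then have "a \<in> ?K" "b \<in> ?K"
      using rtrancl_into_rtrancl[OF step(1,2)] step(1) unfolding component_of_def reach_def by simp_all
    then have "(a, b) \<in> {(a, b). a \<in> ?K \<and> b \<in> ?K \<and> E a b}" using step by auto
    with step.IH show ?case by (rule rtrancl_into_rtrancl)
  qed simp
  then show "connected ?K"
    by (intro connectedI[of _ x]) (simp add: component_of_def)
qed

text \<open>Every neighbour of a component of the graph minus \<open>z\<close> and its neighbours is a neighbour of \<open>z\<close>.
  So the component that contains the edge \<open>xy\<close> is a handle with co-handle \<open>{z}\<close>.\<close>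

lemma handle_exists:
  assumes "x \<in> V" "y \<in> V" "E x y" "z \<in> V" "\<not> E z x" "\<not> E z y"
  shows "\<exists>H. handle V H {z}"
proof -
  let ?S = "{v \<in> V. v \<noteq> z \<and> \<not> E z v}"
  have x: "x \<in> ?S" and y: "y \<in> ?S" using assms by (auto simp: E_sym)
  note K = component_of[OF x]
  have "handle V (component_of ?S x) {z}"
    unfolding handle_def
  proof (intro conjI ballI impI)
    show "\<exists>u\<in>component_of ?S x. \<exists>v\<in>component_of ?S x. E u v"
      using K(2) K(4)[OF K(2) y assms(3)] assms(3) by blast
    show "\<not> E h j" if "h \<in> component_of ?S x" "j \<in> {z}" for h j
      using that K(1) by (auto simp: E_sym)
    show "\<exists>j\<in>{z}. E v j" if v: "v \<in> V - component_of ?S x" and nb: "\<exists>h\<in>component_of ?S x. E v h" for v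
    proof -
      obtain h where h: "h \<in> component_of ?S x" "E h v" using nb E_sym by blast
      then have "v \<notin> ?S" using K(4) v by blast
      moreover have "v \<noteq> z" using h K(1) by (auto simp: E_sym)
      ultimately show ?thesis using v by (auto simp: E_sym)
    qed
    show "component_of ?S x \<subseteq> V" "component_of ?S x \<inter> {z} = {}" using K(1) by auto
    show "connected (component_of ?S x)" by (rule K(3))
  qed (use assms in \<open>auto simp: connected_def\<close>)
  then show ?thesis ..
qed

text \<open>A neighbour \<open>v\<close> of the handle that misses both ends of an edge \<open>xy\<close> can be moved to the co-handle.
  The new handle is the component of \<open>xy\<close> in \<open>H\<close> minus the neighbours of \<open>v\<close>: its neighbours inside
  \<open>H\<close> are adjacent to \<open>v\<close>, those outside \<open>H\<close> are adjacent to \<open>J\<close>.\<close>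

lemma handle_shrink:
  assumes H: "handle V H J" and v: "v \<in> V - H" "h \<in> H" "E v h"
    and xy: "x \<in> H" "y \<in> H" "E x y" "\<not> E v x" "\<not> E v y"
  shows "\<exists>K J'. handle V K J' \<and> K \<subset> H"
proof -
  have sub: "H \<subseteq> V" "J \<subseteq> V" "H \<inter> J = {}" and J: "connected J" and HJ: "\<And>h j. h \<in> H \<Longrightarrow> j \<in> J \<Longrightarrow> \<not> E h j"
    and dom: "\<And>v h. v \<in> V - H \<Longrightarrow> h \<in> H \<Longrightarrow> E v h \<Longrightarrow> \<exists>j\<in>J. E v j"
    using H unfolding handle_def by blast+
  let ?S = "{w \<in> H. \<not> E v w}"
  have x: "x \<in> ?S" and y: "y \<in> ?S" using xy by auto
  note K = component_of[OF x]
  let ?K = "component_of ?S x"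
  obtain j where j: "j \<in> J" "E v j" using dom v by blast
  have con: "connected (insert v J)"
  proof -
    have "reach E (insert v J) v u" if "u \<in> insert v J" for u
    proof (cases "u = v")
      case False
      then have "reach E J j u" using that j J unfolding connected_def by blast
      then have "reach E (insert v J) j u" by (rule reach_mono) auto
      moreover have "reach E (insert v J) v j" using j by (intro reach_edge) auto
      ultimately show ?thesis by (rule reach_trans[rotated])
    qed simp
    then show ?thesis by (rule connectedI)
  qed
  have "handle V ?K (insert v J)"
    unfolding handle_def
  proof (intro conjI ballI impI)
    show "\<exists>u\<in>?K. \<exists>v\<in>?K. E u v"
      using K(2) K(4)[OF K(2) y xy(3)] xy(3) by blast
    show "\<not> E h j" if "h \<in> ?K" "j \<in> insert v J" for h j
      using that K(1) HJ E_sym by blast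
    show "\<exists>j\<in>insert v J. E u j" if u: "u \<in> V - ?K" and nb: "\<exists>h\<in>?K. E u h" for u
    proof (cases "u \<in> H")
      case True
      obtain h where "h \<in> ?K" "E h u" using nb E_sym by blast
      then have "u \<notin> ?S" using K(4) u by blast
      then show ?thesis using True by (auto simp: E_sym)
    next
      case False
      then show ?thesis using u nb K(1) dom by blast
    qed
    show "?K \<subseteq> V" "?K \<inter> insert v J = {}" "insert v J \<subseteq> V"
      using K(1) sub v(1) by blast+
    show "connected ?K" by (rule K(3))
  qed (use con in auto)
  moreover have "?K \<subset> H" using K(1) v by blast
  ultimately show ?thesis by blast
qed

text \<open>A handle with the least number of vertices; an undominated edge would give a smaller one by
  \<open>handle_shrink\<close>.\<close>

lemma minimal_handle:
  assumes "handle V H0 J0" "finite V"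
  shows "\<exists>H J. handle V H J \<and>
    (\<forall>v\<in>V - H. (\<exists>h\<in>H. E v h) \<longrightarrow> (\<forall>x\<in>H. \<forall>y\<in>H. E x y \<longrightarrow> E v x \<or> E v y))"
proof -
  obtain H where H: "\<exists>J. handle V H J" and min: "\<And>K. \<exists>J. handle V K J \<Longrightarrow> card H \<le> card K"
    using ex_has_least_nat[of "\<lambda>H. \<exists>J. handle V H J" H0 card] assms by blast
  have fin: "finite H" using H assms(2) by (auto simp: handle_def finite_subset)
  obtain J where J: "handle V H J" using H by blast
  have "E v x \<or> E v y" if v: "v \<in> V - H" "h \<in> H" "E v h" and xy: "x \<in> H" "y \<in> H" "E x y" for v h x y
  proof (rule ccontr)
    assume "\<not> (E v x \<or> E v y)"
    then obtain K J' where "handle V K J'" "K \<subset> H"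
      using handle_shrink[OF J v xy] by blast
    then show False using min[of K] psubset_card_mono[OF fin, of K] by auto
  qed
  then show ?thesis using J by blast
qed

text \<open>The edge \<open>xy\<close> joins the ends of no induced path of the complement with more than three vertices;
  equivalently, \<open>x\<close> and \<open>y\<close> form a two-pair of the complement.\<close>

definition copair :: "'a set \<Rightarrow> 'a \<Rightarrow> 'a \<Rightarrow> bool" where
  "copair V x y \<longleftrightarrow> x \<in> V \<and> y \<in> V \<and> E x y \<and>
     \<not> (\<exists>m. set m \<subseteq> V \<and> length m \<ge> 2 \<and> ipath (co E) (x # m @ [y]))"

lemma copair_sym: "copair V x y \<Longrightarrow> copair V y x"
proof -
  have "ipath (co E) (x # rev m @ [y])" if "ipath (co E) (y # m @ [x])" for m
    using ipath_rev[of "co E", OF co_sym that] by simp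
  then show "copair V x y \<Longrightarrow> copair V y x"
    unfolding copair_def by (metis E_sym length_rev set_rev)
qed

text \<open>Induction on the vertex set. If there is no handle, every vertex sees an end of every edge and
  every edge is a co-pair. Otherwise take a handle \<open>H\<close> whose edges are dominated by its
  neighbours, and a co-pair \<open>xy\<close> of \<open>H\<close> by induction. A long induced path of the complement from \<open>x\<close> to \<open>y\<close>
  must leave \<open>H\<close>. It stays inside \<open>H\<close> and the neighbours of \<open>H\<close>, as its inner vertices see \<open>x\<close> or \<open>y\<close>.
  Consider a maximal segment outside \<open>H\<close>, between \<open>h\<close> and \<open>h'\<close> in \<open>H\<close>. If it is a single
  vertex, this vertex misses both ends of the edge \<open>hh'\<close>; if it is longer, it contradicts
  \<open>co_ipath_not_attached\<close>.\<close>

theorem holefree_has_copair: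
  assumes "finite V" "holefree E V" "holefree (co E) V" "x \<in> V" "y \<in> V" "E x y"
  shows "\<exists>x y. copair V x y"
  using assms
proof (induction V arbitrary: x y rule: finite_psubset_induct)
  case (psubset V)
  note coC = ipath_Cons[of "co E", OF co_sym]
  show ?case
  proof (cases "\<exists>H J. handle V H J")
    case False
    have "copair V x y"
      unfolding copair_def
    proof (intro conjI notI)
      assume "\<exists>m. set m \<subseteq> V \<and> length m \<ge> 2 \<and> ipath (co E) (x # m @ [y])"
      then obtain m where m: "set m \<subseteq> V" "length m \<ge> 2" "ipath (co E) (x # m @ [y])" by blast
      obtain p1 p2 q where "m = p1 # p2 # q" using m(2) by (cases m; cases "tl m") auto
      then have "E x p2" "\<not> E p1 x" "\<not> E p1 p2" "p1 \<in> V" "p2 \<in> V"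
        using m by (auto simp: coC co_def E_sym)
      then show False using False handle_exists[of x V p2 p1] psubset.prems by blast
    qed (use psubset.prems in auto)
    then show ?thesis by blast
  next
    case True
    then obtain H J where HJ: "handle V H J"
      and dom: "\<forall>v\<in>V - H. (\<exists>h\<in>H. E v h) \<longrightarrow> (\<forall>x\<in>H. \<forall>y\<in>H. E x y \<longrightarrow> E v x \<or> E v y)"
      using minimal_handle psubset.hyps(1) by blast
    have "H \<subset> V" using HJ by (auto simp: handle_def)
    moreover obtain a b where "a \<in> H" "b \<in> H" "E a b" using HJ by (auto simp: handle_def)
    ultimately obtain x y where xy: "copair H x y"
      using psubset.IH[of H a b] holefree_mono[OF psubset.prems(1), of H]
        holefree_mono[OF psubset.prems(2), of H] by blast
    have "copair V x y"
      unfolding copair_def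
    proof (intro conjI notI)
      assume "\<exists>m. set m \<subseteq> V \<and> length m \<ge> 2 \<and> ipath (co E) (x # m @ [y])"
      then obtain m where m: "set m \<subseteq> V" "length m \<ge> 2" "ipath (co E) (x # m @ [y])" by blast
      have nbr: "\<exists>h\<in>H. E n h" if n: "n \<in> set m" for n
      proof -
        obtain a b q where abq: "m = a # b # q" using m(2) by (cases m; cases "tl m") auto
        have "E n x \<or> E n y"
        proof (cases "n = a")
          case True then show ?thesis using m(3) unfolding abq by (auto simp: coC co_def)
        next
          case False then show ?thesis using m(3) n unfolding abq by (auto simp: coC co_def E_sym)
        qed
        then show ?thesis using xy by (auto simp: copair_def)
      qed
      have xyH: "x \<in> H" "y \<in> H" using xy by (auto simp: copair_def)
      have nJ: "n \<in> V - H" "\<exists>j\<in>J. E n j" "n \<notin> J" if nm: "n \<in> set m" "n \<notin> H" for n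
        proof -
        show "n \<in> V - H" using nm m(1) by blast
        then show "\<exists>j\<in>J. E n j" using nbr[OF nm(1)] HJ unfolding handle_def by blast
        obtain h where "h \<in> H" "E h n" using nbr[OF nm(1)] E_sym by blast
        then show "n \<notin> J" using HJ unfolding handle_def by blast
      qed
      have "\<exists>n\<in>set (x # m @ [y]). n \<notin> H"
        proof (rule ccontr)
        assume "\<not> ?thesis"
        then have "set m \<subseteq> H" by auto
        then show False using xy m unfolding copair_def by blast
      qed
      then obtain A n B where AB: "x # m @ [y] = A @ n # B" "n \<notin> H" "\<forall>z\<in>set A. z \<in> H"
        using split_list_first_prop[of "x # m @ [y]" "\<lambda>z. z \<notin> H"] by blast
      have nA: "A \<noteq> []" using AB xyH by (cases A) auto
      then obtain A' h where A: "A = A' @ [h]" by (metis rev_exhaust)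
      have h: "h \<in> H" using AB(3) A by simp
      have "last (x # m @ [y]) = last (A @ n # B)" by (simp only: AB(1))
      then have "last (n # B) = y" by simp
      then have "B \<noteq> []" "last B = y" using AB(2) xyH by (auto split: if_splits)
      then have "\<exists>z\<in>set B. z \<in> H" using last_in_set[of B] xyH by blast
      then obtain S0 h' C where B: "B = S0 @ h' # C" "h' \<in> H" "\<forall>z\<in>set S0. z \<notin> H"
        using split_list_first_prop[of B "\<lambda>z. z \<in> H"] by blast
      let ?S = "n # S0"
      have eq: "x # m @ [y] = A' @ (h # ?S @ [h']) @ C" using AB(1) A B by simp
      have ip: "ipath (co E) (h # ?S @ [h'])"
        using m(3) unfolding eq ipath_append[of "co E", OF co_sym] by blast
      have subm: "z \<in> set m" if "z \<in> set ?S" for z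
      proof -
        have "z \<in> set (x # m @ [y])" using that unfolding eq by auto
        moreover have "z \<notin> H" using that B AB by auto
        ultimately show ?thesis using xyH by auto
      qed
      have nH: "z \<notin> H" if "z \<in> set ?S" for z using that B AB by auto
      show False
      proof (cases "S0 = []")
        case True
        then have "co E h n" "co E n h'" "\<not> co E h h'" "h \<noteq> h'"
          using ip by (auto simp: coC)
        then show False
          using dom[rule_format, of n h h'] nJ(1)[of n] nbr[of n] subm[of n] nH[of n] h B(2)
          by (simp add: co_def E_sym)
      next
        case False
        show False
        proof (rule co_ipath_not_attached[OF psubset.prems(1,2) _ _ ip])
          show "J \<subseteq> V" "connected J" using HJ by (auto simp: handle_def)
          show "set (h # ?S @ [h']) \<subseteq> V" using h B(2) HJ subm m(1) unfolding handle_def by auto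
          show "length ?S \<ge> 2" using False by (cases S0) auto
          show "set (h # ?S @ [h']) \<inter> J = {}" using h B(2) HJ nJ(3)[OF subm nH] unfolding handle_def by auto
          show "\<exists>j\<in>J. E z j" if "z \<in> set ?S" for z using nJ(2)[OF subm nH] that by blast
          show "\<not> E h j" "\<not> E h' j" if "j \<in> J" for j using h B(2) HJ that unfolding handle_def by blast+
        qed
      qed
    qed (use xy HJ in \<open>auto simp: copair_def handle_def\<close>)
    then show ?thesis by blast
  qed
qed

definition del :: "'a \<Rightarrow> 'a \<Rightarrow> 'a \<Rightarrow> 'a \<Rightarrow> bool" where
  "del x y u v \<longleftrightarrow> E u v \<and> {u, v} \<noteq> {x, y}"

lemma ipath_del_cong:
  assumes "x \<notin> set p"
  shows "ipath (del x y) p \<longleftrightarrow> ipath E p" "ipath (co (del x y)) p \<longleftrightarrow> ipath (co E) p"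
  using assms by (auto intro!: ipath_cong simp: del_def co_def doubleton_eq_iff)

lemma copairD:
  assumes "copair V x y" "set m \<subseteq> V" "length m \<ge> 2" "ipath (co E) (x # m @ [y])"
  shows False
  using assms unfolding copair_def by blast

text \<open>Removing the edge \<open>xy\<close> creates no antihole: in the complement a new hole passes through the new edge
  \<open>xy\<close>, and its other edges form a forbidden path between \<open>x\<close> and \<open>y\<close>.\<close>

lemma holefree_co_del:
  assumes cp: "copair V x y" and hf: "holefree (co E) V"
  shows "holefree (co (del x y)) V"
  unfolding holefree_def
proof
  assume "\<exists>c. set c \<subseteq> V \<and> 5 \<le> length c \<and> cycle_adj (co (del x y)) c"
  then obtain c where c: "set c \<subseteq> V" "5 \<le> length c" "cycle_adj (co (del x y)) c" by blast
  have xy: "x \<noteq> y" "E x y" using cp by (auto simp: copair_def)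
  show False
  proof (cases "x \<in> set c \<and> y \<in> set c")
    case False
    then have "cycle_adj (co (del x y)) c \<longleftrightarrow> cycle_adj (co E) c"
      by (intro cycle_adj_cong) (auto simp: co_def del_def doubleton_eq_iff)
    then show False using c hf by (simp add: holefree_def)
  next
    case True
    then obtain u m w where p: "ipath (co (del x y)) (u # m @ [w])" "length m + 3 = length c"
      "set c = insert x (set (u # m @ [w]))" "x \<notin> set (u # m @ [w])"
      "co (del x y) x u" "co (del x y) x w" "\<forall>z\<in>set m. \<not> co (del x y) x z"
      using cycle_open[OF c(3,2)] by metis
    have ip: "ipath (co E) (u # m @ [w])" using p(1) p(4) ipath_del_cong(2) by blast
    have dist: "distinct (u # m @ [w])" using ip by (simp only: ipath_def)
    have "co (del x y) x y" using xy by (simp add: co_def del_def)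
    then have "y = u \<or> y = w" using p(3,7) True xy by auto
    then show False
    proof
      assume y: "y = u"
      have "ipath (co E) ((u # m @ [w]) @ [x])"
      proof (rule ipath_snoc[OF co_sym ip])
        have "\<not> co E z x" if "z \<in> set (m)" for z
          using p(4,7) that y dist by (auto simp: co_def del_def doubleton_eq_iff E_sym)
        moreover have "\<not> co E u x" using xy y by (simp add: co_def E_sym)
        ultimately show "\<forall>z\<in>set (butlast (u # m @ [w])). \<not> co E z x" by (simp add: butlast_append)
        show "co E (last (u # m @ [w])) x"
          using p(6) dist y by (auto simp: co_def del_def doubleton_eq_iff E_sym)
      qed (use p(4) in auto)
      then have "ipath (co E) (y # (m @ [w]) @ [x])" using y by simp
      moreover have "set (m @ [w]) \<subseteq> V" "length (m @ [w]) \<ge> 2" using p(2,3) c(1,2) by auto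
      ultimately show False using copairD[OF copair_sym[OF cp]] by blast
    next
      assume y: "y = w"
      have "ipath (co E) (x # (u # m) @ [y])"
      proof -
        have "\<not> co E x z" if "z \<in> set m" for z
          using p(4,7) that y dist by (auto simp: co_def del_def doubleton_eq_iff E_sym)
        moreover have "\<not> co E x y" using xy by (simp add: co_def)
        moreover have "co E x u" using p(5) dist y by (auto simp: co_def del_def doubleton_eq_iff)
        ultimately show ?thesis
          using ip y p(4) by (simp add: ipath_Cons[of "co E", OF co_sym] ball_Un)
      qed
      moreover have "set (u # m) \<subseteq> V" "length (u # m) \<ge> 2" using p(2,3) c(1,2) by auto
      ultimately show False using copairD[OF cp] by blast
    qed
  qed
qed

text \<open>Removing the edge \<open>xy\<close> creates no hole: in a new hole \<open>x\<close> and \<open>y\<close> are not consecutive, so \<open>xy\<close> is a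
  chord of it in the old graph. An arc from \<open>x\<close> to \<open>y\<close> with at least three inner vertices closes with
  \<open>xy\<close> to an old hole. Two arcs with at most two inner vertices each leave only pentagons and the
  hexagon, and these contain a forbidden induced path of the complement.\<close>

lemma holefree_del:
  assumes cp: "copair V x y" and hf: "holefree E V"
  shows "holefree (del x y) V"
  unfolding holefree_def
proof
  note EC = ipath_Cons[of E, OF E_sym] and coC = ipath_Cons[of "co E", OF co_sym]
  assume "\<exists>c. set c \<subseteq> V \<and> 5 \<le> length c \<and> cycle_adj (del x y) c"
  then obtain c where c: "set c \<subseteq> V" "5 \<le> length c" "cycle_adj (del x y) c" by blast
  have xy: "x \<noteq> y" "E x y" "E y x" using cp E_sym by (auto simp: copair_def)
  show False
  proof (cases "x \<in> set c \<and> y \<in> set c")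
    case False
    then have "cycle_adj (del x y) c \<longleftrightarrow> cycle_adj E c"
      by (intro cycle_adj_cong) (auto simp: del_def doubleton_eq_iff)
    then show False using c hf by (simp add: holefree_def)
  next
    case True
    then obtain u m w where p: "ipath (del x y) (u # m @ [w])" "length m + 3 = length c"
      "set c = insert x (set (u # m @ [w]))" "x \<notin> set (u # m @ [w])"
      "del x y x u" "del x y x w" "\<forall>z\<in>set m. \<not> del x y x z"
      using cycle_open[OF c(3,2)] by metis
    have ip: "ipath E (u # m @ [w])" using p(1) p(4) ipath_del_cong(1) by blast
    have uw: "E x u" "E x w" "u \<noteq> y" "w \<noteq> y" using p(5,6) by (auto simp: del_def)
    have mz: "\<not> E x z" if "z \<in> set m" "z \<noteq> y" for z
      using p(7) that xy by (auto simp: del_def doubleton_eq_iff)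
    have "y \<in> set m" using p(3) True xy uw by auto
    then obtain A B where m: "m = A @ y # B" by (meson split_list)
    have dist: "distinct (u # m @ [w])" using ip by (simp only: ipath_def)
    have inV: "x \<in> V" "set (u # m @ [w]) \<subseteq> V" using c(1) p(3) by auto
    have ipL: "ipath E (u # A @ [y])" and ipR: "ipath E (y # B @ [w])"
    proof -
      have "u # m @ [w] = (u # A @ [y]) @ (B @ [w])" by (simp add: m)
      then show "ipath E (u # A @ [y])" using ip ipath_append[of E, OF E_sym] by metis
      have "u # m @ [w] = (u # A) @ (y # B @ [w])" by (simp add: m)
      then show "ipath E (y # B @ [w])" using ip ipath_append[of E, OF E_sym] by metis
    qed
    have "\<not> length A \<ge> 2"
    proof
      assume "length A \<ge> 2"
      then show False
        using holefree_close[OF hf E_sym ipL, of x] uw xy mz inV p(4) dist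
        by (auto simp: m)
    qed
    moreover have "\<not> length B \<ge> 2"
    proof
      assume "length B \<ge> 2"
      then show False
        using holefree_close[OF hf E_sym ipR, of x] uw xy mz inV p(4) dist
        by (auto simp: m)
    qed
    moreover have "length A + length B \<ge> 1" using p(2) c(2) m by simp
    ultimately consider b where "A = []" "B = [b]" | a where "A = [a]" "B = []"
      | a b where "A = [a]" "B = [b]"
      by (cases A; cases "tl A"; cases B; cases "tl B") auto
    then show False
    proof cases
      case (1 b)
      \<comment> \<open>the pentagon \<open>x, u, y, b, w\<close>: its complement is a pentagon too\<close>
      have "ipath (co E) (x # [b, u, w] @ [y])"
        using ip uw xy mz[of b] dist p(4) unfolding m 1
        by (auto simp: coC EC co_def E_sym ipath_single)
      then show False using copairD[OF cp, of "[b, u, w]"] inV by (simp add: m 1)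
    next
      case (2 a)
      \<comment> \<open>the pentagon \<open>x, u, a, y, w\<close>\<close>
      have "ipath (co E) (x # [a, w, u] @ [y])"
        using ip uw xy mz[of a] dist p(4) unfolding m 2
        by (auto simp: coC EC co_def E_sym ipath_single)
      then show False using copairD[OF cp, of "[a, w, u]"] inV by (simp add: m 2)
    next
      case (3 a b)
      \<comment> \<open>the hexagon \<open>x, u, a, y, b, w\<close> with the long chord \<open>xy\<close>\<close>
      have "ipath (co E) (x # [b, u] @ [y])"
        using ip uw xy mz[of b] dist p(4) unfolding m 3
        by (auto simp: coC EC co_def E_sym ipath_single)
      then show False using copairD[OF cp, of "[b, u]"] inV by (simp add: m 3)
    qed
  qed
qed

text \<open>The two sides are the component of \<open>x\<close> in the complement of \<open>U\<close> and the rest. The rest contains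
  \<open>y\<close>: an induced path of the complement from \<open>x\<close> to \<open>y\<close> would have exactly one inner vertex, and
  every vertex of \<open>U\<close> sees \<open>x\<close> or \<open>y\<close>.\<close>

lemma copair_bipartition:
  assumes cp: "copair V x y" and U: "U \<subseteq> V" "x \<in> U" "y \<in> U"
    and dom: "\<And>u. u \<in> U \<Longrightarrow> u = x \<or> u = y \<or> E u x \<or> E u y"
  shows "\<exists>X Y. x \<in> X \<and> y \<in> Y \<and> X \<inter> Y = {} \<and> X \<union> Y = U \<and> (\<forall>a\<in>X. \<forall>b\<in>Y. E a b)"
proof -
  note coC = ipath_Cons[of "co E", OF co_sym]
  let ?X = "{w. reach (co E) U x w}"
  have "y \<notin> ?X"
  proof
    assume "y \<in> ?X"
    then have "reach (co E) U x y" by simp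
    then obtain p where p: "ipath (co E) (x # p)" "set p \<subseteq> U" "last (x # p) = y"
      using reach_ipath[of "co E" U x y] co_sym U by auto
    have xy: "x \<noteq> y" "E x y" using cp by (auto simp: copair_def)
    then have "p \<noteq> []" using p(3) by auto
    then obtain m where m: "p = m @ [y]" using p(3) by (metis append_butlast_last_id last_ConsR)
    have "\<not> length m \<ge> 2" using copairD[OF cp, of m] p U by (auto simp: m)
    then consider "m = []" | z where "m = [z]" by (cases m; cases "tl m") auto
    then show False
    proof cases
      case 1
      then show ?thesis using p(1) m xy by (simp add: coC co_def)
    next
      case (2 z)
      then show ?thesis using p(1,2) m xy dom[of z] by (auto simp: coC co_def E_sym)
    qed
  qed
  moreover have sub: "?X \<subseteq> U" using reach_in[of "co E" U x] U(2) by blast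
  moreover have "E a b" if "a \<in> ?X" "b \<in> U - ?X" for a b
  proof (rule ccontr)
    assume "\<not> E a b"
    then have "reach (co E) U a b"
      using that sub by (intro reach_edge) (auto simp: co_def)
    then show False using that reach_trans[of "co E" U x a b] by simp
  qed
  ultimately show ?thesis using U by (intro exI[of _ ?X] exI[of _ "U - ?X"]) auto
qed

end

section \<open>Weakly chordal graphs and strongly disjoint families\<close>

definition adj :: "'v graph \<Rightarrow> 'v \<Rightarrow> 'v \<Rightarrow> bool" where
  "adj G u v \<longleftrightarrow> {u, v} \<in> edges G"

lemma sym_graph_adj: "simple_graph G \<Longrightarrow> sym_graph (adj G)"
  by unfold_locales (auto simp: adj_def simple_graph_def insert_commute)

lemma adj_in_verts: "simple_graph G \<Longrightarrow> adj G u v \<Longrightarrow> u \<in> verts G \<and> v \<in> verts G"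
  by (auto simp: adj_def simple_graph_def)

lemma edge_adj:
  assumes G: "simple_graph G" and e: "e \<in> edges G" "x \<in> e"
  shows "\<exists>a. e = {x, a} \<and> adj G x a"
proof -
  obtain u v where uv: "e = {u, v}" using G e(1) by (auto simp: simple_graph_def card_2_iff)
  then have "e = {x, if x = u then v else u}" using e(2) by auto
  then show ?thesis using e(1) unfolding adj_def by blast
qed

lemma weakly_chordal_iff:
  "weakly_chordal G \<longleftrightarrow> holefree (adj G) (verts G) \<and> holefree (co (adj G)) (verts G)"
proof -
  have 1: "induced_cycle G c \<longleftrightarrow> set c \<subseteq> verts G \<and> cycle_adj (adj G) c" for c
    by (simp add: induced_cycle_def cycle_adj_def adj_def)
  have 2: "induced_cycle (complement G) c \<longleftrightarrow> set c \<subseteq> verts G \<and> cycle_adj (co (adj G)) c" for c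
  proof -
    have "{u, v} \<in> edges (complement G) \<longleftrightarrow> co (adj G) u v" if "u \<in> verts G" "v \<in> verts G" for u v
      using that by (auto simp: complement_def co_def adj_def doubleton_eq_iff insert_commute)
    moreover have "verts (complement G) = verts G" by (simp add: complement_def)
    ultimately show ?thesis
      unfolding induced_cycle_def cycle_adj_def by (auto simp: subset_iff)
  qed
  show ?thesis
    unfolding weakly_chordal_def holefree_def 1 2 by blast
qed

definition induced :: "'v graph \<Rightarrow> 'v set \<Rightarrow> 'v graph" where
  "induced G W = \<lparr>verts = W, edges = {e \<in> edges G. e \<subseteq> W}\<rparr>"

definition del_edge :: "'v graph \<Rightarrow> 'v set \<Rightarrow> 'v graph" where
  "del_edge G e = \<lparr>verts = verts G, edges = edges G - {e}\<rparr>"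

lemma induced_simps [simp]: "verts (induced G W) = W" "edges (induced G W) = {e \<in> edges G. e \<subseteq> W}"
  by (simp_all add: induced_def)

lemma del_edge_simps [simp]: "verts (del_edge G e) = verts G" "edges (del_edge G e) = edges G - {e}"
  by (simp_all add: del_edge_def)

lemma simple_graph_induced: "simple_graph G \<Longrightarrow> W \<subseteq> verts G \<Longrightarrow> simple_graph (induced G W)"
  by (auto simp: simple_graph_def finite_subset)

lemma simple_graph_del_edge: "simple_graph G \<Longrightarrow> simple_graph (del_edge G e)"
  by (auto simp: simple_graph_def)

lemma weakly_chordal_induced:
  assumes "weakly_chordal G" "W \<subseteq> verts G"
  shows "weakly_chordal (induced G W)"
proof -
  have "cycle_adj (adj (induced G W)) c \<longleftrightarrow> cycle_adj (adj G) c"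
    "cycle_adj (co (adj (induced G W))) c \<longleftrightarrow> cycle_adj (co (adj G)) c" if "set c \<subseteq> W" for c
    using that by (auto intro!: cycle_adj_cong simp: adj_def co_def)
  then show ?thesis
    using assms unfolding weakly_chordal_iff holefree_def by (metis induced_simps(1) order_trans)
qed

lemma strongly_disjoint_induced:
  assumes "strongly_disjoint (induced G W) Bs" "W \<subseteq> verts G"
  shows "strongly_disjoint G Bs"
proof -
  have sub: "subgraph B G" "\<And>e. e \<in> edges B \<Longrightarrow> e \<subseteq> W" if "B \<in> set Bs" for B
  proof -
    have "subgraph B (induced G W)" using assms that by (simp add: strongly_disjoint_def)
    then have "verts B \<subseteq> W" "edges B \<subseteq> {e \<in> edges G. e \<subseteq> W}" by (simp_all add: subgraph_def)
    then show "subgraph B G" "\<And>e. e \<in> edges B \<Longrightarrow> e \<subseteq> W" using assms(2) unfolding subgraph_def by blast+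
  qed
  obtain es where es: "\<And>i. i < length Bs \<Longrightarrow> es i \<in> edges (Bs ! i)"
    "\<And>i j. i < length Bs \<Longrightarrow> j < length Bs \<Longrightarrow> i \<noteq> j \<Longrightarrow> three_disjoint (induced G W) (es i) (es j)"
    using assms(1) unfolding strongly_disjoint_def by blast
  have W: "es i \<subseteq> W" if "i < length Bs" for i
    using sub(2)[of "Bs ! i"] es(1) that by simp
  have "three_disjoint G (es i) (es j)" if ij: "i < length Bs" "j < length Bs" "i \<noteq> j" for i j
    unfolding three_disjoint_def
  proof (intro conjI ballI notI)
    show "es i \<inter> es j = {}" using es(2)[OF ij] by (simp add: three_disjoint_def)
    fix u v assume "u \<in> es i" "v \<in> es j" "{u, v} \<in> edges G"
    moreover from this have "{u, v} \<in> edges (induced G W)" using W[OF ij(1)] W[OF ij(2)] by auto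
    ultimately show False using es(2)[OF ij] unfolding three_disjoint_def by blast
  qed
  then show ?thesis
    using assms(1) sub(1) es(1) unfolding strongly_disjoint_def by blast
qed

lemma strongly_disjoint_Cons:
  assumes Bs: "strongly_disjoint G Bs" and B: "complete_bipartite B" "subgraph B G" "e \<in> edges B"
    and disj: "\<And>C. C \<in> set Bs \<Longrightarrow> verts B \<inter> verts C = {}"
    and three: "\<And>C f. C \<in> set Bs \<Longrightarrow> f \<in> edges C \<Longrightarrow> three_disjoint G e f \<and> three_disjoint G f e"
  shows "strongly_disjoint G (B # Bs)"
proof -
  obtain es where es: "\<And>i. i < length Bs \<Longrightarrow> es i \<in> edges (Bs ! i)"
    "\<And>i j. i < length Bs \<Longrightarrow> j < length Bs \<Longrightarrow> i \<noteq> j \<Longrightarrow> three_disjoint G (es i) (es j)"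
    using Bs unfolding strongly_disjoint_def by blast
  have v: "verts (Bs ! i) \<inter> verts (Bs ! j) = {}" if "i < length Bs" "j < length Bs" "i \<noteq> j" for i j
    using Bs that unfolding strongly_disjoint_def by blast
  show ?thesis
    unfolding strongly_disjoint_def
  proof (intro conjI exI[of _ "case_nat e es"] allI impI)
    show "\<forall>C\<in>set (B # Bs). complete_bipartite C \<and> subgraph C G"
      using Bs B by (auto simp: strongly_disjoint_def)
    show "verts ((B # Bs) ! i) \<inter> verts ((B # Bs) ! j) = {}"
      if "i < length (B # Bs)" "j < length (B # Bs)" "i \<noteq> j" for i j
    proof -
      have "verts B \<inter> verts (Bs ! k) = {}" "verts (Bs ! k) \<inter> verts B = {}" if "k < length Bs" for k
        using disj[of "Bs ! k"] that by (simp_all add: Int_commute)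
      then show ?thesis using that v by (cases i; cases j) auto
    qed
    show "case_nat e es i \<in> edges ((B # Bs) ! i)" if "i < length (B # Bs)" for i
      using that es(1) B(3) by (cases i) auto
    show "three_disjoint G (case_nat e es i) (case_nat e es j)"
      if "i < length (B # Bs)" "j < length (B # Bs)" "i \<noteq> j" for i j
    proof -
      have "three_disjoint G e (es k)" "three_disjoint G (es k) e" if "k < length Bs" for k
        using three[of "Bs ! k" "es k"] es(1) that by simp_all
      then show ?thesis using that es(2) by (cases i; cases j) auto
    qed
  qed
qed

definition co_pair :: "'v graph \<Rightarrow> 'v \<Rightarrow> 'v \<Rightarrow> bool" where
  "co_pair G x y \<longleftrightarrow> sym_graph.copair (adj G) (verts G) x y"

lemma weakly_chordal_co_pair:
  assumes G: "simple_graph G" "weakly_chordal G" "edges G \<noteq> {}"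
  shows "\<exists>x y. co_pair G x y"
proof -
  interpret sym_graph "adj G" by (rule sym_graph_adj[OF G(1)])
  obtain e where "e \<in> edges G" using G(3) by blast
  moreover from this have "e \<noteq> {}" using G(1) by (auto simp: simple_graph_def)
  ultimately obtain u v where uv: "adj G u v" using edge_adj[OF G(1)] by blast
  show ?thesis
    using holefree_has_copair[of "verts G" u v] uv adj_in_verts[OF G(1) uv] G
    unfolding co_pair_def weakly_chordal_iff by (auto simp: simple_graph_def)
qed

lemma weakly_chordal_del_co_pair:
  assumes G: "simple_graph G" "weakly_chordal G" and xy: "co_pair G x y"
  shows "weakly_chordal (del_edge G {x, y})"
proof -
  interpret sym_graph "adj G" by (rule sym_graph_adj[OF G(1)])
  have "adj (del_edge G {x, y}) = del x y"
    by (auto simp: fun_eq_iff adj_def del_def)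
  then show ?thesis
    using holefree_del[OF xy[unfolded co_pair_def]] holefree_co_del[OF xy[unfolded co_pair_def]] G(2)
    unfolding weakly_chordal_iff by simp
qed

text \<open>Two chosen edges that are three-disjoint in \<open>G - xy\<close> but not in \<open>G\<close> have the form \<open>xa\<close> and \<open>yb\<close>,
  and then \<open>x, b, a, y\<close> is an induced path of the complement.\<close>

lemma strongly_disjoint_del_co_pair:
  assumes G: "simple_graph G" and xy: "co_pair G x y"
    and Bs: "strongly_disjoint (del_edge G {x, y}) Bs"
  shows "strongly_disjoint G Bs"
proof -
  interpret sym_graph "adj G" by (rule sym_graph_adj[OF G(1)])
  let ?G' = "del_edge G {x, y}"
  have cp: "copair (verts G) x y" using xy by (simp add: co_pair_def)
  have P4: False if e: "e \<in> edges G" "f \<in> edges G" "x \<in> e" "y \<in> f" and d: "three_disjoint ?G' e f" for e f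
  proof -
    obtain a where a: "e = {x, a}" "adj G x a"
      using edge_adj[OF G e(1) e(3)] by blast
    obtain b where b: "f = {y, b}" "adj G y b"
      using edge_adj[OF G e(2) e(4)] by blast
    have "e \<inter> f = {}" "\<forall>u\<in>e. \<forall>v\<in>f. {u, v} \<notin> edges ?G'"
      using d unfolding three_disjoint_def by blast+
    then have dist: "x \<noteq> b" "a \<noteq> y" "a \<noteq> b" "x \<noteq> y"
      and "{x, b} \<notin> edges ?G'" "{a, y} \<notin> edges ?G'" "{a, b} \<notin> edges ?G'"
      unfolding a(1) b(1) by blast+
    moreover have xa: "x \<noteq> a" "y \<noteq> b" using a(2) b(2) by auto
    ultimately have "\<not> adj G x b" "\<not> adj G a y" "\<not> adj G a b"
      using dist unfolding adj_def by (simp_all add: doubleton_eq_iff)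
    moreover have "adj G x y" using cp by (simp add: copair_def)
    ultimately have "ipath (co (adj G)) (x # [b, a] @ [y])"
      using dist xa a(2) b(2) by (simp add: ipath_Cons[of "co (adj G)", OF co_sym] co_def ipath_single E_sym)
    moreover have "set [b, a] \<subseteq> verts G" using adj_in_verts[OF G] a b by auto
    ultimately show False using copairD[OF cp, of "[b, a]"] by simp
  qed
  have three: "three_disjoint G e f"
    if "three_disjoint ?G' e f" "three_disjoint ?G' f e" "e \<in> edges G" "f \<in> edges G" for e f
    unfolding three_disjoint_def
  proof (intro conjI ballI notI)
    show "e \<inter> f = {}" using that by (simp add: three_disjoint_def)
    fix u v assume uv: "u \<in> e" "v \<in> f" "{u, v} \<in> edges G"
    then have "{u, v} = {x, y}" using that(1) by (auto simp: three_disjoint_def)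
    then show False using P4[of e f] P4[of f e] that uv by (auto simp: doubleton_eq_iff)
  qed
  obtain es where es: "\<And>i. i < length Bs \<Longrightarrow> es i \<in> edges (Bs ! i)"
    "\<And>i j. i < length Bs \<Longrightarrow> j < length Bs \<Longrightarrow> i \<noteq> j \<Longrightarrow> three_disjoint ?G' (es i) (es j)"
    using Bs unfolding strongly_disjoint_def by blast
  have sub: "subgraph B G" "complete_bipartite B" if "B \<in> set Bs" for B
    using Bs that unfolding strongly_disjoint_def subgraph_def by auto
  have "es i \<in> edges G" if "i < length Bs" for i
    using es(1)[OF that] sub(1)[of "Bs ! i"] that by (auto simp: subgraph_def)
  then have "three_disjoint G (es i) (es j)" if "i < length Bs" "j < length Bs" "i \<noteq> j" for i j
    using three es(2) that by metis
  then show ?thesis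
    using Bs es(1) sub unfolding strongly_disjoint_def by blast
qed

text \<open>The vertices in \<open>W\<close> do not see the edge \<open>xy\<close>, so \<open>xy\<close> can serve as the chosen edge of the new
  member of the family.\<close>

lemma strongly_disjoint_add_co_pair:
  assumes G: "simple_graph G" and xy: "co_pair G x y"
    and T: "\<And>t. t \<in> T \<Longrightarrow> adj G t x \<or> adj G t y"
    and W: "W = {v \<in> verts G. v \<noteq> x \<and> v \<noteq> y \<and> \<not> adj G v x \<and> \<not> adj G v y}"
    and Bs: "strongly_disjoint (induced G W) Bs"
  shows "\<exists>B. strongly_disjoint G (B # Bs) \<and> verts B = insert x (insert y T)"
proof -
  interpret sym_graph "adj G" by (rule sym_graph_adj[OF G(1)])
  have cp: "copair (verts G) x y" using xy by (simp add: co_pair_def)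
  let ?U = "insert x (insert y T)"
  have xyV: "x \<in> verts G" "y \<in> verts G" using cp by (auto simp: copair_def)
  have U: "?U \<subseteq> verts G" using T adj_in_verts[OF G] xyV by blast
  obtain X Y where XY: "x \<in> X" "y \<in> Y" "X \<inter> Y = {}" "X \<union> Y = ?U" "\<forall>a\<in>X. \<forall>b\<in>Y. adj G a b"
  proof -
    have "u = x \<or> u = y \<or> adj G u x \<or> adj G u y" if "u \<in> ?U" for u
      using T[of u] that by blast
    then show ?thesis using copair_bipartition[OF cp U] that by blast
  qed
  define B where "B = \<lparr>verts = X \<union> Y, edges = {{x, y} | x y. x \<in> X \<and> y \<in> Y}\<rparr>"
  have fin: "finite X" "finite Y" using U XY(4) G by (auto simp: simple_graph_def intro: finite_subset)
  have inW: "verts C \<subseteq> W" "\<And>f. f \<in> edges C \<Longrightarrow> f \<subseteq> W" if "C \<in> set Bs" for C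
  proof -
    have "subgraph C (induced G W)" using Bs that by (simp add: strongly_disjoint_def)
    then have "verts C \<subseteq> W" "edges C \<subseteq> {e \<in> edges G. e \<subseteq> W}" by (simp_all add: subgraph_def)
    then show "verts C \<subseteq> W" "\<And>f. f \<in> edges C \<Longrightarrow> f \<subseteq> W" by blast+
  qed
  have "strongly_disjoint G (B # Bs)"
  proof (rule strongly_disjoint_Cons)
    show "strongly_disjoint G Bs"
      using strongly_disjoint_induced[OF Bs] W by blast
    show "complete_bipartite B"
      using XY fin unfolding complete_bipartite_def B_def by (intro exI[of _ X] exI[of _ Y]) auto
    show "subgraph B G"
      using XY U by (auto simp: subgraph_def B_def adj_def)
    show "{x, y} \<in> edges B" using XY by (auto simp: B_def)
    fix C assume C: "C \<in> set Bs"
    have "?U \<inter> W = {}" using T W by auto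
    then show "verts B \<inter> verts C = {}" using inW(1)[OF C] XY(4) by (auto simp: B_def)
    fix f assume "f \<in> edges C"
    then have "f \<subseteq> W" using inW(2) C by blast
    moreover have "\<not> adj G v x" "\<not> adj G v y" "\<not> adj G x v" "\<not> adj G y v" "v \<noteq> x" "v \<noteq> y" if "v \<in> W" for v
      using that W by (auto simp: E_sym)
    ultimately show "three_disjoint G {x, y} f \<and> three_disjoint G f {x, y}"
      unfolding three_disjoint_def adj_def by blast
  qed
  then show ?thesis using XY(4) by (intro exI[of _ B]) (simp add: B_def)
qed

section \<open>Frames of multigraded resolutions\<close>

abbreviation lookup :: "('a \<Rightarrow>\<^sub>0 'b::zero) \<Rightarrow> 'a \<Rightarrow> 'b" where "lookup \<equiv> Poly_Mapping.lookup"
abbreviation keys :: "('a \<Rightarrow>\<^sub>0 'b::zero) \<Rightarrow> 'a set" where "keys \<equiv> Poly_Mapping.keys"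
abbreviation single :: "'a \<Rightarrow> 'b::zero \<Rightarrow> 'a \<Rightarrow>\<^sub>0 'b" where "single \<equiv> Poly_Mapping.single"

definition lin :: "((nat \<Rightarrow>\<^sub>0 'k::field) \<Rightarrow> (nat \<Rightarrow>\<^sub>0 'k)) \<Rightarrow> bool" where
  "lin h \<longleftrightarrow> (\<forall>u v. h (u + v) = h u + h v) \<and> (\<forall>c v. h (vec_scale c v) = vec_scale c (h v))"

definition functional :: "((nat \<Rightarrow>\<^sub>0 'k::field) \<Rightarrow> 'k) \<Rightarrow> bool" where
  "functional h \<longleftrightarrow> (\<forall>u v. h (u + v) = h u + h v) \<and> (\<forall>c v. h (vec_scale c v) = c * h v)"

abbreviation unit :: "nat \<Rightarrow> nat \<Rightarrow>\<^sub>0 'k::field" where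
  "unit j \<equiv> single j 1"

text \<open>The linear map with prescribed values on the unit vectors.\<close>

definition ext :: "(nat \<Rightarrow> nat \<Rightarrow>\<^sub>0 'k::field) \<Rightarrow> (nat \<Rightarrow>\<^sub>0 'k) \<Rightarrow> (nat \<Rightarrow>\<^sub>0 'k)" where
  "ext g v = (\<Sum>j\<in>keys v. vec_scale (lookup v j) (g j))"

lemma lin_add: "lin h \<Longrightarrow> h (u + v) = h u + h v" by (simp add: lin_def)
lemma lin_scale: "lin h \<Longrightarrow> h (vec_scale c v) = vec_scale c (h v)" by (simp add: lin_def)
lemma lin_zero [simp]: "lin h \<Longrightarrow> h 0 = 0" using lin_add[of h 0 0] by (metis add_0 add_cancel_right_left)
lemma lin_diff: "lin h \<Longrightarrow> h (u - v) = h u - h v"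
  using lin_add[of h "u - v" v] by (simp add: algebra_simps)
lemma lin_uminus: "lin h \<Longrightarrow> h (- v) = - h v"
  using lin_diff[of h 0 v] by simp
lemma lin_sum: "lin h \<Longrightarrow> h (sum f A) = (\<Sum>i\<in>A. h (f i))"
  by (induction A rule: infinite_finite_induct) (simp_all add: lin_add)

lemma functional_add: "functional h \<Longrightarrow> h (u + v) = h u + h v" by (simp add: functional_def)
lemma functional_scale: "functional h \<Longrightarrow> h (vec_scale c v) = c * h v" by (simp add: functional_def)
lemma functional_zero [simp]: "functional h \<Longrightarrow> h 0 = 0" using functional_add[of h 0 0] by (metis add_0 add_cancel_right_left)
lemma functional_diff: "functional h \<Longrightarrow> h (u - v) = h u - h v"
  using functional_add[of h "u - v" v] by (simp add: algebra_simps)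
lemma functional_sum: "functional h \<Longrightarrow> h (sum f A) = (\<Sum>i\<in>A. h (f i))"
  by (induction A rule: infinite_finite_induct) (simp_all add: functional_add)

lemma vec_scale_single [simp]: "vec_scale c (single j b) = single j (c * b)"
  by (intro poly_mapping_eqI) (simp add: lookup_vec_scale lookup_single when_def)

lemma sum_singles: "(v :: nat \<Rightarrow>\<^sub>0 'k::field) = (\<Sum>j\<in>keys v. vec_scale (lookup v j) (unit j))"
proof (intro poly_mapping_eqI)
  fix l
  have "lookup (\<Sum>j\<in>keys v. single j (lookup v j)) l
      = (\<Sum>j\<in>keys v. if j = l then lookup v j else 0)"
    by (simp add: lookup_sum lookup_single when_def)
  also have "\<dots> = lookup v l"
    by (simp add: sum.delta in_keys_iff)
  finally show "lookup v l =
      lookup (\<Sum>j\<in>keys v. vec_scale (lookup v j) (unit j)) l"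
    by simp
qed

lemma lin_expand: "lin h \<Longrightarrow> h v = (\<Sum>j\<in>keys v. vec_scale (lookup v j) (h (unit j)))"
  by (subst (1) sum_singles) (simp only: lin_sum lin_scale)

lemma functional_expand:
  "functional h \<Longrightarrow> h v = (\<Sum>j\<in>keys v. lookup v j * h (unit j))"
  by (subst (1) sum_singles) (simp only: functional_sum functional_scale)

lemma lin_eq: "lin h \<Longrightarrow> lin h' \<Longrightarrow> (\<And>j. j \<in> keys v \<Longrightarrow> h (unit j) = h' (unit j)) \<Longrightarrow> h v = h' v"
  unfolding lin_expand[of h v] lin_expand[of h' v] by (rule sum.cong) simp_all

lemma functional_eq:
  "functional h \<Longrightarrow> functional h' \<Longrightarrow> (\<And>j. j \<in> keys v \<Longrightarrow> h (unit j) = h' (unit j)) \<Longrightarrow> h v = h' v"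
  unfolding functional_expand[of h v] functional_expand[of h' v] by (rule sum.cong) simp_all

lemma lin_in_subspace:
  assumes "lin h" "vec.subspace W" "\<And>j. j \<in> keys v \<Longrightarrow> h (unit j) \<in> W"
  shows "h v \<in> W"
  unfolding lin_expand[OF assms(1), of v]
  by (intro vec.subspace_sum vec.subspace_scale assms)

lemma ext_superset:
  assumes "finite A" "keys v \<subseteq> A"
  shows "ext g v = (\<Sum>j\<in>A. vec_scale (lookup v j) (g j))"
  unfolding ext_def
  by (intro sum.mono_neutral_left) (use assms in \<open>auto simp: in_keys_iff\<close>)

lemma lin_ext: "lin (ext g)"
  unfolding lin_def
proof (intro conjI allI)
  fix u v :: "nat \<Rightarrow>\<^sub>0 'a"
  let ?A = "keys u \<union> keys v"
  have "keys (u + v) \<subseteq> ?A" by (rule keys_add)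
  then show "ext g (u + v) = ext g u + ext g v"
    by (simp add: ext_superset[of ?A] lookup_add vec.scale_left_distrib sum.distrib)
next
  fix c and v :: "nat \<Rightarrow>\<^sub>0 'a"
  have "keys (vec_scale c v) \<subseteq> keys v"
    by (auto simp: in_keys_iff lookup_vec_scale)
  then show "ext g (vec_scale c v) = vec_scale c (ext g v)"
    by (simp add: ext_superset[of "keys v"] lookup_vec_scale vec.scale_sum_right)
qed

lemma ext_unit [simp]: "ext g (unit j) = g j"
  by (simp add: ext_def)

lemma subspace_keys: "vec.subspace {v :: nat \<Rightarrow>\<^sub>0 'k::field. keys v \<subseteq> A}"
  unfolding vec.subspace_def
proof (intro conjI ballI allI)
  show "x + y \<in> {v. keys v \<subseteq> A}" if "x \<in> {v. keys v \<subseteq> A}"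
    "y \<in> {v. keys v \<subseteq> A}" for x y :: "nat \<Rightarrow>\<^sub>0 'k"
    using that keys_add[of x y] by auto
  show "vec_scale c x \<in> {v. keys v \<subseteq> A}" if "x \<in> {v. keys v \<subseteq> A}"
    for c and x :: "nat \<Rightarrow>\<^sub>0 'k"
    using that by (auto simp: in_keys_iff lookup_vec_scale subset_iff)
qed simp

text \<open>The complex of vector spaces obtained from a complex of multigraded free modules by setting all
  variables to \<open>1\<close>: ranks, degrees of the basis elements, differentials from position
  \<open>i + 1\<close> to position \<open>i\<close>, and the augmentation. The degree of a homogeneous element is lost, so
  that multiplication by a monomial becomes an inclusion of strands.\<close>

record (overloaded) ('p, 'k) frame =
  rk :: "nat \<Rightarrow> nat"
  dg :: "nat \<Rightarrow> nat \<Rightarrow> 'p"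
  df :: "nat \<Rightarrow> (nat \<Rightarrow>\<^sub>0 'k) \<Rightarrow> (nat \<Rightarrow>\<^sub>0 'k)"
  au :: "(nat \<Rightarrow>\<^sub>0 'k) \<Rightarrow> 'k"

text \<open>The image of the degree \<open>a\<close> part of the \<open>i\<close>-th free module.\<close>

definition strand :: "('p::order, 'k::field) frame \<Rightarrow> nat \<Rightarrow> 'p \<Rightarrow> (nat \<Rightarrow>\<^sub>0 'k) set" where
  "strand X i a = {v. keys v \<subseteq> {j. j < rk X i \<and> dg X i j \<le> a}}"

text \<open>The image of the elements of degree \<open>a\<close> whose coefficients lie in the maximal ideal. The quotient
  of the strand by this subspace is the degree \<open>a\<close> part of the tensor product with \<open>k\<close>.\<close>

definition low :: "('p::order, 'k::field) frame \<Rightarrow> nat \<Rightarrow> 'p \<Rightarrow> (nat \<Rightarrow>\<^sub>0 'k) set" where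
  "low X i a = {v. keys v \<subseteq> {j. j < rk X i \<and> dg X i j < a}}"

definition cyc :: "'p set \<Rightarrow> ('p::order, 'k::field) frame \<Rightarrow> nat \<Rightarrow> 'p \<Rightarrow> (nat \<Rightarrow>\<^sub>0 'k) set" where
  "cyc D X i a = {v \<in> strand X i a.
     case i of 0 \<Rightarrow> a \<in> D \<longrightarrow> au X v = 0 | Suc l \<Rightarrow> df X l v = 0}"

text \<open>The resolved module is one-dimensional in the degrees of \<open>D\<close> and zero in all others, with
  multiplication by a monomial the identity whenever both degrees lie in \<open>D\<close>. Outside
  \<open>D\<close> all elements of position \<open>0\<close> count as cycles. The last condition says that a basis
  element whose degree is not in \<open>D\<close> is augmented to zero; it is imposed only below elements of
  \<open>D\<close>, a form that passes to cones.\<close>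

definition resolves :: "'p set \<Rightarrow> ('p::order, 'k::field) frame \<Rightarrow> bool" where
  "resolves D X \<longleftrightarrow> (\<forall>i. lin (df X i)) \<and> functional (au X) \<and>
     (\<forall>i a. df X i ` strand X (Suc i) a = cyc D X i a) \<and>
     (\<forall>a\<in>D. \<exists>v\<in>strand X 0 a. au X v = 1) \<and>
     (\<forall>a\<in>D. \<forall>j<rk X 0. dg X 0 j \<le> a \<and> dg X 0 j \<notin> D \<longrightarrow> au X (unit j) = 0)"

lemma strand_subspace: "vec.subspace (strand X i a)"
  unfolding strand_def by (rule subspace_keys)

lemma low_subspace: "vec.subspace (low X i a)"
  unfolding low_def by (rule subspace_keys)

lemma strand_mono: "a \<le> b \<Longrightarrow> strand X i a \<subseteq> strand X i b"
  unfolding strand_def using order_trans by auto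

lemma unit_strand: "j < rk X i \<Longrightarrow> dg X i j \<le> a \<Longrightarrow> unit j \<in> strand X i a"
  by (simp add: strand_def)

lemma strandD: "v \<in> strand X i a \<Longrightarrow> j \<in> keys v \<Longrightarrow> j < rk X i \<and> dg X i j \<le> a"
  by (auto simp: strand_def)

lemma resolvesD:
  assumes "resolves D X"
  shows "lin (df X i)" "functional (au X)"
    "v \<in> strand X (Suc i) a \<Longrightarrow> df X i v \<in> cyc D X i a"
    "u \<in> cyc D X i a \<Longrightarrow> \<exists>v\<in>strand X (Suc i) a. df X i v = u"
    "a \<in> D \<Longrightarrow> \<exists>v\<in>strand X 0 a. au X v = 1"
    "a \<in> D \<Longrightarrow> j < rk X 0 \<Longrightarrow> dg X 0 j \<le> a \<Longrightarrow> dg X 0 j \<notin> D \<Longrightarrow> au X (unit j) = 0"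
proof -
  have e: "df X i ` strand X (Suc i) a = cyc D X i a" for i a
    using assms by (simp add: resolves_def)
  show "v \<in> strand X (Suc i) a \<Longrightarrow> df X i v \<in> cyc D X i a" using e[of i a] by blast
  show "u \<in> cyc D X i a \<Longrightarrow> \<exists>v\<in>strand X (Suc i) a. df X i v = u" unfolding e[symmetric] by blast
qed (use assms in \<open>auto simp: resolves_def\<close>)

lemma cyc_strand: "v \<in> cyc D X i a \<Longrightarrow> v \<in> strand X i a"
  by (simp add: cyc_def)

lemma cyc_Suc: "v \<in> cyc D X (Suc i) a \<longleftrightarrow> v \<in> strand X (Suc i) a \<and> df X i v = 0"
  by (simp add: cyc_def)

lemma cyc_0: "v \<in> cyc D X 0 a \<longleftrightarrow> v \<in> strand X 0 a \<and> (a \<in> D \<longrightarrow> au X v = 0)"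
  by (simp add: cyc_def)

lemma ext_strand:
  assumes g: "\<And>j. j < rk X i \<Longrightarrow> g j \<in> strand Y k (dg X i j)" and v: "v \<in> strand X i a"
  shows "ext g v \<in> strand Y k a"
proof (rule lin_in_subspace[OF lin_ext strand_subspace])
  fix j assume "j \<in> keys v"
  then have "j < rk X i" "dg X i j \<le> a" using strandD[OF v] by auto
  then show "ext g (unit j) \<in> strand Y k a" using g strand_mono by auto blast
qed

text \<open>A basis element of degree strictly below \<open>a\<close> is sent to combinations of basis elements of at
  most its own degree.\<close>

lemma graded_low:
  assumes h: "lin h" "\<And>a v. v \<in> strand X i a \<Longrightarrow> h v \<in> strand Y k a" and v: "v \<in> low X i a"
  shows "h v \<in> low Y k a"
proof (rule lin_in_subspace[OF h(1) low_subspace])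
  fix j assume "j \<in> keys v"
  then have j: "j < rk X i" "dg X i j < a" using v by (auto simp: low_def)
  then have "h (unit j) \<in> strand Y k (dg X i j)" by (intro h(2) unit_strand) auto
  then show "h (unit j) \<in> low Y k a" using j(2) by (auto simp: strand_def low_def intro: le_less_trans)
qed

definition chain_lift where
  "chain_lift D Y X \<phi> \<longleftrightarrow> (\<forall>i. lin (\<phi> i) \<and> (\<forall>a. \<forall>v\<in>strand Y i a. \<phi> i v \<in> strand X i a)) \<and>
     (\<forall>i a. \<forall>v\<in>strand Y (Suc i) a. df X i (\<phi> (Suc i) v) = \<phi> i (df Y i v)) \<and>
     (\<forall>a\<in>D. \<forall>v\<in>strand Y 0 a. au X (\<phi> 0 v) = au Y v)"

text \<open>The degrees \<open>D'\<close> form an upper part of \<open>D\<close>, so the module with support \<open>D'\<close> embeds in the one with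
  support \<open>D\<close>. The embedding lifts to the resolutions, position by position, because the image of
  the boundary of a basis element is a cycle and hence a boundary.\<close>

lemma chain_lift_exists:
  assumes Y: "resolves D' Y" and X: "resolves D X" and sub: "D' \<subseteq> D"
    and up: "\<forall>b\<in>D'. \<forall>a\<in>D. b \<le> a \<longrightarrow> a \<in> D'"
  shows "\<exists>\<phi>. chain_lift D' Y X \<phi> \<and> (\<forall>i a. \<forall>v\<in>cyc D' Y i a. \<phi> i v \<in> cyc D X i a)"
proof -
  define P where "P n \<phi> \<longleftrightarrow> lin \<phi> \<and> (\<forall>a. \<forall>v\<in>strand Y n a. \<phi> v \<in> strand X n a) \<and>
      (\<forall>a. \<forall>v\<in>cyc D' Y n a. \<phi> v \<in> cyc D X n a) \<and>
      (n = 0 \<longrightarrow> (\<forall>a\<in>D'. \<forall>v\<in>strand Y 0 a. au X (\<phi> v) = au Y v))" for n \<phi>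
  define Q where "Q n \<phi> \<phi>' \<longleftrightarrow> (\<forall>a. \<forall>v\<in>strand Y (Suc n) a. df X n (\<phi>' v) = \<phi> (df Y n v))" for n \<phi> \<phi>'
  have "\<exists>\<phi>. P 0 \<phi>"
  proof -
    have "\<exists>w. w \<in> strand X 0 (dg Y 0 j) \<and>
        (if dg Y 0 j \<in> D' then au X w = au Y (unit j) else w = 0)" for j
    proof (cases "dg Y 0 j \<in> D'")
      case True
      then obtain v where v: "v \<in> strand X 0 (dg Y 0 j)" "au X v = 1"
        using resolvesD(5)[OF X] sub by blast
      have "vec_scale (au Y (unit j)) v \<in> strand X 0 (dg Y 0 j)"
        using v(1) by (rule vec.subspace_scale[OF strand_subspace])
      moreover have "au X (vec_scale (au Y (unit j)) v) = au Y (unit j)"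
        using v(2) functional_scale[OF resolvesD(2)[OF X]] by simp
      ultimately show ?thesis using True by auto
    next
      case False
      then show ?thesis using vec.subspace_0[OF strand_subspace] by auto
    qed
    then obtain g where g: "\<And>j. g j \<in> strand X 0 (dg Y 0 j)"
      "\<And>j. if dg Y 0 j \<in> D' then au X (g j) = au Y (unit j) else g j = 0" by metis
    have str: "ext g v \<in> strand X 0 a" if "v \<in> strand Y 0 a" for a v
      using ext_strand[OF g(1) that] .
    have comp: "functional (\<lambda>v. au X (ext g v))"
      using resolvesD(2)[OF X] lin_ext[of g] by (auto simp: functional_def lin_def)
    have aug: "au X (ext g v) = au Y v" if a: "a \<in> D'" and v: "v \<in> strand Y 0 a" for a v
    proof (rule functional_eq[OF comp resolvesD(2)[OF Y]])
      fix j assume "j \<in> keys v"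
      then have j: "j < rk Y 0" "dg Y 0 j \<le> a" using strandD[OF v] by auto
      show "au X (ext g (unit j)) = au Y (unit j)"
        using g(2)[of j] resolvesD(6)[OF Y a j] functional_zero[OF resolvesD(2)[OF X]]
        by (cases "dg Y 0 j \<in> D'") auto
    qed
    have "ext g v \<in> cyc D X 0 a" if v: "v \<in> cyc D' Y 0 a" for a v
      unfolding cyc_0
    proof (intro conjI impI)
      show "ext g v \<in> strand X 0 a" using str v by (auto simp: cyc_0)
      assume a: "a \<in> D"
      show "au X (ext g v) = 0"
      proof (cases "a \<in> D'")
        case True then show ?thesis using aug v by (simp add: cyc_0)
      next
        case False
        have "g j = 0" if "j \<in> keys v" for j
        proof -
          have "dg Y 0 j \<notin> D'" using strandD[OF cyc_strand[OF v] that] up a False by blast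
          then show ?thesis using g(2)[of j] by simp
        qed
        then have "ext g v = 0" by (simp add: ext_def)
        then show ?thesis using functional_zero[OF resolvesD(2)[OF X]] by simp
      qed
    qed
    then have "P 0 (ext g)" unfolding P_def using str aug lin_ext by blast
    then show ?thesis by blast
  qed
  moreover have "\<exists>\<phi>'. P (Suc n) \<phi>' \<and> Q n \<phi> \<phi>'" if P: "P n \<phi>" for n \<phi>
  proof -
    have "\<exists>w. j < rk Y (Suc n) \<longrightarrow> w \<in> strand X (Suc n) (dg Y (Suc n) j) \<and> df X n w = \<phi> (df Y n (unit j))" for j
    proof (cases "j < rk Y (Suc n)")
      case True
      then have "df Y n (unit j) \<in> cyc D' Y n (dg Y (Suc n) j)"
        by (intro resolvesD(3)[OF Y] unit_strand) auto
      then have "\<phi> (df Y n (unit j)) \<in> cyc D X n (dg Y (Suc n) j)" using P unfolding P_def by blast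
      then show ?thesis using resolvesD(4)[OF X] by blast
    qed simp
    then obtain g where g: "\<And>j. j < rk Y (Suc n) \<Longrightarrow> g j \<in> strand X (Suc n) (dg Y (Suc n) j)"
      "\<And>j. j < rk Y (Suc n) \<Longrightarrow> df X n (g j) = \<phi> (df Y n (unit j))" by metis
    have str: "ext g v \<in> strand X (Suc n) a" if "v \<in> strand Y (Suc n) a" for a v
      using ext_strand[OF g(1) that] .
    have phi: "lin \<phi>" using P by (simp add: P_def)
    have l: "lin (\<lambda>v. df X n (ext g v))" "lin (\<lambda>v. \<phi> (df Y n v))"
      using resolvesD(1)[OF X, of n] resolvesD(1)[OF Y, of n] phi lin_ext[of g] unfolding lin_def by simp_all
    have com: "df X n (ext g v) = \<phi> (df Y n v)" if v: "v \<in> strand Y (Suc n) a" for a v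
      by (rule lin_eq[OF l]) (use g(2) strandD[OF v] in simp)
    have "ext g v \<in> cyc D X (Suc n) a" if "v \<in> cyc D' Y (Suc n) a" for a v
      using that str com lin_zero[OF phi] by (auto simp: cyc_Suc)
    then have "P (Suc n) (ext g)" unfolding P_def using str lin_ext by blast
    moreover have "Q n \<phi> (ext g)" unfolding Q_def using com by blast
    ultimately show ?thesis by blast
  qed
  ultimately obtain \<phi> where "\<And>n. P n (\<phi> n)" "\<And>n. Q n (\<phi> n) (\<phi> (Suc n))"
    using dependent_nat_choice[of P Q] by metis
  then show ?thesis unfolding chain_lift_def P_def Q_def by blast
qed

text \<open>The homotopy is built position by position so that \<open>d s = \<theta>\<close> on cycles. This makes \<open>\<theta> - s d\<close> of
  a basis element in the next position a cycle, hence a boundary, and a preimage is the value of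
  the next map.\<close>

lemma homotopy_exists:
  assumes X: "resolves D X"
    and th: "\<And>i. lin (\<theta> i)" "\<And>i a v. v \<in> strand X i a \<Longrightarrow> \<theta> i v \<in> strand X i a"
      "\<And>i a v. v \<in> strand X (Suc i) a \<Longrightarrow> df X i (\<theta> (Suc i) v) = \<theta> i (df X i v)"
      "\<And>a v. a \<in> D \<Longrightarrow> v \<in> strand X 0 a \<Longrightarrow> au X (\<theta> 0 v) = 0"
  shows "\<exists>s. (\<forall>i. lin (s i)) \<and> (\<forall>i a. \<forall>v\<in>strand X i a. s i v \<in> strand X (Suc i) a) \<and>
     (\<forall>a. \<forall>v\<in>strand X 0 a. df X 0 (s 0 v) = \<theta> 0 v) \<and>
     (\<forall>i a. \<forall>v\<in>strand X (Suc i) a. df X (Suc i) (s (Suc i) v) + s i (df X i v) = \<theta> (Suc i) v)"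
proof -
  define P where "P n s \<longleftrightarrow> lin s \<and> (\<forall>a. \<forall>v\<in>strand X n a. s v \<in> strand X (Suc n) a) \<and>
      (\<forall>a. \<forall>v\<in>cyc D X n a. df X n (s v) = \<theta> n v) \<and>
      (n = 0 \<longrightarrow> (\<forall>a. \<forall>v\<in>strand X 0 a. df X 0 (s v) = \<theta> 0 v))" for n s
  define Q where "Q n s s' \<longleftrightarrow> (\<forall>a. \<forall>v\<in>strand X (Suc n) a. df X (Suc n) (s' v) + s (df X n v) = \<theta> (Suc n) v)"
    for n s s'
  note lX = resolvesD(1)[OF X]
  have "\<exists>s. P 0 s"
  proof -
    have "\<exists>w. j < rk X 0 \<longrightarrow> w \<in> strand X (Suc 0) (dg X 0 j) \<and> df X 0 w = \<theta> 0 (unit j)" for j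
    proof (cases "j < rk X 0")
      case True
      then have "unit j \<in> strand X 0 (dg X 0 j)" by (simp add: unit_strand)
      then have "\<theta> 0 (unit j) \<in> cyc D X 0 (dg X 0 j)" using th(2,4) by (simp add: cyc_0)
      then show ?thesis using resolvesD(4)[OF X] by blast
    qed simp
    then obtain g where g: "\<And>j. j < rk X 0 \<Longrightarrow> g j \<in> strand X (Suc 0) (dg X 0 j)"
      "\<And>j. j < rk X 0 \<Longrightarrow> df X 0 (g j) = \<theta> 0 (unit j)" by metis
    have l: "lin (\<lambda>v. df X 0 (ext g v))" using lX[of 0] lin_ext[of g] by (simp add: lin_def)
    have "df X 0 (ext g v) = \<theta> 0 v" if v: "v \<in> strand X 0 a" for a v
      by (rule lin_eq[OF l th(1)]) (use g(2) strandD[OF v] in simp)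
    moreover have "ext g v \<in> strand X (Suc 0) a" if "v \<in> strand X 0 a" for a v
      using ext_strand[OF g(1) that] .
    ultimately have "P 0 (ext g)" unfolding P_def using lin_ext cyc_strand by blast
    then show ?thesis by blast
  qed
  moreover have "\<exists>s'. P (Suc n) s' \<and> Q n s s'" if P: "P n s" for n s
  proof -
    have s: "lin s" "\<And>a v. v \<in> strand X n a \<Longrightarrow> s v \<in> strand X (Suc n) a"
      "\<And>a v. v \<in> cyc D X n a \<Longrightarrow> df X n (s v) = \<theta> n v" using P unfolding P_def by auto
    have "\<exists>w. j < rk X (Suc n) \<longrightarrow> w \<in> strand X (Suc (Suc n)) (dg X (Suc n) j) \<and>
        df X (Suc n) w = \<theta> (Suc n) (unit j) - s (df X n (unit j))" for j
    proof (cases "j < rk X (Suc n)")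
      case True
      let ?a = "dg X (Suc n) j"
      have u: "unit j \<in> strand X (Suc n) ?a" using True by (simp add: unit_strand)
      then have c: "df X n (unit j) \<in> cyc D X n ?a" by (rule resolvesD(3)[OF X])
      have "\<theta> (Suc n) (unit j) - s (df X n (unit j)) \<in> strand X (Suc n) ?a"
        by (intro vec.subspace_diff[OF strand_subspace] th(2) u s(2) cyc_strand[OF c])
      moreover have "df X n (\<theta> (Suc n) (unit j) - s (df X n (unit j))) = 0"
        using th(3)[OF u] s(3)[OF c] by (simp add: lin_diff[OF lX])
      ultimately show ?thesis
        using resolvesD(4)[OF X, of "\<theta> (Suc n) (unit j) - s (df X n (unit j))" "Suc n" ?a] by (auto simp: cyc_Suc)
    qed simp
    then obtain g where g: "\<And>j. j < rk X (Suc n) \<Longrightarrow> g j \<in> strand X (Suc (Suc n)) (dg X (Suc n) j)"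
      "\<And>j. j < rk X (Suc n) \<Longrightarrow> df X (Suc n) (g j) = \<theta> (Suc n) (unit j) - s (df X n (unit j))" by metis
    have l: "lin (\<lambda>v. df X (Suc n) (ext g v))" "lin (\<lambda>v. \<theta> (Suc n) v - s (df X n v))"
      using lX[of "Suc n"] lX[of n] lin_ext[of g] s(1) th(1)[of "Suc n"]
      by (simp_all add: lin_def vec.scale_right_diff_distrib)
    have eq: "df X (Suc n) (ext g v) = \<theta> (Suc n) v - s (df X n v)" if v: "v \<in> strand X (Suc n) a" for a v
      by (rule lin_eq[OF l]) (use g(2) strandD[OF v] in simp)
    have "ext g v \<in> strand X (Suc (Suc n)) a" if "v \<in> strand X (Suc n) a" for a v
      using ext_strand[OF g(1) that] .
    moreover have "df X (Suc n) (ext g v) = \<theta> (Suc n) v" if "v \<in> cyc D X (Suc n) a" for a v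
      using eq[of v a] that lin_zero[OF s(1)] by (simp add: cyc_Suc)
    ultimately have "P (Suc n) (ext g)" unfolding P_def using lin_ext by blast
    moreover have "Q n s (ext g)" unfolding Q_def using eq by auto
    ultimately show ?thesis by blast
  qed
  ultimately obtain s where "\<And>n. P n (s n)" "\<And>n. Q n (s n) (s (Suc n))"
    using dependent_nat_choice[of P Q] by metis
  then show ?thesis unfolding P_def Q_def by blast
qed

text \<open>If \<open>Y\<close> has no basis element of degree \<open>a\<close> in position \<open>i\<close>, then every class of degree \<open>a\<close> in the
  \<open>i\<close>-th homology of the tensor product of \<open>X\<close> with \<open>k\<close> is zero. Lifting the identity to \<open>X \<rightarrow> Y\<close> and
  \<open>Y \<rightarrow> X\<close> gives an endomorphism of \<open>X\<close> that is homotopic to the identity and factors, in position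
  \<open>i\<close> and degree \<open>a\<close>, through elements that vanish after tensoring.\<close>

lemma comparison:
  fixes X Y :: "('p::order, 'k::field) frame"
  assumes X: "resolves D X" and Y: "resolves D Y"
    and no: "\<And>j. j < rk Y i \<Longrightarrow> dg Y i j \<noteq> a"
    and v: "v \<in> strand X i a" "\<And>l. i = Suc l \<Longrightarrow> df X l v \<in> low X l a"
  shows "\<exists>w\<in>strand X (Suc i) a. v - df X i w \<in> low X i a"
proof -
  obtain \<alpha> where \<alpha>: "chain_lift D X Y \<alpha>" using chain_lift_exists[OF X Y] by blast
  obtain \<beta> where \<beta>: "chain_lift D Y X \<beta>" using chain_lift_exists[OF Y X] by blast
  note al = \<alpha>[unfolded chain_lift_def] and be = \<beta>[unfolded chain_lift_def]
  have lal: "lin (\<alpha> i)" and lbe: "lin (\<beta> i)" for i using al be by blast+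
  have sal: "\<alpha> i v \<in> strand Y i a" if "v \<in> strand X i a" for i a v using al that by blast
  have sbe: "\<beta> i v \<in> strand X i a" if "v \<in> strand Y i a" for i a v using be that by blast
  have cal: "df Y i (\<alpha> (Suc i) v) = \<alpha> i (df X i v)" if "v \<in> strand X (Suc i) a" for i a v using al that by blast
  have cbe: "df X i (\<beta> (Suc i) v) = \<beta> i (df Y i v)" if "v \<in> strand Y (Suc i) a" for i a v using be that by blast
  have aal: "au Y (\<alpha> 0 v) = au X v" if "a \<in> D" "v \<in> strand X 0 a" for a v using al that by blast
  have abe: "au X (\<beta> 0 v) = au Y v" if "a \<in> D" "v \<in> strand Y 0 a" for a v using be that by blast
  define \<theta> where "\<theta> i v = v - \<beta> i (\<alpha> i v)" for i v
  have th1: "lin (\<theta> i)" for i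
    using lal[of i] lbe[of i] by (simp add: \<theta>_def lin_def vec.scale_right_diff_distrib)
  have th2: "\<theta> i v \<in> strand X i a" if "v \<in> strand X i a" for i a v
    unfolding \<theta>_def using that sal sbe by (intro vec.subspace_diff[OF strand_subspace]) auto
  have th3: "df X i (\<theta> (Suc i) v) = \<theta> i (df X i v)" if "v \<in> strand X (Suc i) a" for i a v
    unfolding \<theta>_def using cal[OF that] cbe[OF sal[OF that]] by (simp add: lin_diff[OF resolvesD(1)[OF X]])
  have th4: "au X (\<theta> 0 v) = 0" if "a \<in> D" "v \<in> strand X 0 a" for a v
    unfolding \<theta>_def using aal[OF that] abe[OF that(1) sal[OF that(2)]]
    by (simp add: functional_diff[OF resolvesD(2)[OF X]])
  have "\<exists>s. (\<forall>i. lin (s i)) \<and> (\<forall>i a. \<forall>v\<in>strand X i a. s i v \<in> strand X (Suc i) a) \<and>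
     (\<forall>a. \<forall>v\<in>strand X 0 a. df X 0 (s 0 v) = \<theta> 0 v) \<and>
     (\<forall>i a. \<forall>v\<in>strand X (Suc i) a. df X (Suc i) (s (Suc i) v) + s i (df X i v) = \<theta> (Suc i) v)"
    by (rule homotopy_exists[OF X th1]) (erule th2, erule th3, erule (1) th4)
  then obtain s where s: "\<forall>i. lin (s i)" "\<forall>i a. \<forall>v\<in>strand X i a. s i v \<in> strand X (Suc i) a"
     "\<forall>a. \<forall>v\<in>strand X 0 a. df X 0 (s 0 v) = \<theta> 0 v"
     "\<forall>i a. \<forall>v\<in>strand X (Suc i) a. df X (Suc i) (s (Suc i) v) + s i (df X i v) = \<theta> (Suc i) v"
    by blast
  have "\<alpha> i v \<in> low Y i a"
    using sal[OF v(1)] no unfolding strand_def low_def by (auto simp: order.strict_iff_order)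
  then have low1: "\<beta> i (\<alpha> i v) \<in> low X i a"
    using graded_low[of "\<beta> i" Y i X i] lbe sbe by blast
  have w: "s i v \<in> strand X (Suc i) a" using s(2) v(1) by blast
  have "v - df X i (s i v) \<in> low X i a"
  proof (cases i)
    case 0
    then have "v - df X i (s i v) = \<beta> i (\<alpha> i v)" using s(3) v(1) unfolding \<theta>_def by simp
    then show ?thesis using low1 by simp
  next
    case (Suc l)
    have "df X i (s i v) + s l (df X l v) = v - \<beta> i (\<alpha> i v)"
      using s(4) v(1) Suc unfolding \<theta>_def by blast
    then have eq: "v - df X i (s i v) = \<beta> i (\<alpha> i v) + s l (df X l v)"
      by (simp add: algebra_simps)
    have "s l (df X l v) \<in> low X i a"
      unfolding Suc by (rule graded_low[OF _ _ v(2)[OF Suc]]) (use s(1,2) in auto)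
    then show ?thesis unfolding eq using low1 by (intro vec.subspace_add[OF low_subspace])
  qed
  then show ?thesis using w by blast
qed

section \<open>Mapping cones of frames\<close>

text \<open>A vector with \<open>r + r'\<close> coordinates is split into its first \<open>r\<close> and its other coordinates;
  \<open>up\<close> embeds the latter.\<close>

lift_definition lo :: "nat \<Rightarrow> (nat \<Rightarrow>\<^sub>0 'k::field) \<Rightarrow> (nat \<Rightarrow>\<^sub>0 'k)" is
  "\<lambda>r v j. if j < r then v j else 0"
  by (rule finite_subset) auto

lift_definition hi :: "nat \<Rightarrow> (nat \<Rightarrow>\<^sub>0 'k::field) \<Rightarrow> (nat \<Rightarrow>\<^sub>0 'k)" is
  "\<lambda>r v j. v (r + j)"
proof -
  fix r and v :: "nat \<Rightarrow> 'k" assume "finite {x. v x \<noteq> 0}"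
  then have "finite ((+) r -` {x. v x \<noteq> 0})" by (rule finite_vimageI) simp
  then show "finite {x. v (r + x) \<noteq> 0}" by (simp add: vimage_def)
qed

lift_definition up :: "nat \<Rightarrow> (nat \<Rightarrow>\<^sub>0 'k::field) \<Rightarrow> (nat \<Rightarrow>\<^sub>0 'k)" is
  "\<lambda>r v j. if j < r then 0 else v (j - r)"
proof -
  fix r and v :: "nat \<Rightarrow> 'k" assume "finite {x. v x \<noteq> 0}"
  then have "finite ((+) r ` {x. v x \<noteq> 0})" by simp
  moreover have "{x. (if x < r then 0 else v (x - r)) \<noteq> 0} \<subseteq> (+) r ` {x. v x \<noteq> 0}"
    by (auto simp: image_iff split: if_splits intro!: exI[of _ "_ - r"])
  ultimately show "finite {x. (if x < r then 0 else v (x - r)) \<noteq> 0}" by (rule finite_subset[rotated])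
qed

lemmas lookup_parts = lo.rep_eq hi.rep_eq up.rep_eq

lemma lin_parts: "lin (lo r)" "lin (hi r)" "lin (up r)"
  by (auto simp: lin_def lookup_parts lookup_add lookup_vec_scale intro!: poly_mapping_eqI)

lemma split_parts: "v = lo r v + up r (hi r v)"
  by (intro poly_mapping_eqI) (simp add: lookup_parts lookup_add)

lemma hi_up: "hi r (up r w) = w" and lo_up: "lo r (up r w) = 0"
  by (auto simp: lookup_parts intro!: poly_mapping_eqI)

lemma keys_below:
  assumes "keys v \<subseteq> {..<r}" shows "lo r v = v" "hi r v = 0"
proof -
  have "lookup v j = 0" if "\<not> j < r" for j
    using assms that by (auto simp: in_keys_iff subset_iff)
  then show "lo r v = v" "hi r v = 0" by (auto simp: lookup_parts intro!: poly_mapping_eqI)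
qed

lemma lin_compose: "lin f \<Longrightarrow> lin g \<Longrightarrow> lin (\<lambda>v. f (g v))"
  by (simp add: lin_def)

lemma lin_plus: "lin f \<Longrightarrow> lin g \<Longrightarrow> lin (\<lambda>v. f v + g v)"
  unfolding lin_def by (simp add: vec.scale_right_distrib algebra_simps)

lemma lin_minus: "lin f \<Longrightarrow> lin g \<Longrightarrow> lin (\<lambda>v. f v - g v)"
  unfolding lin_def by (simp add: vec.scale_right_diff_distrib algebra_simps)

text \<open>The mapping cone of \<open>\<phi> : Y \<rightarrow> X\<close>; in position \<open>i + 1\<close> the basis of \<open>X\<close> comes first and is followed by
  the basis of \<open>Y\<close> from position \<open>i\<close>.\<close>

definition cone :: "('p::order, 'k::field) frame \<Rightarrow> ('p, 'k) frame \<Rightarrow> (nat \<Rightarrow> (nat \<Rightarrow>\<^sub>0 'k) \<Rightarrow> (nat \<Rightarrow>\<^sub>0 'k)) \<Rightarrow> ('p, 'k) frame" where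
  "cone X Y \<phi> = \<lparr>
     rk = (\<lambda>i. case i of 0 \<Rightarrow> rk X 0 | Suc l \<Rightarrow> rk X (Suc l) + rk Y l),
     dg = (\<lambda>i j. case i of 0 \<Rightarrow> dg X 0 j
        | Suc l \<Rightarrow> if j < rk X (Suc l) then dg X (Suc l) j else dg Y l (j - rk X (Suc l))),
     df = (\<lambda>i v. df X i (lo (rk X (Suc i)) v) + \<phi> i (hi (rk X (Suc i)) v) -
        (case i of 0 \<Rightarrow> 0 | Suc l \<Rightarrow> up (rk X (Suc l)) (df Y l (hi (rk X (Suc i)) v)))),
     au = au X\<rparr>"

lemma strand_cone_0: "strand (cone X Y \<phi>) 0 a = strand X 0 a"
  by (simp add: strand_def cone_def)

lemma strand_cone_Suc:
  "v \<in> strand (cone X Y \<phi>) (Suc l) a \<longleftrightarrow>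
     lo (rk X (Suc l)) v \<in> strand X (Suc l) a \<and> hi (rk X (Suc l)) v \<in> strand Y l a"
  (is "_ \<longleftrightarrow> ?lo \<and> ?hi")
proof -
  let ?r = "rk X (Suc l)"
  have "v \<in> strand (cone X Y \<phi>) (Suc l) a \<longleftrightarrow>
     (\<forall>j. lookup v j \<noteq> 0 \<longrightarrow> j < ?r + rk Y l \<and>
        (if j < ?r then dg X (Suc l) j else dg Y l (j - ?r)) \<le> a)" (is "_ \<longleftrightarrow> (\<forall>j. ?P j)")
    by (auto simp: strand_def cone_def subset_iff in_keys_iff)
  also have "(\<forall>j. ?P j) \<longleftrightarrow> (\<forall>j<?r. ?P j) \<and> (\<forall>j. ?P (?r + j))"
    by (metis le_Suc_ex not_le)
  also have "(\<forall>j<?r. ?P j) \<longleftrightarrow> ?lo"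
    by (auto simp: strand_def subset_iff in_keys_iff lookup_parts)
  also have "(\<forall>j. ?P (?r + j)) \<longleftrightarrow> ?hi"
    by (auto simp: strand_def subset_iff in_keys_iff lookup_parts)
  finally show ?thesis .
qed

lemma strand_keys: "v \<in> strand X i a \<Longrightarrow> keys v \<subseteq> {..<rk X i}"
  by (auto simp: strand_def)

lemma df_cone_parts:
  assumes X: "resolves D X" and \<phi>: "lin (\<phi> i)"
    and u: "u \<in> strand X (Suc i) a"
  shows "df (cone X Y \<phi>) i (u + up (rk X (Suc i)) w) = df X i u + \<phi> i w -
     (case i of 0 \<Rightarrow> 0 | Suc l \<Rightarrow> up (rk X (Suc l)) (df Y l w))"
  using keys_below[OF strand_keys[OF u]]
  by (cases i) (simp_all add: cone_def lin_add[OF lin_parts(1)] lin_add[OF lin_parts(2)] hi_up lo_up)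

text \<open>The embedding of the module with support \<open>D'\<close> into the one with support \<open>D\<close> has a cokernel with
  support \<open>D - D'\<close>, which the cone of a lift resolves. The embedding being injective, a cycle
  \<open>u + w\<close> of the cone has a cycle of \<open>Y\<close> as its second component, also in the lowest position.\<close>

lemma resolves_cone:
  assumes X: "resolves D X" and Y: "resolves D' Y" and sub: "D' \<subseteq> D"
    and upc: "\<forall>b\<in>D'. \<forall>a\<in>D. b \<le> a \<longrightarrow> a \<in> D'"
    and \<phi>: "chain_lift D' Y X \<phi>" "\<And>i a v. v \<in> cyc D' Y i a \<Longrightarrow> \<phi> i v \<in> cyc D X i a"
  shows "resolves (D - D') (cone X Y \<phi>)"
proof -
  let ?C = "cone X Y \<phi>"
  note lX = resolvesD(1)[OF X] and lY = resolvesD(1)[OF Y] and fX = resolvesD(2)[OF X]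
  have l\<phi>: "lin (\<phi> i)" for i using \<phi>(1) unfolding chain_lift_def by blast
  have s\<phi>: "\<phi> i v \<in> strand X i a" if "v \<in> strand Y i a" for i a v
    using \<phi>(1) that unfolding chain_lift_def by blast
  have c\<phi>: "df X i (\<phi> (Suc i) v) = \<phi> i (df Y i v)" if "v \<in> strand Y (Suc i) a" for i a v
    using \<phi>(1) that unfolding chain_lift_def by blast
  have a\<phi>: "au X (\<phi> 0 v) = au Y v" if "a \<in> D'" "v \<in> strand Y 0 a" for a v
    using \<phi>(1) that unfolding chain_lift_def by blast
  have auC: "au ?C = au X" by (simp add: cone_def)
  have lC: "lin (df ?C i)" for i
  proof -
    have 1: "lin (\<lambda>v. df X i (lo r v) + \<phi> i (hi r v))" for r
      by (intro lin_plus lin_compose[OF lX] lin_compose[OF l\<phi>] lin_parts)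
    have 2: "lin (\<lambda>v. up r' (df Y l (hi r v)))" for r r' l
      by (intro lin_compose[OF lin_parts(3)] lin_compose[OF lY] lin_parts)
    show ?thesis
    proof (cases i)
      case 0 then show ?thesis using 1 by (simp add: cone_def)
    next
      case (Suc l)
      then show ?thesis using lin_minus[OF 1[of "rk X (Suc i)"] 2[of "rk X (Suc l)" l "rk X (Suc i)"]]
        by (simp add: cone_def)
    qed
  qed
  have parts: "\<exists>u w. v = u + up (rk X (Suc i)) w \<and> u \<in> strand X (Suc i) a \<and> w \<in> strand Y i a"
    if "v \<in> strand ?C (Suc i) a" for v i a
    using that split_parts[of v "rk X (Suc i)"] unfolding strand_cone_Suc by blast
  have join: "u + up (rk X (Suc i)) w \<in> strand ?C (Suc i) a"
    if "u \<in> strand X (Suc i) a" "w \<in> strand Y i a" for u w i a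
    using that keys_below[OF strand_keys[OF that(1)]] unfolding strand_cone_Suc
    by (simp add: lin_add[OF lin_parts(1)] lin_add[OF lin_parts(2)] hi_up lo_up)
  note dC = df_cone_parts[OF X l\<phi>]
  have diff_cyc: "u - v \<in> cyc D X i a" if "u \<in> cyc D X i a" "v \<in> cyc D X i a" for u v i a
    using that by (cases i) (auto simp: cyc_Suc cyc_0 lin_diff[OF lX] functional_diff[OF fX]
        intro: vec.subspace_diff[OF strand_subspace])
  have inj: "w \<in> cyc D' Y 0 a" if "w \<in> strand Y 0 a" "\<phi> 0 w \<in> cyc D X 0 a" for w a
    using that a\<phi> sub by (auto simp: cyc_0)
  have exact: "df ?C i ` strand ?C (Suc i) a = cyc (D - D') ?C i a" for i a
  proof (cases i)
    case 0
    show ?thesis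
    proof (intro subset_antisym subsetI)
      fix z assume "z \<in> df ?C i ` strand ?C (Suc i) a"
      then obtain u w where uw: "u \<in> strand X (Suc 0) a" "w \<in> strand Y 0 a"
        "z = df ?C 0 (u + up (rk X (Suc 0)) w)" using parts 0 by blast
      then have z: "z = df X 0 u + \<phi> 0 w" using dC[OF uw(1)] by simp
      have c: "df X 0 u \<in> cyc D X 0 a" using resolvesD(3)[OF X uw(1)] .
      have "z \<in> strand X 0 a"
        unfolding z using cyc_strand[OF c] s\<phi>[OF uw(2)] by (intro vec.subspace_add[OF strand_subspace])
      moreover have "au X z = 0" if a: "a \<in> D - D'"
      proof -
        have "w \<in> cyc D' Y 0 a" using a uw(2) by (simp add: cyc_0)
        then have "\<phi> 0 w \<in> cyc D X 0 a" by (rule \<phi>(2))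
        then show ?thesis using c a unfolding z by (simp add: cyc_0 functional_add[OF fX])
      qed
      ultimately show "z \<in> cyc (D - D') ?C i a" by (simp add: 0 cyc_0 strand_cone_0 auC)
    next
      fix z assume "z \<in> cyc (D - D') ?C i a"
      then have z: "z \<in> strand X 0 a" "a \<in> D - D' \<Longrightarrow> au X z = 0"
        by (simp_all add: 0 cyc_0 strand_cone_0 auC)
      \<comment> \<open>in degrees of \<open>D'\<close> the augmentation of \<open>z\<close> is cancelled by an element of \<open>Y\<close>\<close>
      have "\<exists>w\<in>strand Y 0 a. z - \<phi> 0 w \<in> cyc D X 0 a"
      proof (cases "a \<in> D'")
        case True
        then obtain y where y: "y \<in> strand Y 0 a" "au Y y = 1" using resolvesD(5)[OF Y] by blast
        let ?w = "vec_scale (au X z) y"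
        have w: "?w \<in> strand Y 0 a" using y(1) by (rule vec.subspace_scale[OF strand_subspace])
        moreover have "z - \<phi> 0 ?w \<in> cyc D X 0 a"
          using z(1) s\<phi>[OF w] a\<phi>[OF True w] y(2) functional_scale[OF resolvesD(2)[OF Y]]
          by (auto simp: cyc_0 functional_diff[OF fX] intro: vec.subspace_diff[OF strand_subspace])
        ultimately show ?thesis by blast
      next
        case False
        then show ?thesis
          using z vec.subspace_0[OF strand_subspace] by (intro bexI[of _ 0]) (auto simp: cyc_0 lin_zero[OF l\<phi>])
      qed
      then obtain w x where wx: "w \<in> strand Y 0 a" "x \<in> strand X (Suc 0) a" "df X 0 x = z - \<phi> 0 w"
        using resolvesD(4)[OF X] by blast
      then show "z \<in> df ?C i ` strand ?C (Suc i) a"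
        using join[OF wx(2,1)] wx(3) by (intro image_eqI[of _ _ "x + up (rk X (Suc 0)) w"]) (simp_all add: 0 dC[OF wx(2)])
    qed
  next
    case (Suc l)
    let ?r = "rk X (Suc l)"
    show ?thesis
    proof (intro subset_antisym subsetI)
      fix z assume "z \<in> df ?C i ` strand ?C (Suc i) a"
      then obtain u w where uw: "u \<in> strand X (Suc (Suc l)) a" "w \<in> strand Y (Suc l) a"
        "z = df ?C (Suc l) (u + up (rk X (Suc (Suc l))) w)" using parts Suc by blast
      then have z: "z = (df X (Suc l) u + \<phi> (Suc l) w) + up ?r (- df Y l w)"
        using dC[OF uw(1)] by (simp add: lin_uminus[OF lin_parts(3)])
      have cu: "df X (Suc l) u \<in> cyc D X (Suc l) a" and cw: "df Y l w \<in> cyc D' Y l a"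
        using resolvesD(3)[OF X uw(1)] resolvesD(3)[OF Y uw(2)] by auto
      have s1: "df X (Suc l) u + \<phi> (Suc l) w \<in> strand X (Suc l) a"
        using cyc_strand[OF cu] s\<phi>[OF uw(2)] by (intro vec.subspace_add[OF strand_subspace])
      have s2: "- df Y l w \<in> strand Y l a"
        using cyc_strand[OF cw] by (intro vec.subspace_neg[OF strand_subspace])
      have "df X l (df X (Suc l) u + \<phi> (Suc l) w) + \<phi> l (- df Y l w) = 0"
        using cu c\<phi>[OF uw(2)] by (simp add: lin_add[OF lX] lin_uminus[OF l\<phi>] cyc_Suc)
      moreover have "(case l of 0 \<Rightarrow> 0 | Suc k \<Rightarrow> up (rk X (Suc k)) (df Y k (- df Y l w))) = 0"
        using cw by (cases l) (simp_all add: cyc_Suc lin_uminus[OF lY] lin_zero[OF lin_parts(3)])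
      ultimately have "df ?C l z = 0"
        unfolding z dC[OF s1] by simp
      then show "z \<in> cyc (D - D') ?C i a"
        unfolding Suc cyc_Suc using join[OF s1 s2] z by simp
    next
      fix z assume "z \<in> cyc (D - D') ?C i a"
      then have z: "z \<in> strand ?C (Suc l) a" "df ?C l z = 0" by (simp_all add: Suc cyc_Suc)
      then obtain u w where uw: "z = u + up ?r w" "u \<in> strand X (Suc l) a" "w \<in> strand Y l a"
        using parts by blast
      have d: "df X l u + \<phi> l w - (case l of 0 \<Rightarrow> 0 | Suc k \<Rightarrow> up (rk X (Suc k)) (df Y k w)) = 0"
        using z(2) unfolding uw(1) dC[OF uw(2)] .
      have cw: "df X l u + \<phi> l w = 0 \<and> w \<in> cyc D' Y l a"
      proof (cases l)
        case 0
        then have e: "df X 0 u + \<phi> 0 w = 0" using d by simp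
        then have "\<phi> 0 w = - df X 0 u" by (simp add: eq_neg_iff_add_eq_0 add.commute)
        also have "\<dots> \<in> cyc D X 0 a"
          using diff_cyc[OF _ resolvesD(3)[OF X], of 0 0 a u] uw(2) 0 vec.subspace_0[OF strand_subspace, of X 0 a]
            functional_zero[OF fX] by (simp add: cyc_0)
        finally show ?thesis using inj[of w a] uw(3) e 0 by simp
      next
        case (Suc k)
        have e: "df X l u + \<phi> l w + up (rk X (Suc k)) (- df Y k w) = 0"
          using d Suc by (simp add: lin_uminus[OF lin_parts(3)])
        have "df X l u + \<phi> l w \<in> strand X (Suc k) a"
          using cyc_strand[OF resolvesD(3)[OF X uw(2)]] s\<phi>[OF uw(3)] Suc
          by (auto intro: vec.subspace_add[OF strand_subspace])
        note kb = keys_below[OF strand_keys[OF this]]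
        have "hi (rk X (Suc k)) (df X l u + \<phi> l w + up (rk X (Suc k)) (- df Y k w)) = 0"
          "lo (rk X (Suc k)) (df X l u + \<phi> l w + up (rk X (Suc k)) (- df Y k w)) = 0"
          unfolding e by (simp_all add: lin_zero[OF lin_parts(1)] lin_zero[OF lin_parts(2)])
        then show ?thesis
          using uw(3) Suc unfolding lin_add[OF lin_parts(2), of _ _ "up _ _"] lin_add[OF lin_parts(1), of _ _ "up _ _"] kb hi_up lo_up
          by (simp add: cyc_Suc)
      qed
      obtain x where x: "x \<in> strand Y (Suc l) a" "df Y l x = w"
        using resolvesD(4)[OF Y] cw by blast
      have "u + \<phi> (Suc l) x \<in> strand X (Suc l) a"
        using uw(2) s\<phi>[OF x(1)] by (intro vec.subspace_add[OF strand_subspace])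
      moreover have "df X l (u + \<phi> (Suc l) x) = 0"
        using cw c\<phi>[OF x(1)] x(2) by (simp add: lin_add[OF lX])
      ultimately have "u + \<phi> (Suc l) x \<in> cyc D X (Suc l) a" by (simp add: cyc_Suc)
      then obtain t where t: "t \<in> strand X (Suc (Suc l)) a" "df X (Suc l) t = u + \<phi> (Suc l) x"
        using resolvesD(4)[OF X] by blast
      have nx: "- x \<in> strand Y (Suc l) a" using x(1) by (intro vec.subspace_neg[OF strand_subspace])
      have "df ?C (Suc l) (t + up (rk X (Suc (Suc l))) (- x)) = z"
        unfolding dC[OF t(1)] using t(2) x(2) uw(1)
        by (simp add: lin_uminus[OF l\<phi>] lin_uminus[OF lY] lin_uminus[OF lin_parts(3)])
      then show "z \<in> df ?C i ` strand ?C (Suc i) a"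
        using join[OF t(1) nx] unfolding Suc by blast
    qed
  qed
  show ?thesis
    unfolding resolves_def
  proof (intro conjI allI ballI impI)
    show "lin (df ?C i)" for i by (rule lC)
    show "functional (au ?C)" using fX by (simp add: auC)
    show "df ?C i ` strand ?C (Suc i) a = cyc (D - D') ?C i a" for i a by (rule exact)
    show "\<exists>v\<in>strand ?C 0 a. au ?C v = 1" if "a \<in> D - D'" for a
      using resolvesD(5)[OF X, of a] that by (simp add: strand_cone_0 auC)
    show "au ?C (unit j) = 0" if a: "a \<in> D - D'" and j: "j < rk ?C 0" "dg ?C 0 j \<le> a \<and> dg ?C 0 j \<notin> D - D'" for a j
    proof -
      have "j < rk X 0" "dg X 0 j \<le> a" "dg X 0 j \<notin> D - D'" using j by (simp_all add: cone_def)
      then show ?thesis using upc a resolvesD(6)[OF X, of a j] unfolding auC by blast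
    qed
  qed
qed

lemma cone_exists:
  fixes X Y :: "('p::order, 'k::field) frame"
  assumes X: "resolves D X" and Y: "resolves D' Y" and sub: "D' \<subseteq> D"
    and upc: "\<forall>b\<in>D'. \<forall>a\<in>D. b \<le> a \<longrightarrow> a \<in> D'"
  shows "\<exists>C :: ('p, 'k) frame. resolves (D - D') C \<and> (\<forall>i. \<forall>j<rk C i.
     (\<exists>k<rk X i. dg C i j = dg X i k) \<or> (\<exists>l k. i = Suc l \<and> k < rk Y l \<and> dg C i j = dg Y l k))"
proof -
  obtain \<phi> where \<phi>: "chain_lift D' Y X \<phi>" "\<forall>i a. \<forall>v\<in>cyc D' Y i a. \<phi> i v \<in> cyc D X i a"
    using chain_lift_exists[OF Y X sub upc] by blast
  have "resolves (D - D') (cone X Y \<phi>)"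
    using resolves_cone[OF X Y sub upc \<phi>(1)] \<phi>(2) by blast
  moreover have "(\<exists>k<rk X i. dg (cone X Y \<phi>) i j = dg X i k) \<or>
      (\<exists>l k. i = Suc l \<and> k < rk Y l \<and> dg (cone X Y \<phi>) i j = dg Y l k)" if j: "j < rk (cone X Y \<phi>) i" for i j
  proof (cases i)
    case 0
    then show ?thesis using j by (auto simp: cone_def)
  next
    case (Suc l)
    show ?thesis
    proof (cases "j < rk X i")
      case True
      then show ?thesis using Suc by (auto simp: cone_def)
    next
      case False
      then have "j - rk X i < rk Y l" "dg (cone X Y \<phi>) i j = dg Y l (j - rk X i)"
        using j Suc by (auto simp: cone_def)
      then show ?thesis using Suc by blast
    qed
  qed
  ultimately show ?thesis by (intro exI[of _ "cone X Y \<phi>"]) blast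
qed

definition free_frame :: "'p \<Rightarrow> ('p::order, 'k::field) frame" where
  "free_frame z = \<lparr>rk = (\<lambda>i. if i = 0 then 1 else 0), dg = (\<lambda>i j. z), df = (\<lambda>i v. 0),
     au = (\<lambda>v. lookup v 0)\<rparr>"

lemma resolves_free_frame: "resolves {a. z \<le> a} (free_frame z :: ('p::order, 'k::field) frame)"
proof -
  let ?F = "free_frame z :: ('p, 'k) frame"
  have S: "strand ?F (Suc i) a = {0}" for i a by (auto simp: strand_def free_frame_def)
  have Z: "strand ?F 0 a = {v. \<forall>j. lookup v j \<noteq> 0 \<longrightarrow> j = 0 \<and> z \<le> a}" for a
    by (auto simp: strand_def free_frame_def subset_iff in_keys_iff)
  have v0: "v = 0" if "v \<in> strand ?F 0 a" "\<not> z \<le> a \<or> lookup v 0 = 0" for v a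
  proof (intro poly_mapping_eqI)
    fix j
    show "lookup v j = lookup 0 j"
      using that unfolding Z by (cases "j = 0") auto
  qed
  have 0: "0 \<in> strand ?F 0 a" for a by (rule vec.subspace_0[OF strand_subspace])
  have "df ?F i ` strand ?F (Suc i) a = cyc {a. z \<le> a} ?F i a" for i a
  proof (cases i)
    case 0
    have "cyc {a. z \<le> a} ?F 0 a = {0}"
      using v0[of _ a] \<open>0 \<in> strand ?F 0 a\<close> by (auto simp: cyc_0 free_frame_def)
    then show ?thesis by (simp add: 0 S) (simp add: free_frame_def)
  next
    case (Suc l)
    show ?thesis unfolding Suc S by (auto simp: cyc_Suc S) (simp_all add: free_frame_def)
  qed
  moreover have "\<exists>v\<in>strand ?F 0 a. au ?F v = 1" if "z \<le> a" for a
    using that by (intro bexI[of _ "unit 0"]) (auto simp: free_frame_def strand_def)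
  ultimately show ?thesis
    unfolding resolves_def
    by (auto simp: free_frame_def lin_def functional_def lookup_add lookup_vec_scale)
qed

definition shift_frame :: "('n \<Rightarrow> int) \<Rightarrow> ('n \<Rightarrow> int, 'k::field) frame \<Rightarrow> ('n \<Rightarrow> int, 'k) frame" where
  "shift_frame m X = X\<lparr>dg := (\<lambda>i j v. dg X i j v + m v)\<rparr>"

lemma resolves_shift:
  assumes X: "resolves D X"
  shows "resolves {a. (\<lambda>v. a v - m v) \<in> D} (shift_frame m X)"
proof -
  let ?Y = "shift_frame m X" and ?D = "{a. (\<lambda>v. a v - m v) \<in> D}"
  have simps: "rk ?Y = rk X" "df ?Y = df X" "au ?Y = au X" "dg ?Y i j = (\<lambda>v. dg X i j v + m v)" for i j
    by (simp_all add: shift_frame_def)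
  have le: "dg ?Y i j \<le> a \<longleftrightarrow> dg X i j \<le> (\<lambda>v. a v - m v)" for i j a
    by (simp add: simps le_fun_def algebra_simps)
  have str: "strand ?Y i a = strand X i (\<lambda>v. a v - m v)" for i a
    by (simp add: strand_def le) (simp add: simps)
  have "cyc ?D ?Y i a = cyc D X i (\<lambda>v. a v - m v)" for i a
    unfolding cyc_def str simps by (cases i) simp_all
  then have "df ?Y i ` strand ?Y (Suc i) a = cyc ?D ?Y i a" for i a
    using X unfolding resolves_def by (simp add: str simps)
  moreover have "au ?Y (unit j) = 0" if "a \<in> ?D" "j < rk ?Y 0" "dg ?Y 0 j \<le> a" "dg ?Y 0 j \<notin> ?D" for a j
  proof -
    have "dg X 0 j \<notin> D" using that(4) by (simp add: simps)
    then show ?thesis using resolvesD(6)[OF X, of "\<lambda>v. a v - m v" j] that(1,2,3) unfolding le by (simp add: simps)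
  qed
  moreover have "\<exists>v\<in>strand ?Y 0 a. au ?Y v = 1" if "a \<in> ?D" for a
    using resolvesD(5)[OF X, of "\<lambda>v. a v - m v"] that by (simp add: simps str)
  ultimately show ?thesis
    unfolding resolves_def using resolvesD(1,2)[OF X] by (auto simp: simps)
qed

section \<open>Frames for edge ideals of weakly chordal graphs\<close>

text \<open>The degrees of the monomials outside the ideal generated by the variables in \<open>Z\<close> and the edge ideal
  of \<open>G\<close>.\<close>

definition standard_degrees :: "'n set \<Rightarrow> 'n graph \<Rightarrow> ('n \<Rightarrow> int) set" where
  "standard_degrees Z G = {a. (\<forall>v. 0 \<le> a v) \<and> (\<forall>z\<in>Z. a z = 0) \<and>
     (\<forall>u v. adj G u v \<longrightarrow> a u = 0 \<or> a v = 0)}"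

text \<open>The Koszul complex on the variables in \<open>Z\<close>, built by one cone for each variable.\<close>

lemma edgeless_frame:
  fixes Z :: "'n::finite set"
  assumes "edges G = {}"
  shows "\<exists>X :: ('n \<Rightarrow> int, 'k::field) frame. resolves (standard_degrees Z G) X \<and>
     (\<forall>i. \<forall>j<rk X i. \<exists>\<sigma>. dg X i j = indicator \<sigma> \<and> \<sigma> \<subseteq> Z \<and> i = card \<sigma>)"
proof (induction Z rule: finite_induct[OF finite])
  case 1
  let ?F = "free_frame (\<lambda>_. 0) :: ('n \<Rightarrow> int, 'k) frame"
  have "standard_degrees {} G = {a. (\<lambda>_. 0) \<le> a}"
    using assms by (auto simp: standard_degrees_def adj_def le_fun_def)
  then have "resolves (standard_degrees {} G) ?F" using resolves_free_frame by simp
  moreover have "dg ?F i j = indicator {}" "j < rk ?F i \<Longrightarrow> i = card ({} :: 'n set)" for i j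
    by (auto simp: free_frame_def indicator_def split: if_splits)
  ultimately show ?case by blast
next
  case (2 z Z)
  obtain X :: "('n \<Rightarrow> int, 'k) frame" where X: "resolves (standard_degrees Z G) X"
    "\<forall>i. \<forall>j<rk X i. \<exists>\<sigma>. dg X i j = indicator \<sigma> \<and> \<sigma> \<subseteq> Z \<and> i = card \<sigma>"
    using 2 by blast
  let ?m = "indicator {z} :: 'n \<Rightarrow> int"
  let ?D' = "{a. (\<lambda>v. a v - ?m v) \<in> standard_degrees Z G}"
  have D': "?D' = {a \<in> standard_degrees Z G. 1 \<le> a z}"
  proof (intro subset_antisym subsetI)
    fix a assume a: "a \<in> ?D'"
    then have nn: "0 \<le> a v - ?m v" for v by (simp add: standard_degrees_def)
    have "0 \<le> a v" for v using nn[of v] by (cases "v = z") (auto simp: indicator_def)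
    moreover have "1 \<le> a z" using nn[of z] by simp
    moreover have "a v = 0" if "v \<in> Z" for v
      using a that 2(2) by (auto simp: standard_degrees_def indicator_def)
    ultimately show "a \<in> {a \<in> standard_degrees Z G. 1 \<le> a z}"
      using assms by (simp add: standard_degrees_def adj_def)
  next
    fix a assume a: "a \<in> {a \<in> standard_degrees Z G. 1 \<le> a z}"
    then show "a \<in> ?D'"
      using assms 2(2) by (auto simp: standard_degrees_def adj_def indicator_def)
  qed
  have eq: "standard_degrees (insert z Z) G = standard_degrees Z G - ?D'"
    unfolding D' by (auto simp: standard_degrees_def) (metis int_one_le_iff_zero_less order_le_less)
  have "\<exists>C :: ('n \<Rightarrow> int, 'k) frame. resolves (standard_degrees Z G - ?D') C \<and> (\<forall>i. \<forall>j<rk C i.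
     (\<exists>k<rk X i. dg C i j = dg X i k) \<or>
     (\<exists>l k. i = Suc l \<and> k < rk (shift_frame ?m X) l \<and> dg C i j = dg (shift_frame ?m X) l k))"
  proof (rule cone_exists[OF X(1) resolves_shift[OF X(1)]])
    show "?D' \<subseteq> standard_degrees Z G" unfolding D' by blast
    show "\<forall>b\<in>?D'. \<forall>a\<in>standard_degrees Z G. b \<le> a \<longrightarrow> a \<in> ?D'"
      unfolding D' by (auto simp: le_fun_def intro: order_trans)
  qed
  then obtain C :: "('n \<Rightarrow> int, 'k) frame" where C: "resolves (standard_degrees (insert z Z) G) C" "\<And>i j. j < rk C i \<Longrightarrow>
     (\<exists>k<rk X i. dg C i j = dg X i k) \<or>
     (\<exists>l k. i = Suc l \<and> k < rk X l \<and> dg C i j = (\<lambda>v. dg X l k v + ?m v))"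
    unfolding eq[symmetric] by (auto simp: shift_frame_def)
  have "\<exists>\<sigma>. dg C i j = indicator \<sigma> \<and> \<sigma> \<subseteq> insert z Z \<and> i = card \<sigma>" if j: "j < rk C i" for i j
    using C(2)[OF j]
  proof
    assume "\<exists>k<rk X i. dg C i j = dg X i k"
    then show ?thesis using X(2) by (metis subset_insertI2)
  next
    assume "\<exists>l k. i = Suc l \<and> k < rk X l \<and> dg C i j = (\<lambda>v. dg X l k v + ?m v)"
    then obtain l k where lk: "i = Suc l" "k < rk X l" "dg C i j = (\<lambda>v. dg X l k v + ?m v)" by blast
    then obtain \<sigma> where \<sigma>: "dg X l k = indicator \<sigma>" "\<sigma> \<subseteq> Z" "l = card \<sigma>" using X(2) by blast
    have z: "z \<notin> \<sigma>" using \<sigma>(2) 2(2) by blast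
    have "dg C i j = indicator (insert z \<sigma>)"
      unfolding lk(3) \<sigma>(1) using z by (auto simp: fun_eq_iff indicator_def)
    moreover have "i = card (insert z \<sigma>)" using z lk(1) \<sigma>(3) by simp
    ultimately show ?thesis using \<sigma>(2) by blast
  qed
  then show ?case using C(1) by (intro exI[of _ C]) blast
qed

text \<open>The variables in \<open>Z\<close> may be used freely and are not covered by the family. They add one to the
  homological degree and one to the size of \<open>\<sigma>\<close>, so \<open>i + length Bs = card \<sigma>\<close> also holds with them.\<close>

definition covered :: "'n graph \<Rightarrow> 'n set \<Rightarrow> nat \<Rightarrow> ('n \<Rightarrow> int) \<Rightarrow> bool" where
  "covered G Z i a \<longleftrightarrow> (\<exists>\<sigma> Bs. a = indicator \<sigma> \<and> i + length Bs = card \<sigma> \<and> strongly_disjoint G Bs \<and>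
     \<sigma> - Z = (\<Union>B\<in>set Bs. verts B))"

text \<open>The recursion over the edges. The variables in \<open>Z\<close> are carried along because the colon ideal for
  a co-pair \<open>xy\<close> contains the neighbours of \<open>x\<close> and \<open>y\<close> as variables. A multiple of the product \<open>m\<close> of
  the variables of \<open>x\<close> and \<open>y\<close> is a standard monomial for \<open>G - xy\<close> iff its quotient by \<open>m\<close> is one for
  \<open>Z \<union> N\<close> and \<open>G - N[xy]\<close>; removing these multiples leaves the standard monomials for \<open>G\<close>.\<close>

theorem graph_frame:
  fixes G :: "'n::finite graph"
  assumes "simple_graph G" "weakly_chordal G" "Z \<inter> verts G = {}"
  shows "\<exists>X :: ('n \<Rightarrow> int, 'k::field) frame. resolves (standard_degrees Z G) X \<and>
     (\<forall>i. \<forall>j<rk X i. covered G Z i (dg X i j))"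
  using assms
proof (induction "card (edges G)" arbitrary: G Z rule: less_induct)
  case less
  note G = less.prems(1,2) and Z = less.prems(3)
  show ?case
  proof (cases "edges G = {}")
    case True
    have "strongly_disjoint G []" by (simp add: strongly_disjoint_def)
    then have "covered G Z i (indicator \<sigma>)" if "\<sigma> \<subseteq> Z" "i = card \<sigma>" for i \<sigma>
      unfolding covered_def using that by (intro exI[of _ \<sigma>] exI[of _ "[]"]) auto
    then show ?thesis using edgeless_frame[OF True, of Z, where ?'k = 'k] by metis
  next
    case False
    then obtain x y where xy: "co_pair G x y" using weakly_chordal_co_pair[OF G] by blast
    interpret sym_graph "adj G" by (rule sym_graph_adj[OF G(1)])
    have xyV: "x \<in> verts G" "y \<in> verts G" "adj G x y"
      using xy by (auto simp: co_pair_def copair_def)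
    have ne: "x \<noteq> y" using xyV(3) by auto
    have xyZ: "x \<notin> Z" "y \<notin> Z" using xyV Z by auto
    have e: "{x, y} \<in> edges G" using xyV by (simp add: adj_def)
    define N where "N = {v \<in> verts G. v \<noteq> x \<and> v \<noteq> y \<and> (adj G v x \<or> adj G v y)}"
    define W where "W = {v \<in> verts G. v \<noteq> x \<and> v \<noteq> y \<and> \<not> adj G v x \<and> \<not> adj G v y}"
    let ?G1 = "del_edge G {x, y}" and ?G2 = "induced G W"
    have fin: "finite (edges G)" by simp
    have "card (edges ?G1) < card (edges G)"
      using e by (intro psubset_card_mono[OF fin]) auto
    then obtain X :: "('n \<Rightarrow> int, 'k) frame" where X: "resolves (standard_degrees Z ?G1) X"
      "\<forall>i. \<forall>j<rk X i. covered ?G1 Z i (dg X i j)"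
      using less.hyps[of ?G1 Z] simple_graph_del_edge[OF G(1)] weakly_chordal_del_co_pair[OF G xy] Z by auto
    have WV: "W \<subseteq> verts G" by (auto simp: W_def)
    have "{x, y} \<notin> edges ?G2" by (simp add: W_def)
    moreover have "edges ?G2 \<subseteq> edges G" by auto
    ultimately have "edges ?G2 \<subset> edges G" using e by blast
    then have "card (edges ?G2) < card (edges G)" by (intro psubset_card_mono[OF fin])
    moreover have "(Z \<union> N) \<inter> verts ?G2 = {}" using Z WV by (auto simp: N_def W_def)
    ultimately obtain Y :: "('n \<Rightarrow> int, 'k) frame" where Y: "resolves (standard_degrees (Z \<union> N) ?G2) Y"
      "\<forall>i. \<forall>j<rk Y i. covered ?G2 (Z \<union> N) i (dg Y i j)"
      using less.hyps[of ?G2 "Z \<union> N"] simple_graph_induced[OF G(1) WV] weakly_chordal_induced[OF G(2) WV] by blast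
    let ?m = "indicator {x, y} :: 'n \<Rightarrow> int"
    let ?D' = "{a. (\<lambda>v. a v - ?m v) \<in> standard_degrees (Z \<union> N) ?G2}"
    have D': "?D' = {a \<in> standard_degrees Z ?G1. 1 \<le> a x \<and> 1 \<le> a y}"
    proof (intro subset_antisym subsetI)
      fix a assume a: "a \<in> ?D'"
      then have nn: "0 \<le> a v - ?m v" for v by (simp add: standard_degrees_def)
      have "0 \<le> a v" for v using nn[of v] by (cases "v \<in> {x, y}") auto
      moreover have "1 \<le> a x" "1 \<le> a y" using nn[of x] nn[of y] by auto
      moreover have zn: "a v = 0" if "v \<in> Z \<union> N" for v
      proof -
        have "v \<noteq> x" "v \<noteq> y" using that xyZ by (auto simp: N_def)
        then show ?thesis using a that by (auto simp: standard_degrees_def)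
      qed
      moreover have "a u = 0 \<or> a v = 0" if uv: "adj ?G1 u v" for u v
      proof (rule ccontr)
        assume c: "\<not> ?thesis"
        have Guv: "adj G u v" "{u, v} \<noteq> {x, y}" using uv by (auto simp: adj_def)
        have V: "u \<in> verts G" "v \<in> verts G" using adj_in_verts[OF G(1) Guv(1)] by auto
        have nN: "u \<notin> N" "v \<notin> N" using zn c by auto
        have "u \<noteq> v" using Guv(1) by auto
        then have ux: "u \<noteq> x" "u \<noteq> y" "v \<noteq> x" "v \<noteq> y"
          using Guv V nN E_sym[of u v] unfolding N_def by auto
        then have "u \<in> W" "v \<in> W" using V nN by (auto simp: N_def W_def)
        then have "adj ?G2 u v" using Guv by (simp add: adj_def)
        then have "a u - ?m u = 0 \<or> a v - ?m v = 0" using a by (simp add: standard_degrees_def)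
        then show False using c ux by simp
      qed
      ultimately show "a \<in> {a \<in> standard_degrees Z ?G1. 1 \<le> a x \<and> 1 \<le> a y}"
        by (simp add: standard_degrees_def)
    next
      fix a assume "a \<in> {a \<in> standard_degrees Z ?G1. 1 \<le> a x \<and> 1 \<le> a y}"
      then have a: "\<And>v. 0 \<le> a v" "\<And>z. z \<in> Z \<Longrightarrow> a z = 0" "\<And>u v. adj ?G1 u v \<Longrightarrow> a u = 0 \<or> a v = 0"
        "1 \<le> a x" "1 \<le> a y" by (auto simp: standard_degrees_def)
      have "0 \<le> a v - ?m v" for v using a(1)[of v] a(4,5) by (auto simp: indicator_def)
      moreover have "a z - ?m z = 0" if "z \<in> Z \<union> N" for z
      proof -
        have "z \<noteq> x" "z \<noteq> y" using that xyZ by (auto simp: N_def)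
        moreover have "a z = 0"
        proof (cases "z \<in> Z")
          case False
          then have "adj G z x \<or> adj G z y" using that by (auto simp: N_def)
          then have "adj ?G1 z x \<or> adj ?G1 z y"
            using \<open>z \<noteq> x\<close> \<open>z \<noteq> y\<close> by (auto simp: adj_def doubleton_eq_iff)
          then show ?thesis using a(3)[of z x] a(3)[of z y] a(4,5) by auto
        qed (rule a(2))
        ultimately show ?thesis by simp
      qed
      moreover have "a u - ?m u = 0 \<or> a v - ?m v = 0" if "adj ?G2 u v" for u v
      proof -
        have uv: "u \<in> W" "v \<in> W" "adj G u v" using that by (auto simp: adj_def)
        then have d: "u \<noteq> x" "u \<noteq> y" "v \<noteq> x" "v \<noteq> y" by (auto simp: W_def)
        then have "adj ?G1 u v" using uv(3) by (auto simp: adj_def doubleton_eq_iff)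
        then show ?thesis using a(3)[of u v] d by auto
      qed
      ultimately show "a \<in> ?D'" by (simp add: standard_degrees_def)
    qed
    have eq: "standard_degrees Z G = standard_degrees Z ?G1 - ?D'"
    proof (intro subset_antisym subsetI)
      fix a assume a: "a \<in> standard_degrees Z G"
      then have "a x = 0 \<or> a y = 0" using xyV(3) by (simp add: standard_degrees_def)
      then show "a \<in> standard_degrees Z ?G1 - ?D'"
        using a unfolding D' by (auto simp: standard_degrees_def adj_def)
    next
      fix a assume a: "a \<in> standard_degrees Z ?G1 - ?D'"
      then have a1: "a \<in> standard_degrees Z ?G1" and "\<not> (1 \<le> a x \<and> 1 \<le> a y)" unfolding D' by auto
      moreover have "0 \<le> a x" "0 \<le> a y" using a1 by (auto simp: standard_degrees_def)
      ultimately have xy0: "a x = 0 \<or> a y = 0" by linarith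
      have "a u = 0 \<or> a v = 0" if "adj G u v" for u v
      proof (cases "{u, v} = {x, y}")
        case True
        then show ?thesis using xy0 by (auto simp: doubleton_eq_iff)
      next
        case False
        then have "adj ?G1 u v" using that by (simp add: adj_def)
        then show ?thesis using a1 by (simp add: standard_degrees_def)
      qed
      then show "a \<in> standard_degrees Z G" using a1 by (simp add: standard_degrees_def)
    qed
    have "\<exists>C :: ('n \<Rightarrow> int, 'k) frame. resolves (standard_degrees Z ?G1 - ?D') C \<and> (\<forall>i. \<forall>j<rk C i.
       (\<exists>k<rk X i. dg C i j = dg X i k) \<or>
       (\<exists>l k. i = Suc l \<and> k < rk (shift_frame ?m Y) l \<and> dg C i j = dg (shift_frame ?m Y) l k))"
    proof (rule cone_exists[OF X(1) resolves_shift[OF Y(1)]])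
      show "?D' \<subseteq> standard_degrees Z ?G1" unfolding D' by blast
      show "\<forall>b\<in>?D'. \<forall>a\<in>standard_degrees Z ?G1. b \<le> a \<longrightarrow> a \<in> ?D'"
        unfolding D' by (auto simp: le_fun_def intro: order_trans)
    qed
    then obtain C :: "('n \<Rightarrow> int, 'k) frame" where C: "resolves (standard_degrees Z G) C" "\<And>i j. j < rk C i \<Longrightarrow>
       (\<exists>k<rk X i. dg C i j = dg X i k) \<or>
       (\<exists>l k. i = Suc l \<and> k < rk Y l \<and> dg C i j = (\<lambda>v. dg Y l k v + ?m v))"
      unfolding eq[symmetric] by (auto simp: shift_frame_def)
    have "covered G Z i (dg C i j)" if j: "j < rk C i" for i j
      using C(2)[OF j]
    proof
      assume "\<exists>k<rk X i. dg C i j = dg X i k"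
      then have "covered ?G1 Z i (dg C i j)" using X(2) by auto
      then show ?thesis
        unfolding covered_def using strongly_disjoint_del_co_pair[OF G(1) xy] by blast
    next
      assume "\<exists>l k. i = Suc l \<and> k < rk Y l \<and> dg C i j = (\<lambda>v. dg Y l k v + ?m v)"
      then obtain l k where lk: "i = Suc l" "k < rk Y l" "dg C i j = (\<lambda>v. dg Y l k v + ?m v)" by blast
      then obtain \<sigma> Bs where \<sigma>: "dg Y l k = indicator \<sigma>" "l + length Bs = card \<sigma>"
        "strongly_disjoint ?G2 Bs" "\<sigma> - (Z \<union> N) = (\<Union>B\<in>set Bs. verts B)"
        using Y(2) unfolding covered_def by blast
      have "adj G t x \<or> adj G t y" if "t \<in> \<sigma> \<inter> N" for t using that by (auto simp: N_def)
      then obtain B where B: "strongly_disjoint G (B # Bs)" "verts B = insert x (insert y (\<sigma> \<inter> N))"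
        using strongly_disjoint_add_co_pair[OF G(1) xy _ W_def \<sigma>(3), of "\<sigma> \<inter> N"] by blast
      have "verts B' \<subseteq> W" if "B' \<in> set Bs" for B'
        using \<sigma>(3) that by (auto simp: strongly_disjoint_def subgraph_def)
      then have sub: "\<sigma> \<subseteq> W \<union> Z \<union> N" using \<sigma>(4) by blast
      then have xy\<sigma>: "x \<notin> \<sigma>" "y \<notin> \<sigma>" using xyZ by (auto simp: W_def N_def)
      let ?\<sigma> = "insert x (insert y \<sigma>)"
      have "dg C i j = indicator ?\<sigma>"
        unfolding lk(3) \<sigma>(1) using xy\<sigma> by (auto simp: fun_eq_iff indicator_def)
      moreover have "i + length (B # Bs) = card ?\<sigma>" using xy\<sigma> ne lk(1) \<sigma>(2) by simp
      moreover have "?\<sigma> - Z = (\<Union>B\<in>set (B # Bs). verts B)"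
      proof -
        have "N \<inter> Z = {}" using Z by (auto simp: N_def)
        then have "\<sigma> - Z = (\<sigma> \<inter> N) \<union> (\<sigma> - (Z \<union> N))" by blast
        then show ?thesis using xyZ B(2) \<sigma>(4) by auto
      qed
      ultimately show ?thesis unfolding covered_def using B(1) by blast
    qed
    then show ?thesis using C(1) by (intro exI[of _ C]) blast
  qed
qed

section \<open>Multigraded free modules by degree\<close>

text \<open>The exponent vector with given degree; negative entries are replaced by zero.\<close>

lift_definition expo :: "('n::finite \<Rightarrow> int) \<Rightarrow> ('n \<Rightarrow>\<^sub>0 nat)" is "\<lambda>a v. nat (a v)"
  by simp

definition mdeg :: "('n \<Rightarrow>\<^sub>0 nat) \<Rightarrow> 'n \<Rightarrow> int" where
  "mdeg m = (\<lambda>v. int (lookup m v))"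

lemma expo_mdeg [simp]: "expo (mdeg m) = m"
  by (intro poly_mapping_eqI) (simp add: expo.rep_eq mdeg_def)

lemma mdeg_expo: "(\<And>v. 0 \<le> a v) \<Longrightarrow> mdeg (expo a) = a"
  by (simp add: expo.rep_eq mdeg_def fun_eq_iff)

lemma mdeg_nonneg: "0 \<le> mdeg m v" by (simp add: mdeg_def)

lemma mdeg_add: "mdeg (m + n) v = mdeg m v + mdeg n v"
  by (simp add: mdeg_def lookup_add)

lemma mdeg_0 [simp]: "mdeg 0 = (\<lambda>_. 0)" by (simp add: mdeg_def)

lemma expo_diff_iff: "s \<le> a \<and> expo (\<lambda>v. a v - s v) = m \<longleftrightarrow> a = (\<lambda>v. s v + mdeg m v)"
proof
  assume "s \<le> a \<and> expo (\<lambda>v. a v - s v) = m"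
  then have "mdeg m = (\<lambda>v. a v - s v)" using mdeg_expo[of "\<lambda>v. a v - s v"] by (auto simp: le_fun_def)
  then show "a = (\<lambda>v. s v + mdeg m v)" by simp
next
  assume a: "a = (\<lambda>v. s v + mdeg m v)"
  then have "(\<lambda>v. a v - s v) = mdeg m" by simp
  then show "s \<le> a \<and> expo (\<lambda>v. a v - s v) = m" using a by (simp add: le_fun_def mdeg_nonneg)
qed

type_synonym ('n, 'k) free_vec = "nat \<Rightarrow>\<^sub>0 ('n, 'k) mpoly"

text \<open>The degree \<open>a\<close> part of an element of the free module with basis degrees \<open>s\<close>, with all variables set
  to \<open>1\<close>. The family of these vectors over all \<open>a\<close> determines the element.\<close>

lift_definition coef :: "(nat \<Rightarrow> 'n::finite \<Rightarrow> int) \<Rightarrow> ('n \<Rightarrow> int) \<Rightarrow> ('n, 'k::field) free_vec \<Rightarrow> (nat \<Rightarrow>\<^sub>0 'k)" is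
  "\<lambda>s a f j. if s j \<le> a then lookup (f j) (expo (\<lambda>v. a v - s j v)) else 0"
  by (rule finite_subset) auto

abbreviation term_vec :: "nat \<Rightarrow> ('n \<Rightarrow>\<^sub>0 nat) \<Rightarrow> 'k::field \<Rightarrow> ('n, 'k) free_vec" where
  "term_vec j m c \<equiv> single j (single m c)"

abbreviation smul :: "('n, 'k::field) mpoly \<Rightarrow> ('n, 'k) free_vec \<Rightarrow> ('n, 'k) free_vec" where
  "smul p \<equiv> Poly_Mapping.map ((*) p)"

lemma lookup_smul [simp]: "lookup (smul p f) j = p * lookup f j"
  by (simp add: map.rep_eq when_def)

lemma smul_add: "smul p (f + g) = smul p f + smul p g" "smul (p + q) f = smul p f + smul q f"
  by (auto intro!: poly_mapping_eqI simp: lookup_add algebra_simps)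

lemma smul_single [simp]: "smul p (single j q) = single j (p * q)"
  by (intro poly_mapping_eqI) (simp add: lookup_single when_def)

lemma coef_0 [simp]: "coef s a 0 = 0"
  by (intro poly_mapping_eqI) (simp add: coef.rep_eq)

lemma coef_add: "coef s a (f + g) = coef s a f + coef s a g"
  by (intro poly_mapping_eqI) (simp add: coef.rep_eq lookup_add)

lemma coef_sum: "coef s a (sum f A) = (\<Sum>i\<in>A. coef s a (f i))"
  by (induction A rule: infinite_finite_induct) (simp_all add: coef_add)

lemma coef_term: "coef s a (term_vec j m c) = (if a = (\<lambda>v. s j v + mdeg m v) then single j c else 0)"
proof (intro poly_mapping_eqI)
  fix i
  have "lookup (coef s a (term_vec j m c)) i =
      (if i = j \<and> (s j \<le> a \<and> expo (\<lambda>v. a v - s j v) = m) then c else 0)"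
    by (auto simp: coef.rep_eq lookup_single when_def)
  then show "lookup (coef s a (term_vec j m c)) i =
      lookup (if a = (\<lambda>v. s j v + mdeg m v) then single j c else 0) i"
    unfolding expo_diff_iff by (auto simp: lookup_single when_def)
qed

lemma coef_at: "lookup (coef s (\<lambda>v. s j v + mdeg m v) f) j = lookup (lookup f j) m"
  using mdeg_nonneg[of m] by (simp add: coef.rep_eq le_fun_def)

lemma coef_eqI:
  assumes "\<And>a. coef s a f = coef s a g" shows "f = g"
proof (intro poly_mapping_eqI)
  fix j m
  show "lookup (lookup f j) m = lookup (lookup g j) m"
    using coef_at[of s j m f] coef_at[of s j m g] assms by metis
qed

lemma coef_finite: "finite {a. coef s a f \<noteq> 0}"
proof (rule finite_subset)
  let ?A = "\<Union>j\<in>keys f. (\<lambda>m v. s j v + mdeg m v) ` keys (lookup f j)"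
  show "finite ?A" by simp
  show "{a. coef s a f \<noteq> 0} \<subseteq> ?A"
  proof
    fix a assume "a \<in> {a. coef s a f \<noteq> 0}"
    then obtain j where "lookup (coef s a f) j \<noteq> 0"
      by (auto simp: poly_mapping_eq_iff fun_eq_iff)
    then have j: "s j \<le> a" "lookup (lookup f j) (expo (\<lambda>v. a v - s j v)) \<noteq> 0"
      by (auto simp: coef.rep_eq split: if_splits)
    have "a = (\<lambda>v. s j v + mdeg (expo (\<lambda>v. a v - s j v)) v)" using j(1) expo_diff_iff by blast
    moreover have "j \<in> keys f" "expo (\<lambda>v. a v - s j v) \<in> keys (lookup f j)"
      using j(2) by (auto simp: in_keys_iff)
    ultimately show "a \<in> ?A" by blast
  qed
qed

lemma keys_coef: "keys f \<subseteq> {..<b} \<Longrightarrow> keys (coef s a f) \<subseteq> {j. j < b \<and> s j \<le> a}"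
  by (auto simp: coef.rep_eq in_keys_iff subset_iff split: if_splits) (metis lookup_zero)

lemma sum_terms:
  "(f :: ('n::finite, 'k::field) free_vec) = (\<Sum>j\<in>keys f. \<Sum>m\<in>keys (lookup f j).
     term_vec j m (lookup (lookup f j) m))"
proof -
  have p: "(p :: ('n, 'k) mpoly) = (\<Sum>m\<in>keys p. single m (lookup p m))" for p
    by (intro poly_mapping_eqI) (simp add: lookup_sum lookup_single when_def sum.delta in_keys_iff)
  have s: "single j (sum g A) = (\<Sum>m\<in>A. single j (g m))"
    for j :: nat and A :: "('n \<Rightarrow>\<^sub>0 nat) set" and g :: "_ \<Rightarrow> ('n, 'k) mpoly"
    by (induction A rule: infinite_finite_induct) (simp_all add: single_add)
  have "f = (\<Sum>j\<in>keys f. single j (lookup f j))"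
    by (intro poly_mapping_eqI[of f]) (simp add: lookup_sum lookup_single when_def sum.delta in_keys_iff)
  moreover have "single j (lookup f j) =
      (\<Sum>m\<in>keys (lookup f j). term_vec j m (lookup (lookup f j) m))" for j
    using arg_cong[OF p[of "lookup f j"], of "single j"] unfolding s .
  ultimately show ?thesis by simp
qed

lemma keys_sum_subset:
  assumes "\<And>i. i \<in> A \<Longrightarrow> keys (f i) \<subseteq> B" shows "keys (sum f A) \<subseteq> B"
  using assms
proof (induction A rule: infinite_finite_induct)
  case (insert x A)
  then show ?case using keys_add[of "f x" "sum f A"] by auto
qed simp_all

text \<open>Additive statements about elements of a free module reduce to monomials times basis elements.\<close>

lemma free_vec_induct [consumes 1, case_names zero add monomial]:
  fixes f :: "('n::finite, 'k::field) free_vec"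
  assumes f: "keys f \<subseteq> {..<b}" and z: "P 0"
    and add: "\<And>f g. keys f \<subseteq> {..<b} \<Longrightarrow> keys g \<subseteq> {..<b} \<Longrightarrow> P f \<Longrightarrow> P g \<Longrightarrow> P (f + g)"
    and t: "\<And>j m c. j < b \<Longrightarrow> P (term_vec j m c)"
  shows "P f"
proof -
  have S: "keys (sum g A) \<subseteq> {..<b} \<and> P (sum g A)"
    if "\<And>i. i \<in> A \<Longrightarrow> keys (g i) \<subseteq> {..<b} \<and> P (g i)" for A :: "'x set" and g
    using that
  proof (induction A rule: infinite_finite_induct)
    case (insert x A)
    then show ?case using add[of "g x" "sum g A"] keys_add[of "g x" "sum g A"] by auto
  qed (use z in auto)
  have "keys (term_vec j m c :: ('n, 'k) free_vec) \<subseteq> {..<b} \<and> P (term_vec j m c)" if "j < b" for j m c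
    using t[OF that, of m c] that by (auto simp: in_keys_iff lookup_single when_def)
  then have "P (\<Sum>j\<in>keys f. \<Sum>m\<in>keys (lookup f j).
     term_vec j m (lookup (lookup f j) m))"
    using f z by (intro S[THEN conjunct2] S) auto
  then show ?thesis using sum_terms[of f] by simp
qed

text \<open>The element of degree \<open>a\<close> that becomes \<open>v\<close> when all variables are set to \<open>1\<close>.\<close>

definition homog :: "(nat \<Rightarrow> 'n::finite \<Rightarrow> int) \<Rightarrow> ('n \<Rightarrow> int) \<Rightarrow> (nat \<Rightarrow>\<^sub>0 'k::field) \<Rightarrow> ('n, 'k) free_vec" where
  "homog s a v = (\<Sum>j\<in>keys v. term_vec j (expo (\<lambda>v. a v - s j v)) (lookup v j))"

lemma keys_homog: "keys (homog s a v) \<subseteq> keys v"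
  unfolding homog_def by (rule keys_sum_subset) (auto simp: in_keys_iff lookup_single when_def split: if_splits)

lemma coef_homog:
  assumes "\<And>j. j \<in> keys v \<Longrightarrow> s j \<le> a"
  shows "coef s c (homog s a v) = (if c = a then v else 0)"
proof -
  have "coef s c (term_vec j (expo (\<lambda>v. a v - s j v)) x) = (if c = a then single j x else 0)"
    if "j \<in> keys v" for j x
    using expo_diff_iff[of "s j" a "expo (\<lambda>v. a v - s j v)"] assms[OF that] by (auto simp: coef_term)
  then have "coef s c (homog s a v) = (\<Sum>j\<in>keys v. if c = a then single j (lookup v j) else 0)"
    unfolding homog_def coef_sum by (intro sum.cong) auto
  also have "\<dots> = (if c = a then v else 0)"
    using sum_singles[of v] by simp
  finally show ?thesis .
qed

text \<open>Setting the variables to \<open>1\<close> turns multiplication by a monomial into a shift of degrees.\<close>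

lemma coef_smul_monomial:
  "coef s a (smul (single m c) f) = vec_scale c (coef s (\<lambda>v. a v - mdeg m v) f)"
proof -
  obtain b where "keys f \<subseteq> {..<b}"
    using finite_nat_set_iff_bounded[of "keys f"] by auto
  then show ?thesis
  proof (induction rule: free_vec_induct)
    case zero
    have "smul (single m c) 0 = 0" by (intro poly_mapping_eqI) simp
    then show ?case by simp
  next
    case (add f g)
    then show ?case by (simp add: coef_add smul_add vec.scale_right_distrib)
  next
    case (monomial j m' c')
    have "a = (\<lambda>v. s j v + mdeg (m + m') v) \<longleftrightarrow> (\<lambda>v. a v - mdeg m v) = (\<lambda>v. s j v + mdeg m' v)"
      by (auto simp: fun_eq_iff mdeg_add algebra_simps)
    then show ?case by (simp add: mult_single coef_term)
  qed
qed

lemma free_module_simps: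
  "carrier (free_module b s) = {f. keys f \<subseteq> {..<b}}"
  "x \<oplus>\<^bsub>free_module b s\<^esub> y = x + y" "p \<odot>\<^bsub>free_module b s\<^esub> x = smul p x"
  by (simp_all add: free_module_def)

lemma component_free_module:
  fixes f :: "('n::finite, 'k::field) free_vec"
  shows "f \<in> component (free_module b s) a \<longleftrightarrow>
    keys f \<subseteq> {..<b} \<and> (\<forall>c. c \<noteq> a \<longrightarrow> coef s c f = 0)"
proof
  assume L: "f \<in> component (free_module b s) a"
  then have k: "keys f \<subseteq> {..<b}"
    and h: "\<And>j. j < b \<Longrightarrow> homogeneous (\<lambda>v. a v - s j v) (lookup f j)"
    by (auto simp: free_module_def)
  have "coef s c f = 0" if "c \<noteq> a" for c
  proof (intro poly_mapping_eqI, rule ccontr)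
    fix j assume "lookup (coef s c f) j \<noteq> lookup 0 j"
    then have j: "s j \<le> c" "lookup (lookup f j) (expo (\<lambda>v. c v - s j v)) \<noteq> 0"
      by (auto simp: coef.rep_eq split: if_splits)
    then have "j \<in> keys f" by (auto simp: in_keys_iff)
    then have "j < b" using k by auto
    then have "mdeg (expo (\<lambda>v. c v - s j v)) = (\<lambda>v. a v - s j v)"
      using h[of j] j(2) by (auto simp: homogeneous_def mdeg_def in_keys_iff fun_eq_iff)
    moreover have "c = (\<lambda>v. s j v + mdeg (expo (\<lambda>v. c v - s j v)) v)" using j(1) expo_diff_iff by blast
    ultimately show False using that by (simp add: fun_eq_iff)
  qed
  then show "keys f \<subseteq> {..<b} \<and> (\<forall>c. c \<noteq> a \<longrightarrow> coef s c f = 0)" using k by blast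
next
  assume R: "keys f \<subseteq> {..<b} \<and> (\<forall>c. c \<noteq> a \<longrightarrow> coef s c f = 0)"
  have "homogeneous (\<lambda>v. a v - s j v) (lookup f j)" for j
    unfolding homogeneous_def
  proof (intro ballI allI)
    fix m v assume "m \<in> keys (lookup f j)"
    then have "coef s (\<lambda>v. s j v + mdeg m v) f \<noteq> 0"
      using coef_at[of s j m f] by (auto simp: in_keys_iff)
    then have "(\<lambda>v. s j v + mdeg m v) = a" using R by blast
    then have "a v = s j v + mdeg m v" by metis
    then show "int (lookup m v) = a v - s j v" by (simp add: mdeg_def)
  qed
  then show "f \<in> component (free_module b s) a" using R by (simp add: free_module_def)
qed

lemma realize:
  assumes "finite {a. w a \<noteq> 0}" "\<And>a. keys (w a) \<subseteq> {j. j < b \<and> s j \<le> a}"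
  shows "\<exists>g\<in>carrier (free_module b s). \<forall>a. coef s a g = w a"
proof -
  let ?g = "\<Sum>a\<in>{a. w a \<noteq> 0}. homog s a (w a)"
  have "keys ?g \<subseteq> {..<b}"
    using keys_homog[of s _ "w _"] assms(2) by (intro keys_sum_subset) blast
  moreover have "coef s c ?g = w c" for c
  proof -
    have "coef s c (homog s a (w a)) = (if c = a then w a else 0)" for a
      by (rule coef_homog) (use assms(2) in blast)
    then show ?thesis using assms(1) by (simp add: coef_sum sum.delta)
  qed
  ultimately show ?thesis by (auto simp: free_module_simps)
qed

definition dehomog :: "(nat \<Rightarrow> 'n::finite \<Rightarrow> int) \<Rightarrow> (nat \<Rightarrow> 'n \<Rightarrow> int) \<Rightarrow>
    (('n, 'k::field) free_vec \<Rightarrow> ('n, 'k) free_vec) \<Rightarrow> (nat \<Rightarrow>\<^sub>0 'k) \<Rightarrow> (nat \<Rightarrow>\<^sub>0 'k)" where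
  "dehomog t s h = ext (\<lambda>j. coef s (t j) (h (single j 1)))"

text \<open>A linear map of free modules that preserves degrees acts on all degree parts by the same matrix of
  scalars.\<close>

lemma coef_dehomog:
  fixes h :: "('n::finite, 'k::field) free_vec \<Rightarrow> ('n, 'k) free_vec"
  assumes hadd: "\<And>x y. keys x \<subseteq> {..<b} \<Longrightarrow> keys y \<subseteq> {..<b} \<Longrightarrow> h (x + y) = h x + h y"
    and sm: "\<And>p x. keys x \<subseteq> {..<b} \<Longrightarrow> h (smul p x) = smul p (h x)"
    and he: "\<And>j c. j < b \<Longrightarrow> c \<noteq> t j \<Longrightarrow> coef s c (h (single j 1)) = 0"
    and f: "keys f \<subseteq> {..<b}"
  shows "coef s a (h f) = dehomog t s h (coef t a f)"
proof -
  have lin: "lin (dehomog t s h)" unfolding dehomog_def by (rule lin_ext)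
  show ?thesis
    using f
  proof (induction rule: free_vec_induct)
    case zero
    have "h 0 = 0" using hadd[of 0 0] by (metis add_cancel_right_left add_0 empty_subsetI keys_zero)
    then show ?case by (simp add: lin_zero[OF lin])
  next
    case (add f g)
    then show ?case by (simp add: hadd coef_add lin_add[OF lin])
  next
    case (monomial j m c)
    let ?e = "single j 1 :: ('n, 'k) free_vec"
    have e: "?e = term_vec j 0 1" by simp
    have ke: "keys ?e \<subseteq> {..<b}" using monomial by simp
    have "term_vec j m c = smul (single m c) ?e" by simp
    then have "h (term_vec j m c) = smul (single m c) (h ?e)" using sm[OF ke] by metis
    then have L: "coef s a (h (term_vec j m c)) = vec_scale c (coef s (\<lambda>v. a v - mdeg m v) (h ?e))"
      by (simp add: coef_smul_monomial)
    show ?case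
    proof (cases "a = (\<lambda>v. t j v + mdeg m v)")
      case True
      have "single j c = vec_scale c (unit j)" by simp
      then have "dehomog t s h (single j c) = vec_scale c (coef s (t j) (h ?e))"
        using lin_scale[OF lin, of c "unit j"] by (simp add: dehomog_def)
      then show ?thesis unfolding L coef_term using True by simp
    next
      case False
      then have "(\<lambda>v. a v - mdeg m v) \<noteq> t j" by (auto simp: fun_eq_iff algebra_simps)
      then show ?thesis unfolding L coef_term using False he[OF monomial] lin_zero[OF lin] by simp
    qed
  qed
qed

lemma graded_hom_coef:
  fixes h :: "('n::finite, 'k::field) free_vec \<Rightarrow> ('n, 'k) free_vec"
  assumes h: "graded_hom (free_module b t) (free_module b' s) h"
    and f: "keys f \<subseteq> {..<b}"
  shows "coef s a (h f) = dehomog t s h (coef t a f)"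
proof (rule coef_dehomog[OF _ _ _ f])
  show "h (x + y) = h x + h y" if "keys x \<subseteq> {..<b}" "keys y \<subseteq> {..<b}" for x y
    using h that by (simp add: graded_hom_def free_module_simps)
  show "h (smul p x) = smul p (h x)" if "keys x \<subseteq> {..<b}" for p x
    using h that by (simp add: graded_hom_def free_module_simps)
  fix j c assume j: "j < b" "c \<noteq> t j"
  have "single j 1 = (term_vec j 0 1 :: ('n, 'k) free_vec)" by simp
  then have "(single j 1 :: ('n, 'k) free_vec) \<in> component (free_module b t) (t j)"
    using j(1) unfolding component_free_module by (simp add: coef_term del: single_one)
  then have "h (single j 1) \<in> component (free_module b' s) (t j)"
    using h unfolding graded_hom_def by blast
  then show "coef s c (h (single j 1)) = 0"
    using j(2) unfolding component_free_module by blast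
qed

definition free_ext :: "(nat \<Rightarrow> ('n, 'k::field) free_vec) \<Rightarrow> ('n, 'k) free_vec \<Rightarrow> ('n, 'k) free_vec" where
  "free_ext g f = (\<Sum>j\<in>keys f. smul (lookup f j) (g j))"

lemma smul_simps: "smul 0 f = 0" "smul 1 f = f" "smul p 0 = 0" "smul p (smul q f) = smul (p * q) f"
  "smul p (sum g A) = (\<Sum>i\<in>A. smul p (g i))"
  by (auto intro!: poly_mapping_eqI simp: lookup_sum sum_distrib_left mult.assoc)

lemma free_ext_superset:
  assumes "finite A" "keys f \<subseteq> A"
  shows "free_ext g f = (\<Sum>j\<in>A. smul (lookup f j) (g j))"
  unfolding free_ext_def
  by (intro sum.mono_neutral_left) (use assms in \<open>auto simp: in_keys_iff smul_simps\<close>)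

lemma free_ext_add: "free_ext g (f + f') = free_ext g f + free_ext g f'"
  using keys_add[of f f']
  by (simp add: free_ext_superset[of "keys f \<union> keys f'"]
      lookup_add smul_add sum.distrib)

lemma free_ext_smul: "free_ext g (smul p f) = smul p (free_ext g f)"
proof -
  have "keys (smul p f) \<subseteq> keys f" by (auto simp: in_keys_iff)
  then show ?thesis
    by (simp add: free_ext_superset[of "keys f"] smul_simps)
qed

lemma free_ext_unit: "free_ext g (single j 1) = g j"
  by (simp add: free_ext_def smul_simps)

lemma keys_free_ext:
  assumes "\<And>j. j \<in> keys f \<Longrightarrow> keys (g j) \<subseteq> B"
  shows "keys (free_ext g f) \<subseteq> B"
  unfolding free_ext_def
proof (rule keys_sum_subset)
  fix j assume "j \<in> keys f"
  moreover have "keys (smul (lookup f j) (g j)) \<subseteq> keys (g j)"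
    by (auto simp: in_keys_iff)
  ultimately show "keys (smul (lookup f j) (g j)) \<subseteq> B" using assms by blast
qed

section \<open>Residue classes modulo the edge ideal\<close>

lemma cring_poly_ring: "cring (poly_ring :: ('n, 'k::field) mpoly ring)"
proof (intro cringI abelian_groupI comm_monoidI)
  fix x :: "('n, 'k) mpoly" assume "x \<in> carrier poly_ring"
  show "\<exists>y\<in>carrier poly_ring. y \<oplus>\<^bsub>poly_ring\<^esub> x = \<zero>\<^bsub>poly_ring\<^esub>"
    by (intro bexI[of _ "- x"]) (simp_all add: poly_ring_def)
qed (simp_all add: poly_ring_def algebra_simps)

definition bad :: "'n graph \<Rightarrow> ('n \<Rightarrow>\<^sub>0 nat) \<Rightarrow> bool" where
  "bad G m \<longleftrightarrow> (\<exists>u v. adj G u v \<and> 1 \<le> lookup m u \<and> 1 \<le> lookup m v)"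

lemma bad_add: "bad G m \<Longrightarrow> bad G (m + n)" "bad G m \<Longrightarrow> bad G (n + m)"
  unfolding bad_def by (fastforce simp: lookup_add)+

lemma bad_iff: "bad G m \<longleftrightarrow> mdeg m \<notin> standard_degrees {} G"
  by (auto simp: bad_def standard_degrees_def mdeg_def Suc_le_eq)

lemma ideal_bad: "ideal {p :: ('n, 'k::field) mpoly. \<forall>m\<in>keys p. bad G m} poly_ring" (is "ideal ?J _")
proof (rule idealI)
  interpret cring "poly_ring :: ('n, 'k) mpoly ring" by (rule cring_poly_ring)
  show "ring (poly_ring :: ('n, 'k) mpoly ring)" by unfold_locales
  show "subgroup ?J (add_monoid poly_ring)"
  proof (rule add.subgroupI)
    show "?J \<subseteq> carrier poly_ring" by (simp add: poly_ring_def)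
    show "?J \<noteq> {}" by (auto intro!: exI[of _ 0])
    fix p assume p: "p \<in> ?J"
    have "p \<oplus>\<^bsub>poly_ring\<^esub> (- p) = \<zero>\<^bsub>poly_ring\<^esub>" by (simp add: poly_ring_def)
    then have "\<ominus>\<^bsub>poly_ring\<^esub> p = - p"
      by (intro minus_equality) (simp_all add: poly_ring_def)
    then show "\<ominus>\<^bsub>poly_ring\<^esub> p \<in> ?J" using p by simp
    fix q assume "q \<in> ?J"
    then show "p \<oplus>\<^bsub>poly_ring\<^esub> q \<in> ?J" using p keys_add[of p q] by (auto simp: poly_ring_def)
  qed
  fix p q :: "('n, 'k) mpoly" assume p: "p \<in> ?J"
  show "q \<otimes>\<^bsub>poly_ring\<^esub> p \<in> ?J" "p \<otimes>\<^bsub>poly_ring\<^esub> q \<in> ?J"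
    using p keys_mult[of p q] keys_mult[of q p] bad_add[of G] by (auto simp: poly_ring_def; blast)+
qed

lemma edge_ideal_eq:
  assumes G: "simple_graph G"
  shows "(edge_ideal G :: ('n, 'k::field) mpoly set) = {p. \<forall>m\<in>keys p. bad G m}" (is "_ = ?J")
proof
  interpret cring "poly_ring :: ('n, 'k) mpoly ring" by (rule cring_poly_ring)
  let ?S = "{Var u * Var v | u v. {u, v} \<in> edges G} :: ('n, 'k) mpoly set"
  show "edge_ideal G \<subseteq> ?J"
    unfolding edge_ideal_def
  proof (rule genideal_minimal[OF ideal_bad])
    show "?S \<subseteq> ?J"
    proof
      fix p assume "p \<in> ?S"
      then obtain u v where p: "p = single (single u 1 + single v 1) 1"
        "adj G u v" by (auto simp: Var_def mult_single adj_def)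
      have "bad G (single u 1 + single v 1)"
        unfolding bad_def using p(2) by (intro exI[of _ u] exI[of _ v]) (simp add: lookup_add lookup_single)
      then show "p \<in> ?J" using p(1) by simp
    qed
  qed
  have S: "?S \<subseteq> carrier poly_ring" by (simp add: poly_ring_def)
  interpret I: ideal "Idl\<^bsub>poly_ring\<^esub> ?S" poly_ring by (rule genideal_ideal[OF S])
  have mon: "single m c \<in> Idl\<^bsub>poly_ring\<^esub> ?S" if "bad G m" for m c
  proof -
    obtain u v where uv: "adj G u v" "1 \<le> lookup m u" "1 \<le> lookup m v"
      using \<open>bad G m\<close> by (auto simp: bad_def)
    interpret sym_graph "adj G" by (rule sym_graph_adj[OF G])
    have ne: "u \<noteq> v" using uv(1) by auto
    let ?e = "single u 1 + single v (1::nat)"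
    have "m = (m - ?e) + ?e"
      using uv(2,3) ne by (intro poly_mapping_eqI) (auto simp: lookup_add lookup_minus lookup_single when_def)
    then have "single m c = single (m - ?e) c * (Var u * Var v)"
      unfolding Var_def mult_single by (metis mult.right_neutral)
    moreover have "Var u * Var v \<in> Idl\<^bsub>poly_ring\<^esub> ?S"
      using genideal_self[OF S] uv(1) by (auto simp: adj_def)
    ultimately show ?thesis
      using I.I_l_closed[of "Var u * Var v" "single (m - ?e) c"] by (simp add: poly_ring_def)
  qed
  show "?J \<subseteq> edge_ideal G"
  proof
    fix p assume p: "p \<in> ?J"
    have sums: "sum f A \<in> Idl\<^bsub>poly_ring\<^esub> ?S" if "\<And>i. i \<in> A \<Longrightarrow> f i \<in> Idl\<^bsub>poly_ring\<^esub> ?S"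
      for f and A :: "('n \<Rightarrow>\<^sub>0 nat) set"
      using that
    proof (induction A rule: infinite_finite_induct)
      case (insert x A)
      then show ?case using I.a_closed[of "f x" "sum f A"] by (simp add: poly_ring_def)
    qed (use I.zero_closed in \<open>simp_all add: poly_ring_def\<close>)
    have "p = (\<Sum>m\<in>keys p. single m (lookup p m))"
      by (intro poly_mapping_eqI) (simp add: lookup_sum lookup_single when_def sum.delta in_keys_iff)
    also have "\<dots> \<in> Idl\<^bsub>poly_ring\<^esub> ?S" using p mon by (intro sums) auto
    finally show "p \<in> edge_ideal G" by (simp add: edge_ideal_def)
  qed
qed

definition residue_class :: "'n graph \<Rightarrow> ('n, 'k::field) mpoly \<Rightarrow> ('n, 'k) mpoly set" where
  "residue_class G p = edge_ideal G +>\<^bsub>poly_ring\<^esub> p"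

text \<open>The standard monomials form a basis of the quotient ring.\<close>

lemma residue_class_eq_iff:
  fixes p q :: "('n::finite, 'k::field) mpoly"
  assumes G: "simple_graph G"
  shows "residue_class G p = residue_class G q \<longleftrightarrow>
    (\<forall>a\<in>standard_degrees {} G. lookup p (expo a) = lookup q (expo a))"
proof -
  let ?J = "{p :: ('n, 'k) mpoly. \<forall>m\<in>keys p. bad G m}"
  have cls: "residue_class G p = {h + p | h. h \<in> ?J}" for p
    unfolding residue_class_def edge_ideal_eq[OF G] by (auto simp: a_r_coset_def' poly_ring_def)
  have add: "x + y \<in> ?J" if "x \<in> ?J" "y \<in> ?J" for x y using that keys_add[of x y] by auto
  have neg: "- x \<in> ?J" if "x \<in> ?J" for x using that by simp
  have "residue_class G p = residue_class G q \<longleftrightarrow> p - q \<in> ?J"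
  proof
    assume "residue_class G p = residue_class G q"
    moreover have "0 + p \<in> residue_class G p" unfolding cls by (intro CollectI exI[of _ 0]) simp
    ultimately obtain h where "p = h + q" "h \<in> ?J" unfolding cls by auto
    then show "p - q \<in> ?J" by simp
  next
    assume pq: "p - q \<in> ?J"
    have "h + p = (h + (p - q)) + q" "h + q = (h + - (p - q)) + p" for h by simp_all
    then show "residue_class G p = residue_class G q"
      unfolding cls using add[OF _ pq] add[OF _ neg[OF pq]] by (intro subset_antisym subsetI; blast)
  qed
  also have "\<dots> \<longleftrightarrow> (\<forall>m. mdeg m \<in> standard_degrees {} G \<longrightarrow> lookup p m = lookup q m)"
    by (auto simp: in_keys_iff lookup_minus bad_iff)
  also have "\<dots> \<longleftrightarrow> (\<forall>a\<in>standard_degrees {} G. lookup p (expo a) = lookup q (expo a))"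
  proof -
    have "mdeg (expo a) = a" if "a \<in> standard_degrees {} G" for a
      using that by (intro mdeg_expo) (simp add: standard_degrees_def)
    then show ?thesis by (metis expo_mdeg)
  qed
  finally show ?thesis .
qed

lemma quotient_module_simps:
  fixes p q :: "('n::finite, 'k::field) mpoly"
  assumes G: "simple_graph G"
  defines "M \<equiv> quotient_module (edge_ideal G) :: ('n, 'k, ('n, 'k) mpoly set) graded_module"
  shows "carrier M = range (residue_class G)"
    "residue_class G p \<oplus>\<^bsub>M\<^esub> residue_class G q = residue_class G (p + q)"
    "p \<odot>\<^bsub>M\<^esub> residue_class G q = residue_class G (p * q)"
    "\<zero>\<^bsub>M\<^esub> = residue_class G 0"
    "component M a = residue_class G ` {p. homogeneous a p}"
proof -
  interpret cring "poly_ring :: ('n, 'k) mpoly ring" by (rule cring_poly_ring)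
  interpret I: ideal "edge_ideal G :: ('n, 'k) mpoly set" poly_ring
    unfolding edge_ideal_eq[OF G] by (rule ideal_bad)
  note rc = residue_class_def
  have U: "x \<in> carrier poly_ring" for x :: "('n, 'k) mpoly" by (simp add: poly_ring_def)
  show "carrier M = range (residue_class G)"
    by (auto simp: M_def quotient_module_def FactRing_def A_RCOSETS_def' rc U)
  show "residue_class G p \<oplus>\<^bsub>M\<^esub> residue_class G q = residue_class G (p + q)"
    using I.a_rcos_sum[OF U U, of p q]
    by (simp add: M_def quotient_module_def FactRing_def rc) (simp add: poly_ring_def)
  show "p \<odot>\<^bsub>M\<^esub> residue_class G q = residue_class G (p * q)"
    using I.rcoset_mult_add[OF U U, of p q]
    by (simp add: M_def quotient_module_def FactRing_def rc) (simp add: poly_ring_def)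
  show "\<zero>\<^bsub>M\<^esub> = residue_class G 0"
    by (simp add: M_def quotient_module_def FactRing_def rc) (simp add: a_r_coset_def' poly_ring_def)
  show "component M a = residue_class G ` {p. homogeneous a p}"
    by (auto simp: M_def quotient_module_def rc)
qed

section \<open>Frames and graded free resolutions\<close>

lemma standard_degrees_down:
  assumes "a \<in> standard_degrees {} G" "b \<le> a" "\<And>v. 0 \<le> b v"
  shows "b \<in> standard_degrees {} G"
proof -
  have "b v = 0" if "a v = 0" for v using assms(2,3) that by (metis le_fun_def order_antisym)
  then show ?thesis using assms(1,3) unfolding standard_degrees_def by blast
qed

lemma mdeg_expo_standard: "a \<in> standard_degrees Z G \<Longrightarrow> mdeg (expo a) = a"
  by (intro mdeg_expo) (simp add: standard_degrees_def)

lemma expo_eq_iff: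
  assumes "a \<in> standard_degrees {} G"
  shows "n = expo a \<longleftrightarrow> mdeg n = a"
  using mdeg_expo_standard[OF assms] by auto

lemma term_vec_smul: "term_vec j m c = smul (single m c) (single j 1)"
  by simp

text \<open>The differentials are homogenised on basis elements. Exactness holds degree by degree: each
  degree part of a cycle is a boundary in its strand, and the finitely many preimages add up to a preimage
  of the whole.\<close>

lemma resolution_of_frame:
  fixes G :: "'n::finite graph" and X :: "('n \<Rightarrow> int, 'k::field) frame"
  assumes G: "simple_graph G" and X: "resolves (standard_degrees {} G) X"
  shows "\<exists>F. graded_free_resolution (quotient_module (edge_ideal G :: ('n, 'k) mpoly set)) F"
proof -
  let ?D = "standard_degrees {} G"
  let ?M = "quotient_module (edge_ideal G :: ('n, 'k) mpoly set)"
  note M = quotient_module_simps[OF G, where ?'k = 'k]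
  define \<Delta> where "\<Delta> i = free_ext (\<lambda>j. homog (dg X i) (dg X (Suc i) j) (df X i (unit j)))" for i
  \<comment> \<open>\<open>q j\<close> represents the augmentation of the \<open>j\<close>-th basis element\<close>
  define q where "q j = (if dg X 0 j \<in> ?D then single (expo (dg X 0 j)) (au X (unit j)) else 0)" for j
  define P where "P f = lookup (free_ext (\<lambda>j. single 0 (q j)) f) 0" for f
  define \<pi> where "\<pi> f = residue_class G (P f)" for f
  define F where "F = \<lparr>rank = rk X, shift = dg X, diff = \<Delta>, aug = \<pi>\<rparr>"
  have F: "rank F = rk X" "shift F = dg X" "diff F = \<Delta>" "aug F = \<pi>"
    "term_at F i = free_module (rk X i) (dg X i)" for i
    by (simp_all add: F_def term_at_def)
  have du: "keys (df X i (unit j)) \<subseteq> {l. l < rk X i \<and> dg X i l \<le> dg X (Suc i) j}"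
    if "j < rk X (Suc i)" for i j
  proof -
    have "df X i (unit j) \<in> strand X i (dg X (Suc i) j)"
      using that by (intro cyc_strand[OF resolvesD(3)[OF X]] unit_strand) auto
    then show ?thesis by (simp add: strand_def)
  qed
  have key\<Delta>: "keys (\<Delta> i f) \<subseteq> {..<rk X i}" if f: "keys f \<subseteq> {..<rk X (Suc i)}" for i f
    unfolding \<Delta>_def
  proof (rule keys_free_ext)
    fix j assume "j \<in> keys f"
    then show "keys (homog (dg X i) (dg X (Suc i) j) (df X i (unit j))) \<subseteq> {..<rk X i}"
      using f du[of j i] keys_homog[of "dg X i" "dg X (Suc i) j" "df X i (unit j)"] by auto
  qed
  have coef\<Delta>: "coef (dg X i) a (\<Delta> i f) = df X i (coef (dg X (Suc i)) a f)"
    if f: "keys f \<subseteq> {..<rk X (Suc i)}" for i a f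
  proof -
    have e: "coef (dg X i) c (\<Delta> i (single j 1)) = (if c = dg X (Suc i) j then df X i (unit j) else 0)"
      if "j < rk X (Suc i)" for j c
      unfolding \<Delta>_def free_ext_unit by (rule coef_homog) (use du[OF that] in auto)
    have "coef (dg X i) a (\<Delta> i f) = dehomog (dg X (Suc i)) (dg X i) (\<Delta> i) (coef (dg X (Suc i)) a f)"
      by (rule coef_dehomog[OF _ _ _ f]) (simp_all add: e, simp_all add: \<Delta>_def free_ext_add free_ext_smul)
    also have "\<dots> = df X i (coef (dg X (Suc i)) a f)"
      unfolding dehomog_def
    proof (rule lin_eq[OF lin_ext resolvesD(1)[OF X]])
      fix j assume "j \<in> keys (coef (dg X (Suc i)) a f)"
      then have "j < rk X (Suc i)" using keys_coef[OF f] by blast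
      then show "ext (\<lambda>j. coef (dg X i) (dg X (Suc i) j) (\<Delta> i (single j 1))) (unit j) = df X i (unit j)"
        by (simp add: e)
    qed
    finally show ?thesis .
  qed
  have strand_coef: "coef (dg X i) a f \<in> strand X i a" if "keys f \<subseteq> {..<rk X i}" for i a f
    using keys_coef[OF that, of "dg X i" a] by (simp add: strand_def)
  have realize': "\<exists>g. keys g \<subseteq> {..<rk X i} \<and> (\<forall>a. coef (dg X i) a g = w a)"
    if "finite {a. w a \<noteq> 0}" "\<And>a. w a \<in> strand X i a" for w i
    using realize[of w "rk X i" "dg X i"] that by (auto simp: strand_def free_module_simps)
  note fa = resolvesD(2)[OF X]
  have P_add: "P (f + g) = P f + P g" for f g by (simp add: P_def free_ext_add lookup_add)
  have P_smul: "P (smul p f) = p * P f" for p f by (simp add: P_def free_ext_smul)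
  have P_unit: "P (single j 1) = q j" for j by (simp add: P_def free_ext_unit)
  have coefP: "lookup (P f) (expo a) = au X (coef (dg X 0) a f)"
    if a: "a \<in> ?D" and f: "keys f \<subseteq> {..<rk X 0}" for a f
    using f
  proof (induction rule: free_vec_induct)
    case zero
    have "P 0 = 0" using P_add[of 0 0] by (metis add_0 add_cancel_right_left)
    then show ?case by (simp add: functional_zero[OF fa])
  next
    case (add f g)
    then show ?case by (simp add: P_add lookup_add coef_add functional_add[OF fa])
  next
    case (monomial j m c)
    let ?s = "dg X 0 j"
    have R: "au X (single j c) = c * au X (unit j)"
      using functional_scale[OF fa, of c "unit j"] by simp
    have L: "P (term_vec j m c) = single m c * q j"
      unfolding term_vec_smul P_smul P_unit ..
    have le: "?s \<le> a" if "a = (\<lambda>v. ?s v + mdeg m v)" using that expo_diff_iff by blast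
    show ?case
    proof (cases "?s \<in> ?D")
      case True
      have "m + expo ?s = expo a \<longleftrightarrow> a = (\<lambda>v. ?s v + mdeg m v)"
        unfolding expo_eq_iff[OF a] using mdeg_expo_standard[OF True]
        by (auto simp: fun_eq_iff mdeg_add add.commute)
      then show ?thesis
        unfolding L coef_term using True functional_zero[OF fa]
        by (simp add: q_def mult_single lookup_single when_def R)
    next
      case False
      then show ?thesis
        unfolding L coef_term using resolvesD(6)[OF X a monomial le] functional_zero[OF fa]
        by (auto simp: q_def R)
    qed
  qed
  have cls: "residue_class G (P f) = residue_class G p \<longleftrightarrow>
      (\<forall>a\<in>?D. au X (coef (dg X 0) a f) = lookup p (expo a))"
    if "keys f \<subseteq> {..<rk X 0}" for f p
    using coefP[OF _ that] by (simp add: residue_class_eq_iff[OF G])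
  have "graded_free_resolution ?M F"
    unfolding graded_free_resolution_def
  proof (intro conjI allI)
    show "graded_hom (term_at F 0) ?M (aug F)"
      unfolding graded_hom_def F free_module_simps
    proof (intro conjI allI ballI)
      show "\<pi> \<in> {f. keys f \<subseteq> {..<rk X 0}} \<rightarrow> carrier ?M" by (auto simp: \<pi>_def M)
      show "\<pi> (x + y) = \<pi> x \<oplus>\<^bsub>?M\<^esub> \<pi> y" for x y
        by (simp add: \<pi>_def M P_add)
      show "\<pi> (smul p x) = p \<odot>\<^bsub>?M\<^esub> \<pi> x" for p x
        by (simp add: \<pi>_def M P_smul)
      show "\<pi> ` component (free_module (rk X 0) (dg X 0)) a \<subseteq> component ?M a" for a
      proof
        fix y assume "y \<in> \<pi> ` component (free_module (rk X 0) (dg X 0)) a"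
        then obtain f where y: "y = residue_class G (P f)" and f: "keys f \<subseteq> {..<rk X 0}"
          "\<And>c. c \<noteq> a \<Longrightarrow> coef (dg X 0) c f = 0"
          by (auto simp: \<pi>_def component_free_module)
        let ?p = "if a \<in> ?D then single (expo a) (au X (coef (dg X 0) a f)) else 0"
        have "homogeneous a ?p"
          using mdeg_expo_standard[of a "{}" G] by (auto simp: homogeneous_def mdeg_def fun_eq_iff)
        moreover have "residue_class G (P f) = residue_class G ?p"
          unfolding cls[OF f(1)]
        proof
          fix c assume c: "c \<in> ?D"
          show "au X (coef (dg X 0) c f) = lookup ?p (expo c)"
          proof (cases "c = a")
            case True then show ?thesis using c by simp
          next
            case False
            then have "\<not> (a \<in> ?D \<and> expo a = expo c)"
              using mdeg_expo_standard[OF c] mdeg_expo_standard[of a "{}" G] by metis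
            then show ?thesis using f(2)[OF False] functional_zero[OF fa]
              by (auto simp: lookup_single when_def)
          qed
        qed
        ultimately show "y \<in> component ?M a" unfolding M y by blast
      qed
    qed
    fix i
    show "graded_hom (term_at F (Suc i)) (term_at F i) (diff F i)"
      unfolding graded_hom_def F free_module_simps
    proof (intro conjI allI ballI)
      show "\<Delta> i \<in> {f. keys f \<subseteq> {..<rk X (Suc i)}} \<rightarrow> {f. keys f \<subseteq> {..<rk X i}}"
        using key\<Delta> by blast
      show "\<Delta> i (x + y) = \<Delta> i x + \<Delta> i y" for x y by (simp add: \<Delta>_def free_ext_add)
      show "\<Delta> i (smul p x) = smul p (\<Delta> i x)" for p x by (simp add: \<Delta>_def free_ext_smul)
      show "\<Delta> i ` component (free_module (rk X (Suc i)) (dg X (Suc i))) a \<subseteq> component (free_module (rk X i) (dg X i)) a" for a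
        using key\<Delta> coef\<Delta> lin_zero[OF resolvesD(1)[OF X]] by (auto simp: component_free_module)
    qed
    have im: "\<exists>g. keys g \<subseteq> {..<rk X (Suc i)} \<and> \<Delta> i g = f"
      if f: "keys f \<subseteq> {..<rk X i}" and c: "\<And>a. coef (dg X i) a f \<in> cyc ?D X i a" for f i
    proof -
      have "\<exists>w. w \<in> strand X (Suc i) a \<and> df X i w = coef (dg X i) a f \<and> (coef (dg X i) a f = 0 \<longrightarrow> w = 0)" for a
      proof (cases "coef (dg X i) a f = 0")
        case True
        then show ?thesis using vec.subspace_0[OF strand_subspace] lin_zero[OF resolvesD(1)[OF X]] by auto
      next
        case False
        then show ?thesis using resolvesD(4)[OF X c] by blast
      qed
      then obtain w where w: "\<And>a. w a \<in> strand X (Suc i) a" "\<And>a. df X i (w a) = coef (dg X i) a f"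
        "\<And>a. coef (dg X i) a f = 0 \<Longrightarrow> w a = 0" by metis
      have "finite {a. w a \<noteq> 0}"
        by (rule finite_subset[OF _ coef_finite[of "dg X i" f]]) (use w(3) in auto)
      then obtain g where g: "keys g \<subseteq> {..<rk X (Suc i)}" "\<And>a. coef (dg X (Suc i)) a g = w a"
        using realize'[of w "Suc i"] w(1) by blast
      have "\<Delta> i g = f" by (rule coef_eqI[of "dg X i"]) (simp add: coef\<Delta>[OF g(1)] g(2) w(2))
      then show ?thesis using g(1) by blast
    qed
    have cycI: "coef (dg X i) a (\<Delta> i g) \<in> cyc ?D X i a" if "keys g \<subseteq> {..<rk X (Suc i)}" for g i a
      unfolding coef\<Delta>[OF that] by (rule resolvesD(3)[OF X strand_coef[OF that]])
    have ker0: "residue_class G (P f) = residue_class G 0 \<longleftrightarrow> (\<forall>a. coef (dg X 0) a f \<in> cyc ?D X 0 a)"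
      if "keys f \<subseteq> {..<rk X 0}" for f
      unfolding cls[OF that] cyc_0 using strand_coef[OF that] by auto
    have ker1: "\<Delta> l f = 0 \<longleftrightarrow> (\<forall>a. coef (dg X (Suc l)) a f \<in> cyc ?D X (Suc l) a)"
      if f: "keys f \<subseteq> {..<rk X (Suc l)}" for f l
    proof -
      have "\<Delta> l f = 0 \<longleftrightarrow> (\<forall>a. coef (dg X l) a (\<Delta> l f) = 0)"
        using coef_eqI[of "dg X l" "\<Delta> l f" 0] by auto
      then show ?thesis using strand_coef[OF f] by (simp add: coef\<Delta>[OF f] cyc_Suc)
    qed
    show "aug F ` carrier (term_at F 0) = carrier ?M"
      unfolding F free_module_simps M(1)
    proof (intro subset_antisym subsetI)
      fix y :: "('n, 'k) mpoly set" assume "y \<in> range (residue_class G)"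
      then obtain p where p: "y = residue_class G p" by blast
      obtain v where v: "\<And>a. a \<in> ?D \<Longrightarrow> v a \<in> strand X 0 a \<and> au X (v a) = 1"
        using resolvesD(5)[OF X] by metis
      define w where "w a = (if a \<in> ?D then vec_scale (lookup p (expo a)) (v a) else 0)" for a
      have "w a \<in> strand X 0 a" for a
        using v[of a] vec.subspace_scale[OF strand_subspace] vec.subspace_0[OF strand_subspace] by (auto simp: w_def)
      moreover have "finite {a. w a \<noteq> 0}"
      proof (rule finite_subset)
        show "{a. w a \<noteq> 0} \<subseteq> mdeg ` keys p"
        proof
          fix a assume "a \<in> {a. w a \<noteq> 0}"
          then have "a \<in> ?D" "lookup p (expo a) \<noteq> 0" by (auto simp: w_def split: if_splits)
          then show "a \<in> mdeg ` keys p"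
            using mdeg_expo_standard[of a "{}" G] by (auto simp: in_keys_iff image_iff intro!: bexI[of _ "expo a"])
        qed
      qed simp
      ultimately obtain f where f: "keys f \<subseteq> {..<rk X 0}" "\<And>a. coef (dg X 0) a f = w a"
        using realize'[of w 0] by blast
      have "residue_class G (P f) = residue_class G p"
        unfolding cls[OF f(1)] f(2) using v functional_scale[OF fa] by (simp add: w_def)
      then show "y \<in> \<pi> ` {f. keys f \<subseteq> {..<rk X 0}}"
        using f(1) p by (intro image_eqI[of _ _ f]) (simp_all add: \<pi>_def)
    qed (auto simp: \<pi>_def)
    show "diff F 0 ` carrier (term_at F 1) = {f \<in> carrier (term_at F 0). aug F f = \<zero>\<^bsub>?M\<^esub>}"
    proof (intro subset_antisym subsetI)
      fix f assume "f \<in> diff F 0 ` carrier (term_at F 1)"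
      then obtain g where "keys g \<subseteq> {..<rk X (Suc 0)}" "f = \<Delta> 0 g" by (auto simp: F free_module_simps)
      then show "f \<in> {f \<in> carrier (term_at F 0). aug F f = \<zero>\<^bsub>?M\<^esub>}"
        using ker0[of f] cycI[of g 0] key\<Delta>[of g 0] by (simp add: F \<pi>_def free_module_simps M)
    next
      fix f assume "f \<in> {f \<in> carrier (term_at F 0). aug F f = \<zero>\<^bsub>?M\<^esub>}"
      then have f: "keys f \<subseteq> {..<rk X 0}" "residue_class G (P f) = residue_class G 0"
        by (auto simp: F \<pi>_def free_module_simps M)
      then obtain g where "keys g \<subseteq> {..<rk X (Suc 0)}" "\<Delta> 0 g = f"
        using im[of f 0] ker0[of f] by blast
      then show "f \<in> diff F 0 ` carrier (term_at F 1)" by (auto simp: F free_module_simps)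
    qed
    show "diff F (Suc i) ` carrier (term_at F (Suc (Suc i))) = {f \<in> carrier (term_at F (Suc i)). diff F i f = 0}"
    proof (intro subset_antisym subsetI)
      fix f assume "f \<in> diff F (Suc i) ` carrier (term_at F (Suc (Suc i)))"
      then obtain g where "keys g \<subseteq> {..<rk X (Suc (Suc i))}" "f = \<Delta> (Suc i) g" by (auto simp: F free_module_simps)
      then show "f \<in> {f \<in> carrier (term_at F (Suc i)). diff F i f = 0}"
        using ker1[of f i] cycI[of g "Suc i"] key\<Delta>[of g "Suc i"] by (simp add: F free_module_simps)
    next
      fix f assume "f \<in> {f \<in> carrier (term_at F (Suc i)). diff F i f = 0}"
      then have f: "keys f \<subseteq> {..<rk X (Suc i)}" "\<Delta> i f = 0" by (auto simp: F free_module_simps)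
      then obtain g where "keys g \<subseteq> {..<rk X (Suc (Suc i))}" "\<Delta> (Suc i) g = f"
        using im[of f "Suc i"] ker1[of f i] by blast
      then show "f \<in> diff F (Suc i) ` carrier (term_at F (Suc (Suc i)))" by (auto simp: F free_module_simps)
    qed
  qed
  then show ?thesis by blast
qed

text \<open>Conversely, any graded free resolution of \<open>R/I(G)\<close> becomes a frame by setting the variables to \<open>1\<close>.
  The augmentation records the coefficient of the only standard monomial in each degree.\<close>

lemma frame_of_resolution:
  fixes G :: "'n::finite graph" and F :: "('n, 'k::field, ('n, 'k) mpoly set) free_complex"
  assumes G: "simple_graph G" and F: "graded_free_resolution (quotient_module (edge_ideal G)) F"
  shows "\<exists>X. resolves (standard_degrees {} G) X \<and> rk X = rank F \<and> dg X = shift F \<and>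
    (\<forall>i f a. keys f \<subseteq> {..<rank F (Suc i)} \<longrightarrow>
       coef (shift F i) a (diff F i f) = df X i (coef (shift F (Suc i)) a f))"
proof -
  let ?D = "standard_degrees {} G"
  let ?M = "quotient_module (edge_ideal G :: ('n, 'k) mpoly set)"
  note M = quotient_module_simps[OF G, where ?'k = 'k]
  let ?N = "\<lambda>i. free_module (rank F i) (shift F i) :: ('n, 'k, nat \<Rightarrow>\<^sub>0 ('n, 'k) mpoly) graded_module"
  have ha: "graded_hom (?N 0) ?M (aug F)" and hd: "\<And>i. graded_hom (?N (Suc i)) (?N i) (diff F i)"
    and surj: "aug F ` carrier (?N 0) = carrier ?M"
    and ex0: "diff F 0 ` carrier (?N 1) = {f \<in> carrier (?N 0). aug F f = \<zero>\<^bsub>?M\<^esub>}"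
    and ex1: "\<And>i. diff F (Suc i) ` carrier (?N (Suc (Suc i))) = {f \<in> carrier (?N (Suc i)). diff F i f = 0}"
    using F unfolding graded_free_resolution_def term_at_def by blast+
  define val where "val a Y = lookup (SOME p. residue_class G p = Y) (expo a)" for a and Y :: "('n, 'k) mpoly set"
  have val: "val a (residue_class G p) = lookup p (expo a)" if "a \<in> ?D" for a p
  proof -
    have "residue_class G (SOME q. residue_class G q = residue_class G p) = residue_class G p"
      by (rule someI) (rule refl)
    then show ?thesis using that unfolding residue_class_eq_iff[OF G] val_def by blast
  qed
  \<comment> \<open>the augmentation of the frame on basis elements; those of non-standard degree go to zero in \<open>R/I(G)\<close>\<close>
  define w where "w j = (if shift F 0 j \<in> ?D then val (shift F 0 j) (aug F (single j 1)) else 0)" for j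
  define X where "X = \<lparr>rk = rank F, dg = shift F,
    df = (\<lambda>i. dehomog (shift F (Suc i)) (shift F i) (diff F i)),
    au = (\<lambda>v. lookup (ext (\<lambda>j. single 0 (w j)) v) 0)\<rparr>"
  have Xs: "rk X = rank F" "dg X = shift F" by (simp_all add: X_def)
  have lX: "lin (df X i)" for i unfolding X_def by (simp add: dehomog_def lin_ext)
  have fX: "functional (au X)"
    using lin_ext[of "\<lambda>j. single 0 (w j)"]
    by (simp add: X_def functional_def lin_def lookup_add lookup_vec_scale)
  have au_unit: "au X (unit j) = w j" for j by (simp add: X_def)
  have cd: "coef (shift F i) a (diff F i f) = df X i (coef (shift F (Suc i)) a f)"
    if "keys f \<subseteq> {..<rank F (Suc i)}" for i a f
    using graded_hom_coef[OF hd that] by (simp add: X_def)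
  have kd: "keys (diff F i f) \<subseteq> {..<rank F i}"
    if "keys f \<subseteq> {..<rank F (Suc i)}" for i f
  proof -
    have "diff F i \<in> carrier (?N (Suc i)) \<rightarrow> carrier (?N i)" using hd[of i] by (simp add: graded_hom_def)
    then show ?thesis using that by (auto simp: free_module_simps)
  qed
  have aug_add: "aug F (f + g) = aug F f \<oplus>\<^bsub>?M\<^esub> aug F g"
    if "keys f \<subseteq> {..<rank F 0}" "keys g \<subseteq> {..<rank F 0}" for f g
    using ha that by (simp add: graded_hom_def free_module_simps)
  have aug_smul: "aug F (smul p f) = p \<odot>\<^bsub>?M\<^esub> aug F f" if "keys f \<subseteq> {..<rank F 0}" for p f
    using ha that by (simp add: graded_hom_def free_module_simps)
  have aug_cls: "\<exists>p. aug F f = residue_class G p" if "keys f \<subseteq> {..<rank F 0}" for f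
  proof -
    have "aug F \<in> carrier (?N 0) \<rightarrow> carrier ?M" using ha by (simp add: graded_hom_def)
    then have "aug F f \<in> carrier ?M" using that by (auto simp: free_module_simps)
    then show ?thesis unfolding M(1) by blast
  qed
  have va: "val a (aug F f) = au X (coef (shift F 0) a f)"
    if a: "a \<in> ?D" and f: "keys f \<subseteq> {..<rank F 0}" for a f
    using f
  proof (induction rule: free_vec_induct)
    case zero
    obtain p where p: "aug F 0 = residue_class G p" using aug_cls[of 0] by auto
    then have "residue_class G (p + p) = residue_class G p" using aug_add[of 0 0] by (simp add: M)
    then have "lookup (p + p) (expo a) = lookup p (expo a)"
      using a unfolding residue_class_eq_iff[OF G] by blast
    then have "lookup p (expo a) = 0"
      by (metis add_cancel_right_left lookup_add)
    then show ?case using p val[OF a] functional_zero[OF fX] by simp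
  next
    case (add f g)
    obtain p q where pq: "aug F f = residue_class G p" "aug F g = residue_class G q"
      using aug_cls[OF add(1)] aug_cls[OF add(2)] by blast
    then have "aug F (f + g) = residue_class G (p + q)" using aug_add[OF add(1,2)] by (simp add: M)
    then show ?case using add(3,4) val[OF a] functional_add[OF fX] pq by (simp add: coef_add lookup_add)
  next
    case (monomial j m c)
    let ?s = "shift F 0 j" and ?e = "single j 1 :: ('n, 'k) free_vec"
    have ke: "keys ?e \<subseteq> {..<rank F 0}" using monomial by simp
    have e: "?e = term_vec j 0 1" by simp
    have "?e \<in> component (?N 0) ?s"
      using ke unfolding component_free_module e coef_term by simp
    moreover have "aug F ` component (?N 0) ?s \<subseteq> component ?M ?s" using ha by (simp add: graded_hom_def)
    ultimately have "aug F ?e \<in> component ?M ?s" by blast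
    then obtain p where p: "aug F ?e = residue_class G p" "homogeneous ?s p" unfolding M by blast
    define x where "x = lookup p (expo ?s)"
    have ks: "mdeg k = ?s" if "lookup p k \<noteq> 0" for k
      using p(2) that by (auto simp: homogeneous_def mdeg_def in_keys_iff fun_eq_iff)
    have px: "p = single (expo ?s) x"
    proof (intro poly_mapping_eqI)
      fix k
      have "lookup p k = 0" if "k \<noteq> expo ?s" using ks[of k] that expo_mdeg[of k] by metis
      then show "lookup p k = lookup (single (expo ?s) x) k"
        by (auto simp: lookup_single when_def x_def)
    qed
    have "aug F (smul (single m c) ?e) = single m c \<odot>\<^bsub>?M\<^esub> aug F ?e"
      by (rule aug_smul[OF ke])
    then have "aug F (term_vec j m c) = residue_class G (single (m + expo ?s) (c * x))"
      unfolding term_vec_smul p(1) M(3) using px by (metis mult_single)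
    then have L: "val a (aug F (term_vec j m c)) = (if m + expo ?s = expo a then c * x else 0)"
      using val[OF a] by (simp add: lookup_single when_def)
    have R: "au X (single j c) = c * w j"
      using functional_scale[OF fX, of c "unit j"] by (simp add: au_unit)
    show ?case
    proof (cases "\<forall>v. 0 \<le> ?s v")
      case True
      then have ms: "mdeg (expo ?s) = ?s" by (intro mdeg_expo) blast
      have iff: "m + expo ?s = expo a \<longleftrightarrow> a = (\<lambda>v. ?s v + mdeg m v)"
        unfolding expo_eq_iff[OF a] using ms by (auto simp: fun_eq_iff mdeg_add add.commute)
      have "w j = x" if "a = (\<lambda>v. ?s v + mdeg m v)"
      proof -
        have "?s \<le> a" using that expo_diff_iff by blast
        then have "?s \<in> ?D" using standard_degrees_down[OF a] True by blast
        then show ?thesis by (simp add: w_def p(1) val x_def)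
      qed
      then show ?thesis unfolding L coef_term iff using functional_zero[OF fX] by (simp add: R)
    next
      case False
      then have "x = 0" using ks[of "expo ?s"] mdeg_nonneg[of "expo ?s"] unfolding x_def by metis
      moreover have "w j = 0" using False by (auto simp: w_def standard_degrees_def)
      ultimately show ?thesis unfolding L coef_term using functional_zero[OF fX] by (simp add: R)
    qed
  qed
  have str: "coef (shift F i) a f \<in> strand X i a" if "keys f \<subseteq> {..<rank F i}" for i a f
    using keys_coef[OF that, of "shift F i" a] by (simp add: strand_def Xs)
  have hom: "keys (homog (shift F i) a v) \<subseteq> {..<rank F i}"
    "coef (shift F i) c (homog (shift F i) a v) = (if c = a then v else 0)"
    if "v \<in> strand X i a" for i a c v
  proof -
    have k: "keys v \<subseteq> {j. j < rank F i \<and> shift F i j \<le> a}" using that by (simp add: strand_def Xs)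
    then show "keys (homog (shift F i) a v) \<subseteq> {..<rank F i}"
      using keys_homog[of "shift F i" a v] by blast
    show "coef (shift F i) c (homog (shift F i) a v) = (if c = a then v else 0)"
      by (rule coef_homog) (use k in blast)
  qed
  have aug0: "aug F f = \<zero>\<^bsub>?M\<^esub> \<longleftrightarrow> (\<forall>a\<in>?D. au X (coef (shift F 0) a f) = 0)"
    if f: "keys f \<subseteq> {..<rank F 0}" for f
  proof -
    obtain p where p: "aug F f = residue_class G p" using aug_cls[OF f] by blast
    have "aug F f = \<zero>\<^bsub>?M\<^esub> \<longleftrightarrow> (\<forall>a\<in>?D. val a (aug F f) = 0)"
      unfolding p M(4) residue_class_eq_iff[OF G] by (simp add: val)
    then show ?thesis using va[OF _ f] by simp
  qed
  have "df X i ` strand X (Suc i) a = cyc ?D X i a" for i a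
  proof (intro subset_antisym subsetI)
    fix v assume "v \<in> df X i ` strand X (Suc i) a"
    then obtain u where u: "u \<in> strand X (Suc i) a" "v = df X i u" by blast
    let ?g = "homog (shift F (Suc i)) a u"
    let ?f = "diff F i ?g"
    have kf: "keys ?f \<subseteq> {..<rank F i}" by (rule kd[OF hom(1)[OF u(1)]])
    have cf: "coef (shift F i) a ?f = v" unfolding cd[OF hom(1)[OF u(1)]] hom(2)[OF u(1)] by (simp add: u(2))
    show "v \<in> cyc ?D X i a"
    proof (cases i)
      case 0
      have "aug F ?f = \<zero>\<^bsub>?M\<^esub>" using ex0 hom(1)[OF u(1)] unfolding 0 free_module_simps by auto
      then show ?thesis using aug0[of ?f] kf cf str[OF kf, of a] unfolding 0 cyc_0 by auto
    next
      case (Suc l)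
      have "diff F l ?f = 0" using ex1[of l] hom(1)[OF u(1)] unfolding Suc free_module_simps by blast
      then have "df X l v = 0" using cd[of ?f l a] kf cf unfolding Suc by simp
      then show ?thesis using cf str[OF kf, of a] unfolding Suc cyc_Suc by simp
    qed
  next
    fix v assume v: "v \<in> cyc ?D X i a"
    let ?f = "homog (shift F i) a v"
    note h = hom[OF cyc_strand[OF v]]
    have "\<exists>g. keys g \<subseteq> {..<rank F (Suc i)} \<and> diff F i g = ?f"
    proof (cases i)
      case 0
      have "aug F ?f = \<zero>\<^bsub>?M\<^esub>"
        using aug0[of ?f] h v functional_zero[OF fX] unfolding 0 cyc_0 by simp
      then have "?f \<in> {f \<in> carrier (?N 0). aug F f = \<zero>\<^bsub>?M\<^esub>}" using h(1) unfolding 0 by (simp add: free_module_simps)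
      then have "?f \<in> diff F 0 ` carrier (?N 1)" using ex0 unfolding 0 by simp
      then show ?thesis unfolding 0 free_module_simps by auto
    next
      case (Suc l)
      have "diff F l ?f = 0"
        by (rule coef_eqI[of "shift F l"]) (use cd[of ?f l] h v lin_zero[OF lX] Suc in \<open>simp add: cyc_Suc\<close>)
      then have "?f \<in> {f \<in> carrier (?N (Suc l)). diff F l f = 0}" using h(1) unfolding Suc by (simp add: free_module_simps)
      then have "?f \<in> diff F (Suc l) ` carrier (?N (Suc (Suc l)))" using ex1[of l] unfolding Suc by simp
      then show ?thesis unfolding Suc free_module_simps by auto
    qed
    then obtain g where g: "keys g \<subseteq> {..<rank F (Suc i)}" "diff F i g = ?f" by blast
    then have "df X i (coef (shift F (Suc i)) a g) = v" using cd[OF g(1), of a] h(2)[of a] by simp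
    then show "v \<in> df X i ` strand X (Suc i) a" using str[OF g(1)] by blast
  qed
  moreover have "\<exists>v\<in>strand X 0 a. au X v = 1" if a: "a \<in> ?D" for a
  proof -
    have "residue_class G (single (expo a) 1) \<in> aug F ` carrier (?N 0)" unfolding surj M by blast
    then obtain f where f: "keys f \<subseteq> {..<rank F 0}" "aug F f = residue_class G (single (expo a) 1)"
      unfolding free_module_simps by auto
    then have "au X (coef (shift F 0) a f) = 1" using va[OF a f(1)] val[OF a] by simp
    then show ?thesis using str[OF f(1)] by blast
  qed
  ultimately have "resolves ?D X"
    unfolding resolves_def using lX fX by (auto simp: au_unit Xs w_def)
  then show ?thesis using Xs cd by blast
qed

section \<open>Betti numbers\<close>

text \<open>After tensoring with \<open>k\<close>, the degree \<open>a\<close> part of the differential is that of the frame, modulo \<open>low\<close>.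
  So \<open>comparison\<close> makes every cycle of degree \<open>a\<close> a boundary.\<close>

lemma tor_vanishes:
  fixes G :: "'n::finite graph" and F :: "('n, 'k::field, ('n, 'k) mpoly set) free_complex"
    and Y :: "('n \<Rightarrow> int, 'k) frame"
  assumes G: "simple_graph G" and F: "graded_free_resolution (quotient_module (edge_ideal G)) F"
    and Y: "resolves (standard_degrees {} G) Y" and no: "\<And>j. j < rk Y i \<Longrightarrow> dg Y i j \<noteq> a"
  shows "tor_dim F i a = 0"
proof -
  let ?D = "standard_degrees {} G"
  obtain X where X: "resolves ?D X" and Xs: "rk X = rank F" "dg X = shift F"
    and cd: "\<And>i f a. keys f \<subseteq> {..<rank F (Suc i)} \<Longrightarrow>
       coef (shift F i) a (diff F i f) = df X i (coef (shift F (Suc i)) a f)"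
    using frame_of_resolution[OF G F] by blast
  note lX = resolvesD(1)[OF X]
  let ?tc = "\<lambda>i. tensor_component F i a :: (nat \<Rightarrow>\<^sub>0 'k) set"
  have tc_strand: "v \<in> strand X i a" if "v \<in> ?tc i" for v i
    using that by (auto simp: tensor_component_def strand_def Xs)
  have td: "lookup (tensor_diff F i v) l =
      (if l < rank F i \<and> shift F i l = a then lookup (df X i v) l else 0)"
    if v: "v \<in> ?tc (Suc i)" for i v l
  proof -
    let ?f = "const_lift v :: ('n, 'k) free_vec"
    have vk: "j < rank F (Suc i) \<and> shift F (Suc i) j = a" if "lookup v j \<noteq> 0" for j
      using v that by (auto simp: tensor_component_def in_keys_iff)
    have lf: "lookup ?f j = single 0 (lookup v j)" for j
      by (simp add: const_lift_def map.rep_eq when_def)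
    have kf: "keys ?f \<subseteq> {..<rank F (Suc i)}"
    proof
      fix j assume "j \<in> keys ?f"
      then have "lookup v j \<noteq> 0" by (auto simp: in_keys_iff lf)
      then show "j \<in> {..<rank F (Suc i)}" using vk by simp
    qed
    have e0: "expo (\<lambda>v. 0) = (0 :: 'n \<Rightarrow>\<^sub>0 nat)" by (intro poly_mapping_eqI) (simp add: expo.rep_eq)
    have cf: "coef (shift F (Suc i)) c ?f = (if c = a then v else 0)" for c
    proof (intro poly_mapping_eqI)
      fix j
      have "shift F (Suc i) j \<le> c \<and> expo (\<lambda>v. c v - shift F (Suc i) j v) = 0 \<longleftrightarrow> c = shift F (Suc i) j"
        unfolding expo_diff_iff by simp
      then show "lookup (coef (shift F (Suc i)) c ?f) j = lookup (if c = a then v else 0) j"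
        using vk[of j] by (auto simp: coef.rep_eq lf lookup_single when_def)
    qed
    have cdf: "coef (shift F i) c (diff F i ?f) = (if c = a then df X i v else 0)" for c
      unfolding cd[OF kf] cf by (simp add: lin_zero[OF lX])
    have "lookup (tensor_diff F i v) l = lookup (lookup (diff F i ?f) l) 0"
      by (simp add: tensor_diff_def tensor_one_def map.rep_eq when_def)
    also have "\<dots> = lookup (coef (shift F i) (shift F i l) (diff F i ?f)) l"
      using coef_at[of "shift F i" l 0 "diff F i ?f"] by simp
    also have "\<dots> = (if shift F i l = a then lookup (df X i v) l else 0)"
      unfolding cdf by simp
    also have "\<dots> = (if l < rank F i \<and> shift F i l = a then lookup (df X i v) l else 0)"
    proof -
      have "df X i v \<in> strand X i a" by (rule cyc_strand[OF resolvesD(3)[OF X tc_strand[OF v]]])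
      then have "lookup (df X i v) l = 0" if "\<not> l < rank F i"
        using that by (auto simp: strand_def Xs in_keys_iff subset_iff)
      then show ?thesis by simp
    qed
    finally show ?thesis .
  qed
  have lowI: "u \<in> low X i a" if "u \<in> strand X i a"
    "\<And>l. l < rank F i \<Longrightarrow> shift F i l = a \<Longrightarrow> lookup u l = 0" for u i
    unfolding low_def Xs
  proof (intro CollectI subsetI)
    fix l assume l: "l \<in> keys u"
    have "l < rank F i" "shift F i l \<le> a" using strandD[OF that(1) l] by (simp_all add: Xs)
    moreover have "shift F i l \<noteq> a" using that(2)[OF calculation(1)] l by (auto simp: in_keys_iff)
    ultimately show "l < rank F i \<and> shift F i l < a" by (simp add: order.strict_iff_order)
  qed
  have lowD: "lookup u l = 0" if "u \<in> low X i a" "shift F i l = a" for u i l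
  proof (rule ccontr)
    assume "lookup u l \<noteq> 0"
    then have "l \<in> keys u" by (simp add: in_keys_iff)
    then have "shift F i l < a" using that(1) unfolding low_def Xs by blast
    then show False using that(2) by simp
  qed
  have dlow: "df X i u \<in> low X i a" if "u \<in> low X (Suc i) a" for u i
    by (rule graded_low[OF lX cyc_strand[OF resolvesD(3)[OF X]] that])
  have td_low: "df X i v - tensor_diff F i v \<in> low X i a" "tensor_diff F i v \<in> ?tc i" if v: "v \<in> ?tc (Suc i)" for i v
  proof -
    show tci: "tensor_diff F i v \<in> ?tc i"
      unfolding tensor_component_def by (auto simp: in_keys_iff td[OF v] split: if_splits)
    have "df X i v \<in> strand X i a" by (rule cyc_strand[OF resolvesD(3)[OF X tc_strand[OF v]]])
    then have "df X i v - tensor_diff F i v \<in> strand X i a"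
      using tc_strand[OF tci] by (intro vec.subspace_diff[OF strand_subspace])
    then show "df X i v - tensor_diff F i v \<in> low X i a"
      by (rule lowI) (simp add: td[OF v] lookup_minus)
  qed
  have td_eq: "tensor_diff F i v = u" if "v \<in> ?tc (Suc i)" "u \<in> ?tc i" "df X i v - u \<in> low X i a" for i u v
  proof (intro poly_mapping_eqI)
    fix l
    have "lookup u l = 0" if "\<not> (l < rank F i \<and> shift F i l = a)"
      using \<open>u \<in> ?tc i\<close> that by (auto simp: tensor_component_def in_keys_iff)
    then show "lookup (tensor_diff F i v) l = lookup u l"
      using lowD[OF that(3), of l] by (auto simp: td[OF that(1)] lookup_minus)
  qed
  have zero_tc: "0 \<in> ?tc i" for i by (simp add: tensor_component_def)
  \<comment> \<open>each element of a strand is, modulo \<open>low\<close>, its part on basis elements of degree exactly \<open>a\<close>\<close>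
  have top: "\<exists>w'\<in>?tc i. w - w' \<in> low X i a" if w: "w \<in> strand X i a" for w i
  proof -
    let ?g = "\<lambda>j. if shift F i j = a then unit j else (0 :: nat \<Rightarrow>\<^sub>0 'k)"
    let ?w = "ext ?g w"
    have lw: "lookup ?w l = (if shift F i l = a then lookup w l else 0)" for l
    proof -
      have "lookup ?w l = (\<Sum>j\<in>keys w. if j = l then (if shift F i l = a then lookup w l else 0) else 0)"
        unfolding ext_def lookup_sum by (intro sum.cong) (auto simp: lookup_vec_scale lookup_single when_def)
      then show ?thesis by (simp add: sum.delta in_keys_iff)
    qed
    have tw: "?w \<in> ?tc i"
      using w by (auto simp: tensor_component_def in_keys_iff lw strand_def Xs subset_iff split: if_splits)
    have "w - ?w \<in> strand X i a" using w tc_strand[OF tw] by (intro vec.subspace_diff[OF strand_subspace])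
    then have "w - ?w \<in> low X i a" by (rule lowI) (simp add: lookup_minus lw)
    then show ?thesis using tw by blast
  qed
  have "tor_cycles F i a = tor_boundaries F i a"
  proof (intro subset_antisym subsetI)
    fix v assume "v \<in> tor_cycles F i a"
    then have v: "v \<in> ?tc i" "\<And>l. i = Suc l \<Longrightarrow> tensor_diff F l v = 0" by (auto simp: tor_cycles_def)
    have "df X l v \<in> low X l a" if "i = Suc l" for l
      using td_low(1)[of v l] v that by simp
    then obtain w where w: "w \<in> strand X (Suc i) a" "v - df X i w \<in> low X i a"
      using comparison[OF X Y no tc_strand[OF v(1)]] by blast
    obtain w' where w': "w' \<in> ?tc (Suc i)" "w - w' \<in> low X (Suc i) a" using top[OF w(1)] by blast
    have "df X i w' - v = - ((v - df X i w) + df X i (w - w'))"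
      by (simp add: lin_diff[OF lX])
    also have "\<dots> \<in> low X i a"
      by (intro vec.subspace_neg[OF low_subspace] vec.subspace_add[OF low_subspace] w(2) dlow w'(2))
    finally have "tensor_diff F i w' = v" by (intro td_eq[OF w'(1) v(1)])
    then show "v \<in> tor_boundaries F i a" using w'(1) unfolding tor_boundaries_def by blast
  next
    fix v assume "v \<in> tor_boundaries F i a"
    then obtain w where w: "w \<in> ?tc (Suc i)" "v = tensor_diff F i w" by (auto simp: tor_boundaries_def)
    have tv: "v \<in> ?tc i" using td_low(2)[OF w(1)] w(2) by simp
    have "tensor_diff F l v = 0" if i: "i = Suc l" for l
    proof (rule td_eq)
      have "df X i w \<in> cyc ?D X i a" by (rule resolvesD(3)[OF X tc_strand[OF w(1)]])
      then have "df X l (df X i w) = 0" unfolding i cyc_Suc by simp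
      then have "df X l v - 0 = - df X l (df X i w - v)" by (simp add: lin_diff[OF lX])
      also have "\<dots> \<in> low X l a"
        using td_low(1)[OF w(1)] w(2) i by (intro vec.subspace_neg[OF low_subspace] dlow) simp
      finally show "df X l v - 0 \<in> low X l a" .
    qed (use tv i zero_tc in simp_all)
    then show "v \<in> tor_cycles F i a" using tv unfolding tor_cycles_def by (cases i) auto
  qed
  then show ?thesis by (simp add: tor_dim_def)
qed

theorem theorem3p4:
  fixes G :: "'n::finite graph" and \<sigma> :: "'n set" and r :: int
  assumes "simple_graph G" and "verts G = UNIV" and "edges G \<noteq> {}"
    and "weakly_chordal G"
    and "\<sigma> \<noteq> {}"
    and "multigraded_betti (quotient_module (edge_ideal G :: ('n, 'k::field) mpoly set))
           (int (card \<sigma>) - r) (indicator \<sigma>) \<noteq> 0"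
  shows "\<exists>Bs. int (length Bs) = r \<and> strongly_disjoint G Bs \<and> \<sigma> = (\<Union>B\<in>set Bs. verts B)"
proof -
  let ?M = "quotient_module (edge_ideal G :: ('n, 'k) mpoly set)"
  let ?i = "int (card \<sigma>) - r"
  obtain Y :: "('n \<Rightarrow> int, 'k) frame" where Y: "resolves (standard_degrees {} G) Y"
    "\<forall>i. \<forall>j<rk Y i. covered G {} i (dg Y i j)"
    using graph_frame[OF assms(1,4), of "{}", where ?'k = 'k] by auto
  have res: "graded_free_resolution ?M (SOME F. graded_free_resolution ?M F)"
    using resolution_of_frame[OF assms(1) Y(1)] by (rule someI_ex)
  have i: "0 \<le> ?i" and tor: "tor_dim (SOME F. graded_free_resolution ?M F) (nat ?i) (indicator \<sigma>) \<noteq> 0"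
    using assms(6) by (auto simp: multigraded_betti_def split: if_splits)
  have "\<exists>j<rk Y (nat ?i). dg Y (nat ?i) j = indicator \<sigma>"
  proof (rule ccontr)
    assume "\<not> ?thesis"
    then have no: "dg Y (nat ?i) j \<noteq> indicator \<sigma>" if "j < rk Y (nat ?i)" for j
      using that by blast
    show False using tor_vanishes[OF assms(1) res Y(1) no] tor by simp
  qed
  then obtain j where j: "j < rk Y (nat ?i)" "dg Y (nat ?i) j = indicator \<sigma>" by blast
  have "covered G {} (nat ?i) (indicator \<sigma>)" using Y(2)[rule_format, OF j(1)] j(2) by simp
  then obtain \<tau> Bs where \<tau>: "(indicator \<sigma> :: 'n \<Rightarrow> int) = indicator \<tau>" "nat ?i + length Bs = card \<tau>"
    "strongly_disjoint G Bs" "\<tau> - {} = (\<Union>B\<in>set Bs. verts B)"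
    unfolding covered_def by blast
  have "v \<in> \<sigma> \<longleftrightarrow> v \<in> \<tau>" for v
    using fun_cong[OF \<tau>(1), of v] by (cases "v \<in> \<sigma>"; cases "v \<in> \<tau>") simp_all
  then have "\<sigma> = \<tau>" by blast
  then have "int (length Bs) = r" using arg_cong[OF \<tau>(2), of int] i by simp
  then show ?thesis using \<tau>(3,4) \<open>\<sigma> = \<tau>\<close> by auto
qed

end
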